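(* There is an isomorphism of $\mathbb Z$-algebras $$\mathcal H_{I^\flat}(\mathbb Z)\simeq\mathbb Z[\widetilde\Omega^\flat]\otimes'\mathcal H^{\mathrm{aff}}_{I^\flat}(\mathbb Z),$$ where $\otimes'$ indicates that the tensor product of $\mathbb Z$-modules $\mathbb Z[\widetilde\Omega^\flat]\otimes_{\mathbb Z}\mathcal H^{\mathrm{aff}}_{I^\flat}(\mathbb Z)$ is endowed with the twisted multiplication $$(\sigma\otimes i_w^\flat)(\sigma'\otimes i_{w'}^\flat)=\sigma\sigma'\otimes\bigl(i^\flat_{\sigma'^{-1}w\sigma'}*_{I^\flat}i^\flat_{w'}\bigr)$$ for all $\sigma,\sigma'\in\widetilde\Omega^\flat$ and all $w,w'\in W_{\mathrm{aff}}^\flat$.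
   Context: Let $F$ be a non-archimedean local field. Let $\mathbf G$ be a connected reductive group over $F$, $\mathbf S$ a maximal $F$-split torus, $\mathbf M$ and $\mathbf N$ its centralizer and normalizer; ordinary capitals denote groups of $F$-points. Let $\mathcal A$ be the apartment of $\mathbf S$ in the reduced Bruhat--Tits building of $\mathbf G$, on which $N$ acts; fix an alcove $\mathfrak a\subset\mathcal A$. Let $M_1\subset M$, $G_1\subset G$ be the kernels of the Kottwitz homomorphisms. The Iwahori subgroup $I$ is the subgroup of $G_1$ fixing $\mathfrak a$ pointwise. Fix an open compact subgroup $M^\flat$ with $M_1\subset M^\flat\subset M$ (automatically normal in $N$). For $X\subset G$ put $X^\flat=M^\flat X$; $I^\flat$ and $G_1^\flat$ are groups. Put $\widetilde W^\flat=N/M^\flat$, $W^\flat_{\mathrm{aff}}=(N\cap G_1)^\flat/M^\flat$, and let $\widetilde\Omega^\flat$ be the stabilizer of $\mathfrak a$ in $\widetilde W^\flat$, so that $\widetilde W^\flat=W^\flat_{\mathrm{aff}}\rtimes\widetilde\Omega^\flat$. $\mathcal H_{I^\flat}(\mathbb Z)$ is the ring of compactly supported $I^\flat$-bi-invariant functions $G\to\mathbb Z$ under convolution $*_{I^\flat}$ for the Haar measure giving $I^\flat$ volume $1$; it has $\mathbb Z$-basis $i^\flat_w=\mathbf 1_{I^\flat wI^\flat}$, $w\in\widetilde W^\flat$. $\mathcal H^{\mathrm{aff}}_{I^\flat}(\mathbb Z)$ is the subalgebra of functions supported on $G_1^\flat$; it has $\mathbb Z$-basis $i^\flat_w$, $w\in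 W^\flat_{\mathrm{aff}}$. *)

theory Defs
  imports
    "HOL-Analysis.Bochner_Integration"
    "HOL-Analysis.Function_Topology"
    "HOL-Algebra.Algebra"
    "HOL-Algebra.Algebraic_Closure_Type"
    "HOL-Algebra.Free_Abelian_Groups"
    "Jordan_Normal_Form.Determinant"
begin

no_notation var (\<open>X\<index>\<close>)

section \<open>Linear algebraic groups\<close>

text \<open>
  Linear algebraic groups are treated in the style of Borel: such a group is a Zariski closed
  subgroup of \<open>GL n\<close> over an algebraically closed field, which is the whole type \<open>'k\<close>. Fields
  of definition are subsets of \<open>'k\<close>. In the application \<open>'k\<close> is \<open>'f alg_closure\<close> for a local
  field \<open>'f\<close>, whose copy inside the closure is \<open>range to_ac\<close>.
\<close>

definition GL :: "nat \<Rightarrow> 'k::field mat monoid" where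
  "GL n = units_of (ring_mat TYPE('k) n ())"

abbreviation grp :: "nat \<Rightarrow> 'k::field mat set \<Rightarrow> 'k mat monoid" where
  "grp n X \<equiv> (GL n)\<lparr>carrier := X\<rparr>"

definition points :: "'k::field set \<Rightarrow> 'k mat set \<Rightarrow> 'k mat set" where
  "points E X = {x \<in> X. elements_mat x \<subseteq> E}"

inductive_set polyfun :: "nat \<Rightarrow> 'k::field set \<Rightarrow> ('k mat \<Rightarrow> 'k) set" for n E where
  const: "c \<in> E \<Longrightarrow> (\<lambda>_. c) \<in> polyfun n E"
| coord: "i < n \<Longrightarrow> j < n \<Longrightarrow> (\<lambda>x. x $$ (i, j)) \<in> polyfun n E"
| add: "f \<in> polyfun n E \<Longrightarrow> g \<in> polyfun n E \<Longrightarrow> (\<lambda>x. f x + g x) \<in> polyfun n E"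
| mult: "f \<in> polyfun n E \<Longrightarrow> g \<in> polyfun n E \<Longrightarrow> (\<lambda>x. f x * g x) \<in> polyfun n E"

definition regfun :: "nat \<Rightarrow> 'k::field set \<Rightarrow> ('k mat \<Rightarrow> 'k) set" where
  "regfun n E = {\<phi>. \<exists>f\<in>polyfun n E. \<exists>k::nat. \<forall>x\<in>carrier (GL n). \<phi> x = f x / Determinant.det x ^ k}"

definition zariski_closed :: "nat \<Rightarrow> 'k::field mat set \<Rightarrow> bool" where
  "zariski_closed n X \<longleftrightarrow> (\<exists>P\<subseteq>polyfun n UNIV. X = {x \<in> carrier (GL n). \<forall>f\<in>P. f x = 0})"

definition vanishing :: "nat \<Rightarrow> 'k::field set \<Rightarrow> 'k mat set \<Rightarrow> ('k mat \<Rightarrow> 'k) set" where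
  "vanishing n E X = {f \<in> polyfun n E. \<forall>x\<in>X. f x = 0}"

text \<open>
  Over an imperfect field it is not enough that \<open>X\<close> is the zero set of polynomials over \<open>E\<close>:
  the whole vanishing ideal has to be spanned by its elements with coefficients in \<open>E\<close>.
\<close>

definition defined_over :: "nat \<Rightarrow> 'k::field set \<Rightarrow> 'k mat set \<Rightarrow> bool" where
  "defined_over n E X \<longleftrightarrow> zariski_closed n X \<and>
     (\<forall>f\<in>vanishing n UNIV X. \<exists>(d::nat) c h. (\<forall>i<d. h i \<in> vanishing n E X) \<and>
        (\<forall>x\<in>carrier_mat n n. f x = (\<Sum>i<d. c i * h i x)))"

definition alg_group :: "nat \<Rightarrow> 'k::field mat set \<Rightarrow> bool" where
  "alg_group n X \<longleftrightarrow> subgroup X (GL n) \<and> zariski_closed n X"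

definition zconnected :: "nat \<Rightarrow> 'k::field mat set \<Rightarrow> bool" where
  "zconnected n X \<longleftrightarrow> \<not> (\<exists>A B. zariski_closed n A \<and> zariski_closed n B \<and>
     A \<noteq> {} \<and> B \<noteq> {} \<and> A \<inter> B = {} \<and> A \<union> B = X)"

definition unipotent :: "nat \<Rightarrow> 'k::field mat set \<Rightarrow> bool" where
  "unipotent n X \<longleftrightarrow> (\<forall>x\<in>X. (x - 1\<^sub>m n) ^\<^sub>m n = 0\<^sub>m n n)"

definition connected_reductive :: "nat \<Rightarrow> 'k::field set \<Rightarrow> 'k mat set \<Rightarrow> bool" where
  "connected_reductive n E G \<longleftrightarrow> alg_group n G \<and> defined_over n E G \<and> zconnected n G \<and>
     (\<forall>U. alg_group n U \<and> zconnected n U \<and> unipotent n U \<and> U \<lhd> grp n G \<longrightarrow> U = {1\<^sub>m n})"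

definition alg_hom ::
  "'k::field set \<Rightarrow> nat \<Rightarrow> 'k mat set \<Rightarrow> nat \<Rightarrow> 'k mat set \<Rightarrow> ('k mat \<Rightarrow> 'k mat) set" where
  "alg_hom E n X m Y = {\<phi> \<in> hom (grp n X) (grp m Y).
     \<forall>i<m. \<forall>j<m. \<exists>f\<in>regfun n E. \<forall>x\<in>X. \<phi> x $$ (i, j) = f x}"

text \<open>
  \<open>Y\<close> is the quotient of \<open>X\<close> by the kernel of \<open>p\<close>. The last clause (functions constant on the
  fibres descend) is what excludes inseparable \<open>p\<close>, so that
  \<open>1 \<rightarrow> ker p \<rightarrow> X \<rightarrow> Y \<rightarrow> 1\<close> is exact as a sequence of group schemes with smooth kernel.
\<close>

definition alg_quotient ::
  "'k::field set \<Rightarrow> nat \<Rightarrow> 'k mat set \<Rightarrow> nat \<Rightarrow> 'k mat set \<Rightarrow> ('k mat \<Rightarrow> 'k mat) \<Rightarrow> bool" where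
  "alg_quotient E n X m Y p \<longleftrightarrow> p \<in> alg_hom E n X m Y \<and> p ` X = Y \<and>
     (\<forall>f\<in>regfun n UNIV. (\<forall>x\<in>X. \<forall>y\<in>X. p x = p y \<longrightarrow> f x = f y) \<longrightarrow>
        (\<exists>h\<in>regfun m UNIV. \<forall>x\<in>X. f x = h (p x)))"

subsection \<open>Tori, characters and cocharacters\<close>

definition torus :: "nat \<Rightarrow> 'k::field mat set \<Rightarrow> bool" where
  "torus n T \<longleftrightarrow> alg_group n T \<and> zconnected n T \<and>
     (\<exists>g\<in>carrier (GL n). \<forall>t\<in>T. diagonal_mat (g * t * inv\<^bsub>GL n\<^esub> g))"

definition split_torus :: "nat \<Rightarrow> 'k::field set \<Rightarrow> 'k mat set \<Rightarrow> bool" where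
  "split_torus n E T \<longleftrightarrow> alg_group n T \<and> zconnected n T \<and> defined_over n E T \<and>
     (\<exists>g\<in>points E (carrier (GL n)). \<forall>t\<in>T. diagonal_mat (g * t * inv\<^bsub>GL n\<^esub> g))"

definition maximal_torus :: "nat \<Rightarrow> 'k::field mat set \<Rightarrow> 'k mat set \<Rightarrow> bool" where
  "maximal_torus n G T \<longleftrightarrow> torus n T \<and> T \<subseteq> G \<and>
     (\<forall>T'. torus n T' \<and> T \<subseteq> T' \<and> T' \<subseteq> G \<longrightarrow> T' = T)"

definition maximal_split_torus ::
  "nat \<Rightarrow> 'k::field set \<Rightarrow> 'k mat set \<Rightarrow> 'k mat set \<Rightarrow> bool" where
  "maximal_split_torus n E G S \<longleftrightarrow> split_torus n E S \<and> S \<subseteq> G \<and>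
     (\<forall>S'. split_torus n E S' \<and> S \<subseteq> S' \<and> S' \<subseteq> G \<longrightarrow> S' = S)"

definition centralizer_in :: "'k::field mat set \<Rightarrow> 'k mat set \<Rightarrow> 'k mat set" where
  "centralizer_in G S = {g \<in> G. \<forall>s\<in>S. g * s = s * g}"

definition normalizer_in :: "nat \<Rightarrow> 'k::field mat set \<Rightarrow> 'k mat set \<Rightarrow> 'k mat set" where
  "normalizer_in n G S = {g \<in> G. (\<lambda>s. g * s * inv\<^bsub>GL n\<^esub> g) ` S = S}"

definition character_group ::
  "'k::field set \<Rightarrow> nat \<Rightarrow> 'k mat set \<Rightarrow> ('k mat \<Rightarrow> 'k) monoid" where
  "character_group E n X = \<lparr>
     carrier = {\<xi> \<in> extensional X. (\<forall>x\<in>X. \<xi> x \<noteq> 0) \<and> (\<forall>x\<in>X. \<forall>y\<in>X. \<xi> (x * y) = \<xi> x * \<xi> y) \<and>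
        (\<exists>f\<in>regfun n E. \<forall>x\<in>X. \<xi> x = f x)},
     monoid.mult = (\<lambda>\<xi> \<psi>. \<lambda>x\<in>X. \<xi> x * \<psi> x),
     one = (\<lambda>x\<in>X. 1)\<rparr>"

definition cocharacter_group :: "nat \<Rightarrow> 'k::field mat set \<Rightarrow> ('k \<Rightarrow> 'k mat) monoid" where
  "cocharacter_group n T = \<lparr>
     carrier = {\<mu> \<in> (-{0}) \<rightarrow>\<^sub>E T. (\<forall>s t. s \<noteq> 0 \<longrightarrow> t \<noteq> 0 \<longrightarrow> \<mu> (s * t) = \<mu> s * \<mu> t) \<and>
        (\<forall>i<n. \<forall>j<n. \<exists>(p::'k poly) k::nat. \<forall>t. t \<noteq> 0 \<longrightarrow> \<mu> t $$ (i, j) = poly p t / t ^ k)},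
     monoid.mult = (\<lambda>\<mu> \<mu>'. \<lambda>t\<in>-{0}. \<mu> t * \<mu>' t),
     one = (\<lambda>t\<in>-{0}. 1\<^sub>m n)\<rparr>"

definition pairing :: "('k::field mat \<Rightarrow> 'k) \<Rightarrow> ('k \<Rightarrow> 'k mat) \<Rightarrow> int" where
  "pairing \<xi> \<mu> = (THE k. \<forall>t. t \<noteq> 0 \<longrightarrow> \<xi> (\<mu> t) = t powi k)"

subsection \<open>Roots and root groups\<close>

text \<open>The tangent space at the identity: \<open>f (1 + t A)\<close> has no linear term in \<open>t\<close>.\<close>

definition lie :: "nat \<Rightarrow> 'k::field mat set \<Rightarrow> 'k mat set" where
  "lie n X = {A \<in> carrier_mat n n. \<forall>f\<in>vanishing n UNIV X. \<forall>p.
     (\<forall>t. poly p t = f (1\<^sub>m n + t \<cdot>\<^sub>m A)) \<longrightarrow> poly.coeff p 1 = 0}"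

definition weight_space ::
  "nat \<Rightarrow> 'k::field mat set \<Rightarrow> 'k mat set \<Rightarrow> ('k mat \<Rightarrow> 'k) \<Rightarrow> 'k mat set" where
  "weight_space n G S \<xi> = {A \<in> lie n G. \<forall>s\<in>S. s * A * inv\<^bsub>GL n\<^esub> s = \<xi> s \<cdot>\<^sub>m A}"

definition roots :: "nat \<Rightarrow> 'k::field mat set \<Rightarrow> 'k mat set \<Rightarrow> ('k mat \<Rightarrow> 'k) set" where
  "roots n G S = {a \<in> carrier (character_group UNIV n S).
     a \<noteq> \<one>\<^bsub>character_group UNIV n S\<^esub> \<and> weight_space n G S a \<noteq> {0\<^sub>m n n}}"

abbreviation neg_char ::
  "nat \<Rightarrow> 'k::field mat set \<Rightarrow> ('k mat \<Rightarrow> 'k) \<Rightarrow> ('k mat \<Rightarrow> 'k)" where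
  "neg_char n S a \<equiv> inv\<^bsub>character_group UNIV n S\<^esub> a"

abbreviation double_char ::
  "nat \<Rightarrow> 'k::field mat set \<Rightarrow> ('k mat \<Rightarrow> 'k) \<Rightarrow> ('k mat \<Rightarrow> 'k)" where
  "double_char n S a \<equiv> a \<otimes>\<^bsub>character_group UNIV n S\<^esub> a"

text \<open>
  The group \<open>U\<^sub>a\<close>, with Lie algebra the sum of the root spaces of \<open>a\<close> and \<open>2a\<close>
  (Borel, Linear Algebraic Groups, 21.9). If \<open>2a\<close> is not a root, then \<open>U\<^sub>2\<^sub>a\<close> is trivial.
\<close>

definition root_group ::
  "nat \<Rightarrow> 'k::field mat set \<Rightarrow> 'k mat set \<Rightarrow> ('k mat \<Rightarrow> 'k) \<Rightarrow> 'k mat set" where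
  "root_group n G S a = (THE U. U \<subseteq> G \<and> alg_group n U \<and> zconnected n U \<and> unipotent n U \<and>
     (\<forall>m\<in>centralizer_in G S. (\<lambda>u. m * u * inv\<^bsub>GL n\<^esub> m) ` U = U) \<and>
     lie n U = {A + B | A B. A \<in> weight_space n G S a \<and>
                             B \<in> weight_space n G S (double_char n S a)})"

definition coroot ::
  "nat \<Rightarrow> 'k::field mat set \<Rightarrow> 'k mat set \<Rightarrow> ('k mat \<Rightarrow> 'k) \<Rightarrow> ('k \<Rightarrow> 'k mat)" where
  "coroot n G T a = (THE \<mu>. \<mu> \<in> carrier (cocharacter_group n T) \<and> pairing a \<mu> = 2 \<and>
     (\<forall>t. t \<noteq> 0 \<longrightarrow>
        \<mu> t \<in> generate (GL n) (root_group n G T a \<union> root_group n G T (neg_char n T a))))"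

definition simply_connected_semisimple :: "nat \<Rightarrow> 'k::field mat set \<Rightarrow> bool" where
  "simply_connected_semisimple n H \<longleftrightarrow> connected_reductive n UNIV H \<and>
     (\<exists>T. maximal_torus n H T \<and>
        generate (cocharacter_group n T) (coroot n H T ` roots n H T)
          = carrier (cocharacter_group n T))"

section \<open>Fields and valuations\<close>

definition subfield_set :: "'k::field set \<Rightarrow> bool" where
  "subfield_set E \<longleftrightarrow> 0 \<in> E \<and> 1 \<in> E \<and>
     (\<forall>x\<in>E. \<forall>y\<in>E. x - y \<in> E \<and> x * y \<in> E) \<and> (\<forall>x\<in>E. inverse x \<in> E)"

definition finite_ext :: "'k::field set \<Rightarrow> 'k set \<Rightarrow> bool" where
  "finite_ext L E \<longleftrightarrow> subfield_set L \<and> subfield_set E \<and> L \<subseteq> E \<and>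
     (\<exists>B. finite B \<and> B \<subseteq> E \<and> (\<forall>x\<in>E. \<exists>c. (\<forall>b\<in>B. c b \<in> L) \<and> x = (\<Sum>b\<in>B. c b * b)))"

definition aut_over :: "'k::field set \<Rightarrow> ('k \<Rightarrow> 'k) set" where
  "aut_over L = {\<sigma>. bij \<sigma> \<and> (\<forall>x y. \<sigma> (x + y) = \<sigma> x + \<sigma> y) \<and> (\<forall>x y. \<sigma> (x * y) = \<sigma> x * \<sigma> y) \<and>
     (\<forall>x\<in>L. \<sigma> x = x)}"

definition galois_ext :: "'k::field set \<Rightarrow> 'k set \<Rightarrow> bool" where
  "galois_ext L E \<longleftrightarrow> finite_ext L E \<and> (\<forall>\<sigma>\<in>aut_over L. \<sigma> ` E = E) \<and>
     {x \<in> E. \<forall>\<sigma>\<in>aut_over L. \<sigma> x = x} = L"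

definition galois_group :: "'k::field set \<Rightarrow> 'k set \<Rightarrow> ('k \<Rightarrow> 'k) set" where
  "galois_group L E = (\<lambda>\<sigma>. restrict \<sigma> E) ` aut_over L"

text \<open>
  \<open>\<omega>\<close> is the normalized valuation of the field; its value at \<open>0\<close> is irrelevant.
\<close>

definition nonarch_local_field :: "('f::field \<Rightarrow> int) \<Rightarrow> bool" where
  "nonarch_local_field \<omega> \<longleftrightarrow>
     (\<forall>x y. x \<noteq> 0 \<longrightarrow> y \<noteq> 0 \<longrightarrow> \<omega> (x * y) = \<omega> x + \<omega> y) \<and>
     (\<forall>x y. x \<noteq> 0 \<longrightarrow> y \<noteq> 0 \<longrightarrow> x + y \<noteq> 0 \<longrightarrow> min (\<omega> x) (\<omega> y) \<le> \<omega> (x + y)) \<and>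
     (\<exists>x. x \<noteq> 0 \<and> \<omega> x = 1) \<and>
     \<comment> \<open>complete\<close>
     (\<forall>X::nat \<Rightarrow> 'f.
        (\<forall>k. \<exists>N. \<forall>i\<ge>N. \<forall>j\<ge>N. X i = X j \<or> k \<le> \<omega> (X i - X j)) \<longrightarrow>
        (\<exists>x. \<forall>k. \<exists>N. \<forall>i\<ge>N. X i = x \<or> k \<le> \<omega> (X i - x))) \<and>
     \<comment> \<open>finite residue field\<close>
     (\<exists>R. finite R \<and> (\<forall>x. x = 0 \<or> 0 \<le> \<omega> x \<longrightarrow> (\<exists>r\<in>R. x = r \<or> 0 < \<omega> (x - r))))"

text \<open>The unique extension of \<open>\<omega>\<close> to a valuation of the algebraic closure (with dummy value at 0).\<close>

definition ext_val :: "('f::field \<Rightarrow> int) \<Rightarrow> 'f alg_closure \<Rightarrow> real" where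
  "ext_val \<omega> = (THE v. v 0 = 0 \<and> (\<forall>x. x \<noteq> 0 \<longrightarrow> v (to_ac x) = of_int (\<omega> x)) \<and>
     (\<forall>x y. x \<noteq> 0 \<longrightarrow> y \<noteq> 0 \<longrightarrow> v (x * y) = v x + v y) \<and>
     (\<forall>x y. x \<noteq> 0 \<longrightarrow> y \<noteq> 0 \<longrightarrow> x + y \<noteq> 0 \<longrightarrow> min (v x) (v y) \<le> v (x + y)))"

text \<open>
  The maximal unramified extension. As finite fields are perfect, a finite extension is unramified
  iff its ramification index is 1.
\<close>

definition max_unramified :: "('k::field \<Rightarrow> real) \<Rightarrow> 'k set \<Rightarrow> 'k set" where
  "max_unramified v F = \<Union>{E. finite_ext F E \<and> v ` (E - {0}) = v ` (F - {0})}"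

definition mat_topology :: "('k::field \<Rightarrow> real) \<Rightarrow> nat \<Rightarrow> 'k mat topology" where
  "mat_topology v n = topology (\<lambda>U. U \<subseteq> carrier_mat n n \<and>
     (\<forall>x\<in>U. \<exists>r. \<forall>y\<in>carrier_mat n n.
        (\<forall>i<n. \<forall>j<n. y $$ (i, j) = x $$ (i, j) \<or> r < v (y $$ (i, j) - x $$ (i, j))) \<longrightarrow> y \<in> U))"

section \<open>The Kottwitz homomorphism\<close>

text \<open>
  Let \<open>L\<close> be the maximal unramified extension of \<open>F\<close>. For an \<open>L\<close>-torus \<open>T\<close> split over a finite
  Galois extension \<open>E/L\<close>, the Kottwitz homomorphism is the map from \<open>T(L)\<close> to the
  coinvariants \<open>X\<^sub>*(T)\<^sub>I\<close>, \<open>I = Aut(K/L)\<close>, that makes the square with the norm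
  \<open>T(E) \<rightarrow> T(L)\<close>, the valuation \<open>T(E) \<rightarrow> X\<^sub>*(T)\<close> and the projection
  \<open>X\<^sub>*(T) \<rightarrow> X\<^sub>*(T)\<^sub>I\<close> commute (Kottwitz, Isocrystals with additional structure II, section 7).
\<close>

definition cochar_act ::
  "('k::field \<Rightarrow> 'k) \<Rightarrow> ('k \<Rightarrow> 'k mat) \<Rightarrow> ('k \<Rightarrow> 'k mat)" where
  "cochar_act \<sigma> \<mu> = (\<lambda>t\<in>-{0}. map_mat \<sigma> (\<mu> (inv_into UNIV \<sigma> t)))"

definition augmentation :: "'k::field set \<Rightarrow> nat \<Rightarrow> 'k mat set \<Rightarrow> ('k \<Rightarrow> 'k mat) set" where
  "augmentation L n T = generate (cocharacter_group n T)
     {cochar_act \<sigma> \<mu> \<otimes>\<^bsub>cocharacter_group n T\<^esub> inv\<^bsub>cocharacter_group n T\<^esub> \<mu> | \<sigma> \<mu>.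
        \<sigma> \<in> aut_over L \<and> \<mu> \<in> carrier (cocharacter_group n T)}"

text \<open>\<open>val_unit v E\<close> is the valuation of a uniformizer of \<open>E\<close>.\<close>

definition val_unit :: "('k::field \<Rightarrow> real) \<Rightarrow> 'k set \<Rightarrow> real" where
  "val_unit v E = Inf {v x | x. x \<in> E \<and> x \<noteq> 0 \<and> 0 < v x}"

definition torus_val ::
  "('k::field \<Rightarrow> real) \<Rightarrow> 'k set \<Rightarrow> nat \<Rightarrow> 'k mat set \<Rightarrow> 'k mat \<Rightarrow> ('k \<Rightarrow> 'k mat)" where
  "torus_val v E n T t = (THE \<mu>. \<mu> \<in> carrier (cocharacter_group n T) \<and>
     (\<forall>\<xi>\<in>carrier (character_group UNIV n T). v (\<xi> t) = of_int (pairing \<xi> \<mu>) * val_unit v E))"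

definition torus_norm :: "'k::field set \<Rightarrow> 'k set \<Rightarrow> nat \<Rightarrow> 'k mat set \<Rightarrow> 'k mat \<Rightarrow> 'k mat" where
  "torus_norm L E n T t = finprod (grp n T) (\<lambda>\<tau>. map_mat \<tau> t) (galois_group L E)"

definition kottwitz_torus ::
  "('k::field \<Rightarrow> real) \<Rightarrow> 'k set \<Rightarrow> nat \<Rightarrow> 'k mat set \<Rightarrow> 'k mat \<Rightarrow> ('k \<Rightarrow> 'k mat) set" where
  "kottwitz_torus v L n T x = (THE c. \<exists>E. galois_ext L E \<and> split_torus n E T \<and>
     (\<exists>t\<in>points E T. torus_norm L E n T t = x \<and>
        c = augmentation L n T #>\<^bsub>cocharacter_group n T\<^esub> torus_val v E n T t))"

text \<open>A torus is induced iff its cocharacter lattice has a basis permuted by the Galois group.\<close>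

definition induced_torus :: "'k::field set \<Rightarrow> nat \<Rightarrow> 'k mat set \<Rightarrow> bool" where
  "induced_torus F n Z \<longleftrightarrow> torus n Z \<and> defined_over n F Z \<and>
     (\<exists>B. finite B \<and> B \<subseteq> carrier (cocharacter_group n Z) \<and>
        (\<forall>\<mu>\<in>carrier (cocharacter_group n Z). \<exists>!c. c \<in> B \<rightarrow>\<^sub>E (UNIV :: int set) \<and>
           \<mu> = finprod (cocharacter_group n Z) (\<lambda>b. b [^]\<^bsub>cocharacter_group n Z\<^esub> c b) B) \<and>
        (\<forall>\<sigma>\<in>aut_over F. cochar_act \<sigma> ` B = B))"

text \<open>
  \<open>p\<close> is a z-extension of \<open>G\<close> by \<open>G'\<close> and \<open>q\<close> is the quotient of \<open>G'\<close> by its simply connected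
  derived group; \<open>D\<close> is a torus.
\<close>

definition z_extension ::
  "'k::field set \<Rightarrow> nat \<Rightarrow> 'k mat set \<Rightarrow> nat \<Rightarrow> 'k mat set \<Rightarrow> ('k mat \<Rightarrow> 'k mat) \<Rightarrow>
   nat \<Rightarrow> 'k mat set \<Rightarrow> ('k mat \<Rightarrow> 'k mat) \<Rightarrow> bool" where
  "z_extension F n G n' G' p d D q \<longleftrightarrow>
     connected_reductive n' F G' \<and> alg_quotient F n' G' n G p \<and>
     kernel (grp n' G') (grp n G) p \<subseteq> centralizer_in G' G' \<and>
     induced_torus F n' (kernel (grp n' G') (grp n G) p) \<and>
     simply_connected_semisimple n' (derived (GL n') G') \<and>
     torus d D \<and> defined_over d F D \<and> alg_quotient F n' G' d D q \<and>
     kernel (grp n' G') (grp d D) q = derived (GL n') G'"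

text \<open>
  In terms of a z-extension with kernel \<open>Z\<close>, the group \<open>\<pi>\<^sub>1(G)\<^sub>I\<close> is \<open>X\<^sub>*(D)\<close> modulo
  the augmentation submodule and the image of \<open>X\<^sub>*(Z)\<close>.
\<close>

definition kottwitz_relations ::
  "'k::field set \<Rightarrow> nat \<Rightarrow> 'k mat set \<Rightarrow> nat \<Rightarrow> 'k mat set \<Rightarrow> ('k mat \<Rightarrow> 'k mat) \<Rightarrow>
   ('k \<Rightarrow> 'k mat) set" where
  "kottwitz_relations L n' Z d D q = generate (cocharacter_group d D)
     (augmentation L d D \<union>
      {\<lambda>t\<in>-{0}. q (\<mu> t) | \<mu>. \<mu> \<in> carrier (cocharacter_group n' Z)})"

text \<open>
  The Kottwitz homomorphism of \<open>G\<close> over \<open>L\<close> is the homomorphism through which the composite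
  \<open>G'(L) \<rightarrow> D(L) \<rightarrow> X\<^sub>*(D)\<^sub>I \<rightarrow> \<pi>\<^sub>1(G)\<^sub>I\<close> factors; \<open>G'(L) \<rightarrow> G(L)\<close> is surjective.
  \<open>kottwitz_kernel\<close> says that \<open>G1\<close> is the part of its kernel in \<open>G(F)\<close>.
\<close>

definition kottwitz_kernel ::
  "('k::field \<Rightarrow> real) \<Rightarrow> 'k set \<Rightarrow> nat \<Rightarrow> 'k mat set \<Rightarrow> 'k mat set \<Rightarrow> bool" where
  "kottwitz_kernel v F n G G1 \<longleftrightarrow> (\<exists>n' G' p d D q L \<pi> \<kappa>.
     z_extension F n G n' G' p d D q \<and>
     L = max_unramified v F \<and>
     \<pi> = cocharacter_group d D Mod
           kottwitz_relations L n' (kernel (grp n' G') (grp n G) p) d D q \<and>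
     \<kappa> \<in> hom (grp n (points L G)) \<pi> \<and>
     (\<forall>g\<in>points L G'. kottwitz_torus v L d D (q g) \<subseteq> \<kappa> (p g)) \<and>
     G1 = points F G \<inter> kernel (grp n (points L G)) \<pi> \<kappa>)"

section \<open>The apartment and the reduced building\<close>

text \<open>
  The real vector space \<open>V\<close> of the reduced apartment is the quotient of \<open>X\<^sub>*(S) \<otimes> \<real>\<close> by the
  common kernel of the roots, that is, the space of homomorphisms from the root lattice to the
  reals (extended by 0 outside the root lattice).
\<close>

definition root_lattice :: "nat \<Rightarrow> 'k::field mat set \<Rightarrow> 'k mat set \<Rightarrow> ('k mat \<Rightarrow> 'k) set" where
  "root_lattice n G S = generate (character_group UNIV n S) (roots n G S)"

definition apartment_space ::
  "nat \<Rightarrow> 'k::field mat set \<Rightarrow> 'k mat set \<Rightarrow> (('k mat \<Rightarrow> 'k) \<Rightarrow> real) set" where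
  "apartment_space n G S = {x. (\<forall>\<xi>. \<xi> \<notin> root_lattice n G S \<longrightarrow> x \<xi> = 0) \<and>
     (\<forall>\<xi>\<in>root_lattice n G S. \<forall>\<psi>\<in>root_lattice n G S.
        x (\<xi> \<otimes>\<^bsub>character_group UNIV n S\<^esub> \<psi>) = x \<xi> + x \<psi>)}"

text \<open>
  The action \<open>\<nu>\<close> of \<open>N\<close> on the affine space \<open>\<A>\<close> under \<open>V\<close>, with \<open>\<A>\<close> identified with \<open>V\<close> by the
  choice of an origin: linear part the natural action on \<open>V\<close>, and on \<open>M\<close> the translations given by
  \<open>\<xi>(\<nu>(m)) = - v(\<xi>(m))\<close> for the rational characters \<open>\<xi>\<close> of \<open>\<^bold>M\<close>. As restriction identifies these
  with a finite-index subgroup of the characters of \<open>\<^bold>S\<close>, every root has a positive multiple that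
  extends to \<open>\<^bold>M\<close>, and this determines the translation (Tits, Reductive groups over local fields,
  1.2). Such a \<open>\<nu>\<close> is unique up to the choice of the origin.
\<close>

definition apartment_action ::
  "('k::field \<Rightarrow> real) \<Rightarrow> 'k set \<Rightarrow> nat \<Rightarrow> 'k mat set \<Rightarrow> 'k mat set \<Rightarrow>
   ('k mat \<Rightarrow> (('k mat \<Rightarrow> 'k) \<Rightarrow> real) \<Rightarrow> (('k mat \<Rightarrow> 'k) \<Rightarrow> real)) \<Rightarrow> bool" where
  "apartment_action v F n G S \<nu> \<longleftrightarrow>
     (let V = apartment_space n G S; N = points F (normalizer_in n G S) in
       (\<forall>g\<in>N. \<nu> g \<in> V \<rightarrow> V) \<and>
       (\<forall>g\<in>N. \<forall>h\<in>N. \<forall>x\<in>V. \<nu> (g * h) x = \<nu> g (\<nu> h x)) \<and>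
       (\<forall>g\<in>N. \<forall>x\<in>V. \<forall>y\<in>V. \<forall>\<xi>\<in>root_lattice n G S.
          \<nu> g (\<lambda>\<psi>. x \<psi> + y \<psi>) \<xi> = \<nu> g x \<xi> + y (\<lambda>s\<in>S. \<xi> (g * s * inv\<^bsub>GL n\<^esub> g))) \<and>
       (\<forall>m\<in>points F (centralizer_in G S). \<exists>t\<in>V.
          (\<forall>x\<in>V. \<nu> m x = (\<lambda>\<psi>. x \<psi> + t \<psi>)) \<and>
          (\<forall>a\<in>root_lattice n G S.
             \<forall>\<xi>\<in>carrier (character_group F n (centralizer_in G S)). \<forall>k::int.
               (\<forall>s\<in>S. \<xi> s = a s powi k) \<longrightarrow> of_int k * t a = - v (\<xi> m))))"

text \<open>
  For \<open>u \<noteq> 1\<close> in \<open>U\<^sub>a(F)\<close> the set \<open>U\<^sub>-\<^sub>a(F) u U\<^sub>-\<^sub>a(F) \<inter> N\<close> has a unique element \<open>m(u)\<close>, which acts on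
  \<open>\<A>\<close> as a reflection, and \<open>root_val\<close> is the constant \<open>l\<close> such that the affine function \<open>a + l\<close>
  vanishes exactly on its fixed hyperplane (Tits, 1.4).
\<close>

definition reflection_elt ::
  "'k::field set \<Rightarrow> nat \<Rightarrow> 'k mat set \<Rightarrow> 'k mat set \<Rightarrow> ('k mat \<Rightarrow> 'k) \<Rightarrow> 'k mat \<Rightarrow> 'k mat" where
  "reflection_elt F n G S a u = (THE m. m \<in> points F (normalizer_in n G S) \<and>
     (\<exists>x\<in>points F (root_group n G S (neg_char n S a)).
      \<exists>y\<in>points F (root_group n G S (neg_char n S a)). m = x * u * y))"

definition root_val ::
  "'k::field set \<Rightarrow> nat \<Rightarrow> 'k mat set \<Rightarrow> 'k mat set \<Rightarrow>
   ('k mat \<Rightarrow> (('k mat \<Rightarrow> 'k) \<Rightarrow> real) \<Rightarrow> (('k mat \<Rightarrow> 'k) \<Rightarrow> real)) \<Rightarrow>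
   ('k mat \<Rightarrow> 'k) \<Rightarrow> 'k mat \<Rightarrow> real" where
  "root_val F n G S \<nu> a u = (THE l. \<forall>x\<in>apartment_space n G S.
     \<nu> (reflection_elt F n G S a u) x = x \<longleftrightarrow> x a + l = 0)"

definition root_filtration ::
  "'k::field set \<Rightarrow> nat \<Rightarrow> 'k mat set \<Rightarrow> 'k mat set \<Rightarrow>
   ('k mat \<Rightarrow> (('k mat \<Rightarrow> 'k) \<Rightarrow> real) \<Rightarrow> (('k mat \<Rightarrow> 'k) \<Rightarrow> real)) \<Rightarrow>
   ('k mat \<Rightarrow> 'k) \<Rightarrow> real \<Rightarrow> 'k mat set" where
  "root_filtration F n G S \<nu> a l =
     {u \<in> points F (root_group n G S a). u = 1\<^sub>m n \<or> l \<le> root_val F n G S \<nu> a u}"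

text \<open>The pair \<open>(a, l)\<close> stands for the affine function \<open>a + l\<close> (Tits, 1.6).\<close>

definition affine_root ::
  "'k::field set \<Rightarrow> nat \<Rightarrow> 'k mat set \<Rightarrow> 'k mat set \<Rightarrow>
   ('k mat \<Rightarrow> (('k mat \<Rightarrow> 'k) \<Rightarrow> real) \<Rightarrow> (('k mat \<Rightarrow> 'k) \<Rightarrow> real)) \<Rightarrow>
   ('k mat \<Rightarrow> 'k) \<Rightarrow> real \<Rightarrow> bool" where
  "affine_root F n G S \<nu> a l \<longleftrightarrow> a \<in> roots n G S \<and>
     (\<forall>\<epsilon>>0. \<not> root_filtration F n G S \<nu> a l \<subseteq>
        root_filtration F n G S \<nu> a (l + \<epsilon>)
          <#>\<^bsub>GL n\<^esub> points F (root_group n G S (double_char n S a)))"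

text \<open>
  Alcoves are open here; the pointwise fixer and the setwise stabilizer are the same as for the
  closure. The product topology on functions induces the usual topology on \<open>V\<close>.
\<close>

definition alcoves ::
  "'k::field set \<Rightarrow> nat \<Rightarrow> 'k mat set \<Rightarrow> 'k mat set \<Rightarrow>
   ('k mat \<Rightarrow> (('k mat \<Rightarrow> 'k) \<Rightarrow> real) \<Rightarrow> (('k mat \<Rightarrow> 'k) \<Rightarrow> real)) \<Rightarrow>
   (('k mat \<Rightarrow> 'k) \<Rightarrow> real) set set" where
  "alcoves F n G S \<nu> = components
     {x \<in> apartment_space n G S. \<forall>a l. affine_root F n G S \<nu> a l \<longrightarrow> x a + l \<noteq> 0}"

text \<open>
  The reduced building is a \<open>G(F)\<close>-set \<open>\<B>\<close> with an embedding \<open>\<iota>\<close> of the apartment; it is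
  characterized up to unique isomorphism by the following properties (Tits, 2.1).
\<close>

definition building ::
  "'k::field set \<Rightarrow> nat \<Rightarrow> 'k mat set \<Rightarrow> 'k mat set \<Rightarrow>
   ('k mat \<Rightarrow> (('k mat \<Rightarrow> 'k) \<Rightarrow> real) \<Rightarrow> (('k mat \<Rightarrow> 'k) \<Rightarrow> real)) \<Rightarrow>
   'b set \<Rightarrow> ('k mat \<Rightarrow> 'b \<Rightarrow> 'b) \<Rightarrow> ((('k mat \<Rightarrow> 'k) \<Rightarrow> real) \<Rightarrow> 'b) \<Rightarrow> bool" where
  "building F n G S \<nu> \<B> act \<iota> \<longleftrightarrow>
     (let V = apartment_space n G S in
       group_action (grp n (points F G)) \<B> act \<and>
       inj_on \<iota> V \<and>
       \<B> = (\<Union>g\<in>points F G. act g ` \<iota> ` V) \<and>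
       (\<forall>g\<in>points F (normalizer_in n G S). \<forall>x\<in>V. act g (\<iota> x) = \<iota> (\<nu> g x)) \<and>
       (\<forall>a l. affine_root F n G S \<nu> a l \<longrightarrow>
          (\<forall>u\<in>root_filtration F n G S \<nu> a l. \<forall>x\<in>V. 0 \<le> x a + l \<longrightarrow> act u (\<iota> x) = \<iota> x)))"

section \<open>Hecke rings\<close>

definition haar_measure :: "'g monoid \<Rightarrow> 'g topology \<Rightarrow> 'g measure \<Rightarrow> bool" where
  "haar_measure \<G> \<T> \<mu> \<longleftrightarrow>
     space \<mu> = carrier \<G> \<and> sets \<mu> = sigma_sets (carrier \<G>) {U. openin \<T> U} \<and>
     (\<forall>g\<in>carrier \<G>. \<forall>A\<in>sets \<mu>. emeasure \<mu> (g <#\<^bsub>\<G>\<^esub> A) = emeasure \<mu> A) \<and>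
     (\<forall>C. compactin \<T> C \<longrightarrow> emeasure \<mu> C < \<infinity>)"

definition convolution :: "'g monoid \<Rightarrow> 'g measure \<Rightarrow> ('g \<Rightarrow> real) \<Rightarrow> ('g \<Rightarrow> real) \<Rightarrow> 'g \<Rightarrow> real" where
  "convolution \<G> \<mu> f h = (\<lambda>x. if x \<in> carrier \<G>
     then (LINT y|\<mu>. f y * h (inv\<^bsub>\<G>\<^esub> y \<otimes>\<^bsub>\<G>\<^esub> x)) else 0)"

text \<open>
  The ring of integer-valued, compactly supported, \<open>J\<close>-bi-invariant functions with support in \<open>Y\<close>.
  Values are real numbers that are integers, so that convolution can be written as an integral;
  functions are extended by 0 outside the group.
\<close>

definition hecke_ring ::
  "'g monoid \<Rightarrow> 'g topology \<Rightarrow> 'g measure \<Rightarrow> 'g set \<Rightarrow> 'g set \<Rightarrow> ('g \<Rightarrow> real) ring" where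
  "hecke_ring \<G> \<T> \<mu> J Y = \<lparr>
     carrier = {f. range f \<subseteq> \<int> \<and> (\<forall>x. x \<notin> Y \<longrightarrow> f x = 0) \<and>
        (\<exists>C. compactin \<T> C \<and> (\<forall>x. x \<notin> C \<longrightarrow> f x = 0)) \<and>
        (\<forall>j\<in>J. \<forall>j'\<in>J. \<forall>x\<in>carrier \<G>. f (j \<otimes>\<^bsub>\<G>\<^esub> x \<otimes>\<^bsub>\<G>\<^esub> j') = f x)},
     monoid.mult = convolution \<G> \<mu>,
     one = indicator J,
     ring.zero = (\<lambda>_. 0),
     add = (\<lambda>f h x. f x + h x)\<rparr>"

definition int_basis :: "'w set \<Rightarrow> ('w \<Rightarrow> 'g \<Rightarrow> real) \<Rightarrow> ('g \<Rightarrow> real) set \<Rightarrow> bool" where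
  "int_basis W b H \<longleftrightarrow> (\<forall>w\<in>W. b w \<in> H) \<and>
     (\<forall>f\<in>H. \<exists>!c :: 'w \<Rightarrow>\<^sub>0 int. Poly_Mapping.keys c \<subseteq> W \<and>
        f = (\<lambda>x. \<Sum>w\<in>Poly_Mapping.keys c. of_int (Poly_Mapping.lookup c w) * b w x))"

definition semidirect :: "'w monoid \<Rightarrow> 'w set \<Rightarrow> 'w set \<Rightarrow> bool" where
  "semidirect W A \<Omega> \<longleftrightarrow> A \<lhd> W \<and> subgroup \<Omega> W \<and> A \<inter> \<Omega> = {\<one>\<^bsub>W\<^esub>} \<and> A <#>\<^bsub>W\<^esub> \<Omega> = carrier W"

section \<open>Tensor products of abelian groups\<close>

text \<open>
  The groups are written multiplicatively as records. Over the integers, compatibility with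
  scalars follows from biadditivity.
\<close>

definition tensor_relations :: "'a monoid \<Rightarrow> 'b monoid \<Rightarrow> ('a \<times> 'b \<Rightarrow>\<^sub>0 int) set" where
  "tensor_relations A B = generate (free_Abelian_group (carrier A \<times> carrier B))
     ({frag_of (a \<otimes>\<^bsub>A\<^esub> a', b) - frag_of (a, b) - frag_of (a', b) | a a' b.
         a \<in> carrier A \<and> a' \<in> carrier A \<and> b \<in> carrier B} \<union>
      {frag_of (a, b \<otimes>\<^bsub>B\<^esub> b') - frag_of (a, b) - frag_of (a, b') | a b b'.
         a \<in> carrier A \<and> b \<in> carrier B \<and> b' \<in> carrier B})"

definition tensor :: "'a monoid \<Rightarrow> 'b monoid \<Rightarrow> ('a \<times> 'b \<Rightarrow>\<^sub>0 int) set monoid" where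
  "tensor A B = free_Abelian_group (carrier A \<times> carrier B) Mod tensor_relations A B"

definition pure_tensor :: "'a monoid \<Rightarrow> 'b monoid \<Rightarrow> 'a \<Rightarrow> 'b \<Rightarrow> ('a \<times> 'b \<Rightarrow>\<^sub>0 int) set" where
  "pure_tensor A B a b =
     tensor_relations A B #>\<^bsub>free_Abelian_group (carrier A \<times> carrier B)\<^esub> frag_of (a, b)"

definition with_multiplication :: "'a monoid \<Rightarrow> ('a \<Rightarrow> 'a \<Rightarrow> 'a) \<Rightarrow> 'a \<Rightarrow> 'a ring" where
  "with_multiplication A m e = \<lparr>carrier = carrier A, monoid.mult = m, one = e,
     ring.zero = \<one>\<^bsub>A\<^esub>, add = monoid.mult A\<rparr>"

end

theory Submission
  imports Defs "HOL-Analysis.T1_Spaces"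
begin

text \<open>
  Write \<open>J\<close> for \<open>I\<^sup>\<flat>\<close> and \<open>x\<^sub>\<sigma>\<close> for a lift of \<open>\<sigma> \<in> \<Omega>\<close> to \<open>N\<close>. As \<open>\<sigma>\<close> stabilizes the alcove, \<open>x\<^sub>\<sigma>\<close> normalizes
  \<open>J\<close>, so \<open>i\<^sub>\<sigma>\<close> is the indicator function of the single coset \<open>x\<^sub>\<sigma> J\<close> and convolution with it from the
  left or right is a translation. Hence \<open>i\<^sub>\<sigma> * i\<^sub>w = i\<^sub>\<sigma>\<^sub>w\<close> and \<open>i\<^sub>w * i\<^sub>\<sigma> = i\<^sub>w\<^sub>\<sigma>\<close>, which gives the
  twisted multiplication rule. The supports of the translates \<open>i\<^sub>\<sigma> * h\<close> of affine Hecke functions lie in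
  the cosets \<open>x\<^sub>\<sigma> G\<^sub>1\<^sup>\<flat>\<close>, which are pairwise disjoint because \<open>W\<^sub>a\<^sub>f\<^sub>f \<inter> \<Omega>\<close> is trivial, and these
  translates generate the Hecke ring because of the given basis. So the Hecke ring is the direct sum
  of the \<open>i\<^sub>\<sigma> * H\<^sub>a\<^sub>f\<^sub>f\<close>, that is, the tensor product, to which the multiplication is transported.

  That convolution is defined at all rests on compact subsets of \<open>G\<close> being measurable, hence on the
  topology being Hausdorff. As the valuation of the algebraic closure is given by a definite
  description, this requires the existence and uniqueness of the extension of a complete valuation.
\<close>

section \<open>Valuations\<close>

text \<open>Convolution becomes algebra because a Hecke function is a finite combination of
  indicators of left cosets, all of volume 1, and the integrand of a convolution is again of this
  kind. The tensor product is reached through a system of injections (translation by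
  \<open>i \<sigma>\<close>) and projections (restriction to a coset), which characterizes a direct
  sum of copies of one group. The multiplication is then defined by transport of structure, so its
  ring axioms are those of convolution. Two facts must be extracted from data that do not display
  them. The Kottwitz homomorphism maps into a quotient that is not shown to be a group, so normality
  of its kernel is derived from multiplicativity and from the kernel being nonempty. And a valuation
  on the algebraic closure is found by way of a maximal subring omitting the inverse of a
  uniformizer, its values being read off from powers comparable with elements of the base field;
  uniqueness follows from the coordinates of high powers in a finite basis.\<close>

definition valuation :: "('k::field \<Rightarrow> real) \<Rightarrow> bool" where
  "valuation v \<longleftrightarrow> (\<forall>x y. x \<noteq> 0 \<longrightarrow> y \<noteq> 0 \<longrightarrow> v (x * y) = v x + v y) \<and>
     (\<forall>x y. x \<noteq> 0 \<longrightarrow> y \<noteq> 0 \<longrightarrow> x + y \<noteq> 0 \<longrightarrow> min (v x) (v y) \<le> v (x + y))"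

text \<open>\<open>valuation\<close> leaves the value at 0 open. The first disjunct lets 0 satisfy
  every lower bound, as if its value were infinite.\<close>

definition val_ge :: "('k::field \<Rightarrow> real) \<Rightarrow> 'k \<Rightarrow> real \<Rightarrow> bool" where
  "val_ge v x r \<longleftrightarrow> x = 0 \<or> r \<le> v x"

lemma valuation_mult: "valuation v \<Longrightarrow> x \<noteq> 0 \<Longrightarrow> y \<noteq> 0 \<Longrightarrow> v (x * y) = v x + v y"
  by (simp add: valuation_def)

lemma valuation_one: "valuation v \<Longrightarrow> v 1 = 0"
  using valuation_mult[of v 1 1] by simp

lemma valuation_minus:
  assumes "valuation v" shows "v (- x) = v x"
proof (cases "x = 0")
  case False
  have "v (- 1) + v (- 1) = 0"
    using valuation_mult[OF assms, of "- 1" "- 1"] valuation_one[OF assms] by simp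
  then show ?thesis
    using valuation_mult[OF assms, of "- 1" x] False by simp
qed simp

lemma valuation_inverse:
  assumes "valuation v" "x \<noteq> 0" shows "v (inverse x) = - v x"
  using valuation_mult[OF assms(1), of x "inverse x"] assms valuation_one[OF assms(1)] by simp

lemma valuation_power:
  assumes "valuation v" "x \<noteq> 0" shows "v (x ^ n) = n * v x"
  by (induction n) (simp_all add: valuation_one valuation_mult assms algebra_simps)

lemma val_ge_zero [simp]: "val_ge v 0 r"
  by (simp add: val_ge_def)

lemma val_ge_self: "val_ge v x (v x)"
  by (simp add: val_ge_def)

lemma val_ge_mono: "val_ge v x r \<Longrightarrow> s \<le> r \<Longrightarrow> val_ge v x s"
  by (auto simp: val_ge_def)

lemma val_ge_add: "valuation v \<Longrightarrow> val_ge v x r \<Longrightarrow> val_ge v y r \<Longrightarrow> val_ge v (x + y) r"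
  unfolding val_ge_def valuation_def by (cases "x = 0"; cases "y = 0"; cases "x + y = 0") (auto, force)

lemma val_ge_minus: "valuation v \<Longrightarrow> val_ge v (- x) r \<longleftrightarrow> val_ge v x r"
  by (simp add: val_ge_def valuation_minus)

lemma val_ge_diff: "valuation v \<Longrightarrow> val_ge v x r \<Longrightarrow> val_ge v y r \<Longrightarrow> val_ge v (x - y) r"
  using val_ge_add[of v x r "- y"] by (simp add: val_ge_minus)

lemma val_ge_mult: "valuation v \<Longrightarrow> val_ge v x r \<Longrightarrow> val_ge v y s \<Longrightarrow> val_ge v (x * y) (r + s)"
  unfolding val_ge_def by (cases "x = 0"; cases "y = 0") (simp_all add: valuation_mult)

lemma val_ge_sum:
  assumes "valuation v" "\<And>i. i \<in> S \<Longrightarrow> val_ge v (f i) r" shows "val_ge v (sum f S) r"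
  using assms(2) by (induction S rule: infinite_finite_induct) (auto intro: val_ge_add[OF assms(1)])

subsection \<open>Uniqueness of the extension of a complete valuation\<close>

text \<open>The completeness clause of \<open>nonarch_local_field\<close>, word for word, so that it
  can be folded there.\<close>

definition complete_valuation :: "('f::field \<Rightarrow> int) \<Rightarrow> bool" where
  "complete_valuation \<omega> \<longleftrightarrow> (\<forall>X::nat \<Rightarrow> 'f.
     (\<forall>k. \<exists>N. \<forall>i\<ge>N. \<forall>j\<ge>N. X i = X j \<or> k \<le> \<omega> (X i - X j)) \<longrightarrow>
     (\<exists>x. \<forall>k. \<exists>N. \<forall>i\<ge>N. X i = x \<or> k \<le> \<omega> (X i - x)))"

text \<open>Only the first \<open>d\<close> entries of the sequence \<open>z\<close> count, so
  lowering \<open>d\<close> drops the last vector without reindexing.\<close>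

definition lin_comb :: "('f::field \<Rightarrow> 'k::field) \<Rightarrow> (nat \<Rightarrow> 'k) \<Rightarrow> nat \<Rightarrow> (nat \<Rightarrow> 'f) \<Rightarrow> 'k" where
  "lin_comb \<phi> z d c = (\<Sum>i<d. \<phi> (c i) * z i)"

locale field_embedding =
  fixes \<phi> :: "'f::field \<Rightarrow> 'k::field"
  assumes hom_one [simp]: "\<phi> 1 = 1"
    and hom_add [simp]: "\<phi> (x + y) = \<phi> x + \<phi> y"
    and hom_mult [simp]: "\<phi> (x * y) = \<phi> x * \<phi> y"
begin

lemma hom_zero [simp]: "\<phi> 0 = 0"
proof -
  have "\<phi> 0 + \<phi> 0 = \<phi> 0" by (simp only: hom_add[symmetric] add_0_left)
  then show ?thesis by (metis add_cancel_right_left)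
qed

lemma hom_minus [simp]: "\<phi> (- x) = - \<phi> x"
  using hom_add[of x "- x"] by (simp add: minus_unique)

lemma hom_diff [simp]: "\<phi> (x - y) = \<phi> x - \<phi> y"
  using hom_add[of x "- y"] by simp

lemma hom_eq_0_iff [simp]: "\<phi> x = 0 \<longleftrightarrow> x = 0"
proof
  assume *: "\<phi> x = 0"
  show "x = 0"
  proof (rule ccontr)
    assume "x \<noteq> 0"
    then have "\<phi> (x * inverse x) = 1" by (simp del: hom_mult)
    with * show False by simp
  qed
qed simp

lemma hom_inverse [simp]: "\<phi> (inverse x) = inverse (\<phi> x)"
proof (cases "x = 0")
  case False
  then have "\<phi> x * \<phi> (inverse x) = 1" by (simp flip: hom_mult)
  then show ?thesis by (simp add: inverse_unique)
qed simp

lemma hom_power [simp]: "\<phi> (x ^ n) = \<phi> x ^ n"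
  by (induction n) simp_all

definition indep :: "(nat \<Rightarrow> 'k) \<Rightarrow> nat \<Rightarrow> bool" where
  "indep z d \<longleftrightarrow> (\<forall>c. lin_comb \<phi> z d c = 0 \<longrightarrow> (\<forall>i<d. c i = 0))"

lemma lin_comb_diff: "lin_comb \<phi> z d (\<lambda>i. a i - b i) = lin_comb \<phi> z d a - lin_comb \<phi> z d b"
  by (simp add: lin_comb_def sum_subtractf left_diff_distrib)

lemma lin_comb_scale: "lin_comb \<phi> z d (\<lambda>i. k * a i) = \<phi> k * lin_comb \<phi> z d a"
  by (simp add: lin_comb_def sum_distrib_left mult.assoc)

lemma indep_Suc_D: "indep z (Suc d) \<Longrightarrow> indep z d"
proof -
  assume *: "indep z (Suc d)"
  show "indep z d" unfolding indep_def
  proof safe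
    fix c i assume "lin_comb \<phi> z d c = 0" "i < d"
    then have "lin_comb \<phi> z (Suc d) (\<lambda>i. if i < d then c i else 0) = 0"
      by (simp add: lin_comb_def)
    then have "\<forall>i<Suc d. (if i < d then c i else 0) = 0" using * unfolding indep_def by blast
    then show "c i = 0" using \<open>i < d\<close> by (auto dest: spec[of _ i])
  qed
qed

text \<open>
  Norm equivalence on a finite-dimensional space: by induction on the dimension, completeness
  of the coefficient field shows that the new vector has positive distance from the span of the
  previous ones.
\<close>

lemma coefficient_bound:
  assumes v: "valuation v" and ext: "\<And>x. x \<noteq> 0 \<Longrightarrow> v (\<phi> x) = of_int (\<omega> x)"
    and compl: "complete_valuation \<omega>" and "indep z d"
  shows "\<exists>C. \<forall>c r. val_ge v (lin_comb \<phi> z d c) r \<longrightarrow> (\<forall>i<d. val_ge v (\<phi> (c i)) (r - C))"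
  using assms(4)
proof (induction d)
  case (Suc d)
  note ind = Suc.prems
  obtain C where C: "\<And>c r i. val_ge v (lin_comb \<phi> z d c) r \<Longrightarrow> i < d \<Longrightarrow> val_ge v (\<phi> (c i)) (r - C)"
    using Suc.IH[OF indep_Suc_D[OF ind]] by blast
  have nz: "z d + lin_comb \<phi> z d c \<noteq> 0" for c
  proof
    assume "z d + lin_comb \<phi> z d c = 0"
    then have "lin_comb \<phi> z (Suc d) (c(d := 1)) = 0"
      by (simp add: lin_comb_def add.commute)
    then have "(c(d := 1)) d = 0" using ind unfolding indep_def by blast
    then show False by simp
  qed
  \<comment> \<open>If these values were unbounded, the vectors \<open>c k\<close> would be Cauchy
    by the coefficient bound for \<open>d\<close> vectors, and their limit \<open>x\<close> would
    make \<open>z d + lin_comb \<phi> z d x\<close> arbitrarily divisible, hence 0, against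
    independence.\<close>
  have "\<exists>D. \<forall>c. v (z d + lin_comb \<phi> z d c) \<le> D"
  proof (rule ccontr)
    assume "\<not> ?thesis"
    then have "\<forall>k::nat. \<exists>c. v (z d + lin_comb \<phi> z d c) > real k"
      by (metis not_le)
    then obtain c where c: "\<And>k::nat. v (z d + lin_comb \<phi> z d (c k)) > real k" by metis
    have cauchy: "val_ge v (\<phi> (c k i - c l i)) (real N - C)" if "k \<ge> N" "l \<ge> N" "i < d" for k l N i
    proof -
      have "val_ge v (z d + lin_comb \<phi> z d (c k)) (real N)" "val_ge v (z d + lin_comb \<phi> z d (c l)) (real N)"
        using c[of k] c[of l] that by (auto simp: val_ge_def)
      from val_ge_diff[OF v this]
      have "val_ge v (lin_comb \<phi> z d (\<lambda>i. c k i - c l i)) (real N)"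
        by (simp add: lin_comb_diff)
      from C[OF this \<open>i < d\<close>] show ?thesis by simp
    qed
    have "\<exists>x. \<forall>k. \<exists>N. \<forall>j\<ge>N. c j i = x \<or> k \<le> \<omega> (c j i - x)" if "i < d" for i
    proof -
      have "\<exists>N. \<forall>j\<ge>N. \<forall>l\<ge>N. c j i = c l i \<or> k \<le> \<omega> (c j i - c l i)" for k
      proof -
        obtain N :: nat where N: "real N \<ge> of_int k + C" using real_arch_simple by blast
        have "c j i = c l i \<or> k \<le> \<omega> (c j i - c l i)" if "j \<ge> N" "l \<ge> N" for j l
          using cauchy[OF that \<open>i < d\<close>] ext[of "c j i - c l i"] N unfolding val_ge_def
          by (cases "c j i = c l i") (auto simp del: hom_diff)
        then show ?thesis by blast
      qed
      then show ?thesis using compl[unfolded complete_valuation_def, rule_format, of "\<lambda>j. c j i"] by blast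
    qed
    then obtain x where x: "\<And>i k. i < d \<Longrightarrow> \<exists>N. \<forall>j\<ge>N. c j i = x i \<or> k \<le> \<omega> (c j i - x i)" by metis
    let ?y = "z d + lin_comb \<phi> z d x"
    have big: "val_ge v ?y r" for r
    proof -
      \<comment> \<open>A coefficient error of valuation \<open>s i\<close> gives an error term
        \<open>\<phi> (c j i - x i) * z i\<close> of valuation at least \<open>r\<close>.\<close>
      define s where "s = (\<lambda>i. \<lceil>r - v (z i)\<rceil>)"
      have "\<forall>i. \<exists>N. i < d \<longrightarrow> (\<forall>j\<ge>N. c j i = x i \<or> s i \<le> \<omega> (c j i - x i))"
        using x by blast
      then obtain N where N: "\<And>i j. i < d \<Longrightarrow> j \<ge> N i \<Longrightarrow> c j i = x i \<or> s i \<le> \<omega> (c j i - x i)"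
        by metis
      obtain N0 :: nat where N0: "real N0 \<ge> r" using real_arch_simple by blast
      \<comment> \<open>The sum of the thresholds dominates each of them; the summand
        \<open>N0\<close> makes the approximation with coefficients \<open>c j\<close> itself have
        valuation at least \<open>r\<close>.\<close>
      define j where "j = N0 + (\<Sum>i<d. N i)"
      have jN: "j \<ge> N i" if "i < d" for i
        using member_le_sum[of i "{..<d}" N] that unfolding j_def by simp
      have "val_ge v (z d + lin_comb \<phi> z d (c j)) r"
      proof -
        have "real N0 \<le> real j" by (simp add: j_def sum_nonneg)
        then show ?thesis using c[of j] N0 unfolding val_ge_def by linarith
      qed
      moreover have "val_ge v (lin_comb \<phi> z d (\<lambda>i. c j i - x i)) r"
        unfolding lin_comb_def
      proof (rule val_ge_sum[OF v])
        fix i assume "i \<in> {..<d}"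
        then have "c j i = x i \<or> s i \<le> \<omega> (c j i - x i)" using N jN by auto
        moreover have "r - v (z i) \<le> of_int (s i)" unfolding s_def by linarith
        ultimately have "val_ge v (\<phi> (c j i - x i)) (r - v (z i))"
          using ext[of "c j i - x i"] unfolding val_ge_def
          by (cases "c j i = x i") (auto simp del: hom_diff)
        from val_ge_mult[OF v this val_ge_self[of v "z i"]]
        show "val_ge v (\<phi> (c j i - x i) * z i) r" by simp
      qed
      ultimately have "val_ge v (z d + lin_comb \<phi> z d (c j) - lin_comb \<phi> z d (\<lambda>i. c j i - x i)) r"
        by (rule val_ge_diff[OF v])
      then show ?thesis by (simp add: lin_comb_diff)
    qed
    show False using big[of "v ?y + 1"] nz[of x] by (simp add: val_ge_def)
  qed
  then obtain D where D: "\<And>c. v (z d + lin_comb \<phi> z d c) \<le> D" by blast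
  \<comment> \<open>The last coefficient may fall short of \<open>r\<close> by \<open>D\<close>. For
    the others its term is subtracted first; that term may lie below \<open>r\<close> by
    \<open>D - v (z d)\<close>, and the bound for \<open>d\<close> vectors then costs another
    \<open>C\<close>.\<close>
  define E where "E = max (max 0 D) (C + max 0 (D - v (z d)))"
  have "val_ge v (\<phi> (c i)) (r - E)" if r: "val_ge v (lin_comb \<phi> z (Suc d) c) r" and i: "i < Suc d" for c r i
  proof (cases "c d = 0")
    case True
    then have "val_ge v (lin_comb \<phi> z d c) r" using r by (simp add: lin_comb_def)
    then have "i < d \<Longrightarrow> val_ge v (\<phi> (c i)) (r - C)" by (rule C)
    moreover have "C \<le> E" by (simp add: E_def)
    ultimately show ?thesis using True i by (auto simp: less_Suc_eq intro: val_ge_mono)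
  next
    case False
    \<comment> \<open>Scaling the last coefficient to 1 produces a vector of the form to which the
      bound \<open>D\<close> applies.\<close>
    let ?u = "z d + lin_comb \<phi> z d (\<lambda>i. inverse (c d) * c i)"
    have eq: "lin_comb \<phi> z (Suc d) c = \<phi> (c d) * ?u"
    proof -
      have "\<phi> (c d) * ?u = \<phi> (c d) * z d + (\<phi> (c d) * inverse (\<phi> (c d))) * lin_comb \<phi> z d c"
        by (simp only: lin_comb_scale distrib_left hom_inverse mult.assoc)
      then show ?thesis using False by (simp add: lin_comb_def)
    qed
    have vcd: "v (\<phi> (c d)) \<ge> r - D"
      using r D[of "\<lambda>i. inverse (c d) * c i"] False nz unfolding val_ge_def eq
      by (simp add: valuation_mult[OF v])
    show ?thesis
    proof (cases "i = d")
      case True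
      moreover have "D \<le> E" by (simp add: E_def)
      ultimately show ?thesis using vcd by (simp add: val_ge_def)
    next
      case neq: False
      let ?s = "r - max 0 (D - v (z d))"
      have "val_ge v (\<phi> (c d) * z d) (r - D + v (z d))"
        using vcd by (intro val_ge_mult[OF v] val_ge_self) (simp add: val_ge_def)
      then have "val_ge v (\<phi> (c d) * z d) ?s" by (rule val_ge_mono) simp
      moreover have "val_ge v (lin_comb \<phi> z (Suc d) c) ?s" using r by (rule val_ge_mono) simp
      ultimately have "val_ge v (lin_comb \<phi> z (Suc d) c - \<phi> (c d) * z d) ?s"
        by (intro val_ge_diff[OF v])
      then have "val_ge v (lin_comb \<phi> z d c) ?s" by (simp add: lin_comb_def)
      from C[OF this, of i] have "val_ge v (\<phi> (c i)) (?s - C)" using i neq by simp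
      then show ?thesis by (rule val_ge_mono) (simp add: E_def)
    qed
  qed
  then show ?case by (intro exI[of _ E]) auto
next
  case 0
  show ?case by (intro exI allI impI) auto
qed

text \<open>Multiplication by \<open>z\<close> shifts the coefficients by one place, and the
  overflow into \<open>z ^ d\<close> is rewritten by the given relation.\<close>

lemma power_in_span:
  assumes d: "z ^ d = lin_comb \<phi> (\<lambda>i. z ^ i) d b"
  shows "\<exists>c. z ^ n = lin_comb \<phi> (\<lambda>i. z ^ i) d c"
proof (induction n)
  case 0
  show ?case
  proof (cases d)
    case 0 then show ?thesis using d by (simp add: lin_comb_def)
  next
    case (Suc e)
    have "lin_comb \<phi> (\<lambda>i. z ^ i) d (\<lambda>i. if i = 0 then 1 else 0) = 1"
      by (simp add: lin_comb_def Suc if_distrib[of \<phi>] if_distrib[of "\<lambda>x. x * _"] sum.delta cong: if_cong)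
    then show ?thesis by (metis power_0)
  qed
next
  case (Suc n)
  then obtain c where c: "z ^ n = lin_comb \<phi> (\<lambda>i. z ^ i) d c" by blast
  show ?case
  proof (cases d)
    case 0 then show ?thesis using c by (auto simp: lin_comb_def)
  next
    case (Suc e)
    define c' where "c' = (\<lambda>i. (if i = 0 then 0 else c (i - 1)) + c e * b i)"
    have "z ^ Suc n = (\<Sum>i<d. \<phi> (c i) * z ^ Suc i)"
      unfolding power_Suc c lin_comb_def by (simp add: sum_distrib_left algebra_simps)
    also have "\<dots> = (\<Sum>i<e. \<phi> (c i) * z ^ Suc i) + \<phi> (c e) * z ^ d"
      by (simp add: Suc)
    also have "(\<Sum>i<e. \<phi> (c i) * z ^ Suc i) = (\<Sum>i<d. \<phi> (if i = 0 then 0 else c (i - 1)) * z ^ i)"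
      unfolding Suc sum.lessThan_Suc_shift[of _ e] by simp
    also have "\<phi> (c e) * z ^ d = (\<Sum>i<d. \<phi> (c e * b i) * z ^ i)"
      unfolding d lin_comb_def by (simp add: sum_distrib_left mult.assoc)
    finally have "z ^ Suc n = lin_comb \<phi> (\<lambda>i. z ^ i) d c'"
      unfolding lin_comb_def c'_def by (simp add: sum.distrib distrib_right del: power_Suc)
    then show ?thesis by blast
  qed
qed

text \<open>At the least \<open>n\<close> for which the first \<open>n\<close> powers are dependent,
  the top coefficient of a relation cannot vanish, since otherwise a shorter relation would exist;
  dividing by it expresses the top power through the others.\<close>

lemma algebraic_basis:
  assumes "p \<noteq> 0" "poly (map_poly \<phi> p) z = 0"
  obtains d b where "indep (\<lambda>i. z ^ i) d" "z ^ d = lin_comb \<phi> (\<lambda>i. z ^ i) d b"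
proof -
  have "\<exists>n. \<not> indep (\<lambda>i. z ^ i) n"
  proof
    have "lin_comb \<phi> (\<lambda>i. z ^ i) (Suc (degree p)) (poly.coeff p) = poly (map_poly \<phi> p) z"
      unfolding lin_comb_def
      by (subst poly_as_sum_of_monoms'[symmetric, of "map_poly \<phi> p" "degree p"])
         (simp_all add: map_poly_degree_leq poly_sum poly_monom coeff_map_poly lessThan_Suc_atMost)
    then have "lin_comb \<phi> (\<lambda>i. z ^ i) (Suc (degree p)) (poly.coeff p) = 0" using assms(2) by simp
    moreover have "poly.coeff p (degree p) \<noteq> 0" using assms(1) by simp
    ultimately show "\<not> indep (\<lambda>i. z ^ i) (Suc (degree p))" unfolding indep_def by blast
  qed
  then obtain n where n: "\<not> indep (\<lambda>i. z ^ i) n" "\<And>m. m < n \<Longrightarrow> indep (\<lambda>i. z ^ i) m"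
    using exists_least_iff[of "\<lambda>n. \<not> indep (\<lambda>i. z ^ i) n"] by blast
  then obtain d where [simp]: "n = Suc d" by (cases n) (auto simp: indep_def)
  have ind: "indep (\<lambda>i. z ^ i) d" using n(2) by simp
  obtain c i where c: "lin_comb \<phi> (\<lambda>i. z ^ i) (Suc d) c = 0" "i < Suc d" "c i \<noteq> 0"
    using n(1) unfolding indep_def by auto
  have cd: "c d \<noteq> 0"
  proof
    assume "c d = 0"
    then have "lin_comb \<phi> (\<lambda>i. z ^ i) d c = 0" "i < d" using c by (auto simp: lin_comb_def less_Suc_eq)
    then show False using ind c(3) unfolding indep_def by blast
  qed
  have *: "\<phi> (c d) * z ^ d = - lin_comb \<phi> (\<lambda>i. z ^ i) d c"
    using c(1) by (simp add: lin_comb_def add_eq_0_iff)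
  then have "z ^ d = \<phi> (- inverse (c d)) * lin_comb \<phi> (\<lambda>i. z ^ i) d c"
  proof -
    have "z ^ d = inverse (\<phi> (c d)) * (\<phi> (c d) * z ^ d)" using cd by simp
    then show ?thesis using * by simp
  qed
  then have "z ^ d = lin_comb \<phi> (\<lambda>i. z ^ i) d (\<lambda>i. - inverse (c d) * c i)"
    by (simp only: lin_comb_scale)
  with ind show ?thesis using that by blast
qed

context
  fixes \<omega> :: "'f \<Rightarrow> int" and \<pi> :: 'f and v w :: "'k \<Rightarrow> real"
  assumes alg: "\<And>z. \<exists>p. p \<noteq> 0 \<and> poly (map_poly \<phi> p) z = 0"
    and compl: "complete_valuation \<omega>" and uniformizer: "\<pi> \<noteq> 0" "\<omega> \<pi> = 1"
    and v: "valuation v" "\<And>x. x \<noteq> 0 \<Longrightarrow> v (\<phi> x) = of_int (\<omega> x)"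
    and w: "valuation w" "\<And>x. x \<noteq> 0 \<Longrightarrow> w (\<phi> x) = of_int (\<omega> x)"
begin

text \<open>Powers of an element with positive \<open>v\<close> tend to 0, hence so do their coefficients.\<close>

lemma positive_transfer:
  assumes z: "z \<noteq> 0" "v z > 0" shows "w z > 0"
proof (rule ccontr)
  assume neg: "\<not> w z > 0"
  obtain p where p: "p \<noteq> 0" "poly (map_poly \<phi> p) z = 0" using alg by blast
  obtain d b where ind: "indep (\<lambda>i. z ^ i) d" and b: "z ^ d = lin_comb \<phi> (\<lambda>i. z ^ i) d b"
    by (rule algebraic_basis[OF p])
  obtain C where C: "\<And>c r i. val_ge v (lin_comb \<phi> (\<lambda>i. z ^ i) d c) r \<Longrightarrow> i < d \<Longrightarrow> val_ge v (\<phi> (c i)) (r - C)"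
    using coefficient_bound[OF v compl ind] by blast
  \<comment> \<open>As \<open>w z\<close> is not positive, \<open>w (z ^ i)\<close> is at least
    \<open>- m\<close> for all \<open>i < d\<close>. The exponent \<open>n\<close> below makes the
    valuations of the coefficients, on which \<open>v\<close> and \<open>w\<close> agree, exceed
    this deficit.\<close>
  define m where "m = \<bar>real d * w z\<bar>"
  obtain n :: nat where n: "real n * v z > m + C"
    using reals_Archimedean3[OF z(2)] by blast
  obtain c where c: "z ^ n = lin_comb \<phi> (\<lambda>i. z ^ i) d c" using power_in_span[OF b] by blast
  have "val_ge v (lin_comb \<phi> (\<lambda>i. z ^ i) d c) (real n * v z)"
    unfolding c[symmetric] by (simp add: val_ge_def valuation_power[OF v(1) z(1)])
  note coef = C[OF this]
  have mw: "- m \<le> real i * w z" if "i < d" for i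
  proof -
    have "real d * w z \<le> real i * w z" using that neg by (intro mult_right_mono_neg) auto
    then show ?thesis unfolding m_def by linarith
  qed
  define \<epsilon> where "\<epsilon> = real n * v z - C - m"
  have "val_ge w (lin_comb \<phi> (\<lambda>i. z ^ i) d c) \<epsilon>"
    unfolding lin_comb_def
  proof (rule val_ge_sum[OF w(1)])
    fix i assume "i \<in> {..<d}"
    then have i: "i < d" by simp
    have "val_ge w (\<phi> (c i)) (real n * v z - C)"
      using coef[OF i] v(2)[of "c i"] w(2)[of "c i"] by (cases "c i = 0") (auto simp: val_ge_def)
    moreover have "val_ge w (z ^ i) (- m)"
      using mw[OF i] by (simp add: val_ge_def valuation_power[OF w(1) z(1)])
    ultimately show "val_ge w (\<phi> (c i) * z ^ i) \<epsilon>"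
      unfolding \<epsilon>_def using val_ge_mult[OF w(1)] by fastforce
  qed
  moreover have "\<epsilon> > 0" using n by (simp add: \<epsilon>_def)
  ultimately have "w (z ^ n) > 0"
    unfolding c[symmetric] using z by (simp add: val_ge_def)
  then show False using neg by (simp add: valuation_power[OF w(1) z(1)] zero_less_mult_iff)
qed

text \<open>A rational number \<open>a / b\<close> strictly between \<open>w x\<close> and
  \<open>v x\<close> would separate them: with \<open>t\<close> in the base field of valuation
  \<open>- a\<close>, the product of \<open>x ^ b\<close> and \<open>\<phi> t\<close> has positive
  \<open>v\<close> and negative \<open>w\<close>, against \<open>positive_transfer\<close>.\<close>

lemma extension_le:
  assumes x: "x \<noteq> 0" shows "w x \<ge> v x"
proof (rule ccontr)
  assume "\<not> w x \<ge> v x"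
  then obtain q where q: "q \<in> \<rat>" "w x < q" "q < v x" 
    using Rats_dense_in_real[of "w x" "v x"] by auto
  obtain a b :: int where ab: "q = of_int a / of_int b" "b > 0" by (rule Rats_cases'[OF q(1)])
  define k where "k = nat b"
  have k: "k > 0" "real k = of_int b" using ab by (auto simp: k_def)
  define t where "t = (if a \<ge> 0 then inverse \<pi> ^ nat a else \<pi> ^ nat (- a))"
  have t0: "t \<noteq> 0" using uniformizer by (simp add: t_def)
  have pi0: "\<phi> \<pi> \<noteq> 0" using uniformizer by simp
  have val_t: "u (\<phi> t) = - of_int a"
    if u: "valuation u" "\<And>x. x \<noteq> 0 \<Longrightarrow> u (\<phi> x) = of_int (\<omega> x)" for u
  proof -
    have "u (\<phi> \<pi>) = 1" using u(2)[OF uniformizer(1)] uniformizer(2) by simp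
    then show ?thesis
      using pi0 by (simp add: t_def valuation_power[OF u(1)] valuation_inverse[OF u(1)])
  qed
  let ?z = "x ^ k * \<phi> t"
  have z: "?z \<noteq> 0" using x t0 by simp
  have val_z: "u ?z = of_int b * (u x - q)"
    if u: "valuation u" "\<And>x. x \<noteq> 0 \<Longrightarrow> u (\<phi> x) = of_int (\<omega> x)" for u
  proof -
    have "u ?z = real k * u x + u (\<phi> t)"
      using x t0 by (simp add: valuation_mult[OF u(1)] valuation_power[OF u(1)])
    also have "u (\<phi> t) = - of_int a" by (rule val_t) (use u in auto)
    finally show ?thesis using ab by (simp add: k right_diff_distrib)
  qed
  have "v ?z = of_int b * (v x - q)" "w ?z = of_int b * (w x - q)"
    using v w by (auto intro!: val_z)
  note vz = this
  have "v ?z > 0" unfolding vz using q(3) ab(2) by (intro mult_pos_pos) simp_all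
  then have "w ?z > 0" by (rule positive_transfer[OF z])
  moreover have "w ?z < 0" unfolding vz using q(2) ab(2) by (intro mult_pos_neg) simp_all
  ultimately show False by simp
qed

end

end

subsection \<open>Existence of extensions\<close>

definition subring_set :: "'k::field set \<Rightarrow> bool" where
  "subring_set A \<longleftrightarrow> 1 \<in> A \<and> (\<forall>x\<in>A. \<forall>y\<in>A. x - y \<in> A \<and> x * y \<in> A)"

lemma
  assumes "subring_set A"
  shows subring_set_one: "1 \<in> A"
    and subring_set_zero: "0 \<in> A"
    and subring_set_diff: "x \<in> A \<Longrightarrow> y \<in> A \<Longrightarrow> x - y \<in> A"
    and subring_set_mult: "x \<in> A \<Longrightarrow> y \<in> A \<Longrightarrow> x * y \<in> A"
    and subring_set_minus: "x \<in> A \<Longrightarrow> - x \<in> A"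
    and subring_set_add: "x \<in> A \<Longrightarrow> y \<in> A \<Longrightarrow> x + y \<in> A"
proof -
  show one: "1 \<in> A" and d: "\<And>x y. x \<in> A \<Longrightarrow> y \<in> A \<Longrightarrow> x - y \<in> A"
    and "x \<in> A \<Longrightarrow> y \<in> A \<Longrightarrow> x * y \<in> A"
    using assms by (auto simp: subring_set_def)
  show zero: "0 \<in> A" using d[OF one one] by simp
  show minus: "- x \<in> A" if "x \<in> A" for x using d[OF zero that] by simp
  show "x + y \<in> A" if "x \<in> A" "y \<in> A" using d[OF that(1) minus[OF that(2)]] by simp
qed

lemma subring_set_power: "subring_set A \<Longrightarrow> x \<in> A \<Longrightarrow> x ^ n \<in> A"
  by (induction n) (auto intro: subring_set_one subring_set_mult)

lemma subring_set_sum: "subring_set A \<Longrightarrow> (\<And>i. i \<in> S \<Longrightarrow> f i \<in> A) \<Longrightarrow> sum f S \<in> A"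
  by (induction S rule: infinite_finite_induct) (auto intro: subring_set_zero subring_set_add)

text \<open>Polynomial expressions in \<open>x\<close> of degree less than \<open>N\<close>; the
  ring \<open>A[x]\<close> is their union. The filtration by degree is kept because the argument
  below minimizes the degree.\<close>

definition adjoin :: "'k::field set \<Rightarrow> 'k \<Rightarrow> nat \<Rightarrow> 'k set" where
  "adjoin A x N = {poly p x | p. (\<forall>i. poly.coeff p i \<in> A) \<and> (\<forall>i\<ge>N. poly.coeff p i = 0)}"

lemma adjoin_subring:
  assumes "subring_set A" shows "subring_set (\<Union>N. adjoin A x N)"
proof -
  have eq: "(\<Union>N. adjoin A x N) = {poly p x | p. \<forall>i. poly.coeff p i \<in> A}"
  proof (intro equalityI subsetI)
    fix y assume "y \<in> {poly p x | p. \<forall>i. poly.coeff p i \<in> A}"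
    then obtain p where "y = poly p x" "\<forall>i. poly.coeff p i \<in> A" by auto
    then have "y \<in> adjoin A x (Suc (degree p))"
      unfolding adjoin_def by (auto intro!: exI[of _ p] coeff_eq_0)
    then show "y \<in> (\<Union>N. adjoin A x N)" by blast
  qed (auto simp: adjoin_def)
  show ?thesis unfolding eq subring_set_def
  proof (intro conjI ballI)
    show "1 \<in> {poly p x | p. \<forall>i. poly.coeff p i \<in> A}"
      using assms by (auto intro!: exI[of _ 1] simp: subring_set_one subring_set_zero coeff_1)
  next
    fix a b assume "a \<in> {poly p x | p. \<forall>i. poly.coeff p i \<in> A}" "b \<in> {poly p x | p. \<forall>i. poly.coeff p i \<in> A}"
    then obtain p q where pq: "a = poly p x" "b = poly q x" "\<And>i. poly.coeff p i \<in> A" "\<And>i. poly.coeff q i \<in> A"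
      by auto
    have "a - b = poly (p - q) x" "\<forall>i. poly.coeff (p - q) i \<in> A"
      "a * b = poly (p * q) x" "\<forall>i. poly.coeff (p * q) i \<in> A"
      using pq assms by (auto simp: coeff_mult intro!: subring_set_diff subring_set_sum subring_set_mult)
    then show "a - b \<in> {poly p x | p. \<forall>i. poly.coeff p i \<in> A}" "a * b \<in> {poly p x | p. \<forall>i. poly.coeff p i \<in> A}"
      by blast+
  qed
qed

lemma adjoin_add: "subring_set A \<Longrightarrow> y \<in> adjoin A x N \<Longrightarrow> z \<in> adjoin A x N \<Longrightarrow> y + z \<in> adjoin A x N"
  unfolding adjoin_def
proof safe
  fix p q :: "'a poly"
  assume "subring_set A" and *: "\<forall>i. poly.coeff p i \<in> A" "\<forall>i\<ge>N. poly.coeff p i = 0"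
    "\<forall>i. poly.coeff q i \<in> A" "\<forall>i\<ge>N. poly.coeff q i = 0"
  then show "\<exists>r. poly p x + poly q x = poly r x \<and> (\<forall>i. poly.coeff r i \<in> A) \<and> (\<forall>i\<ge>N. poly.coeff r i = 0)"
    by (intro exI[of _ "p + q"]) (auto intro: subring_set_add)
qed

lemma adjoin_scale: "subring_set A \<Longrightarrow> a \<in> A \<Longrightarrow> y \<in> adjoin A x N \<Longrightarrow> a * y \<in> adjoin A x N"
  unfolding adjoin_def
proof safe
  fix p :: "'a poly"
  assume "subring_set A" "a \<in> A" and *: "\<forall>i. poly.coeff p i \<in> A" "\<forall>i\<ge>N. poly.coeff p i = 0"
  then show "\<exists>r. a * poly p x = poly r x \<and> (\<forall>i. poly.coeff r i \<in> A) \<and> (\<forall>i\<ge>N. poly.coeff r i = 0)"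
    by (intro exI[of _ "smult a p"]) (auto intro: subring_set_mult)
qed

lemma adjoin_power: "subring_set A \<Longrightarrow> i < N \<Longrightarrow> x ^ i \<in> adjoin A x N"
  unfolding adjoin_def
  by (rule CollectI, rule exI[of _ "monom 1 i"]) (auto simp: poly_monom subring_set_one subring_set_zero)

lemma adjoin_sum:
  assumes "subring_set A" "\<And>i. i \<in> S \<Longrightarrow> f i \<in> adjoin A x N" shows "sum f S \<in> adjoin A x N"
proof -
  have "0 \<in> adjoin A x N" unfolding adjoin_def
    by (rule CollectI, rule exI[of _ 0]) (auto simp: subring_set_zero[OF assms(1)])
  then show ?thesis
    using assms(2) by (induction S rule: infinite_finite_induct) (auto intro: adjoin_add[OF assms(1)])
qed

lemma adjoin_SucE:
  assumes "y \<in> adjoin A x (Suc N)"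
  obtains a where "\<And>i. a i \<in> A" "y = (\<Sum>i\<le>N. a i * x ^ i)"
proof -
  obtain p where p: "y = poly p x" "\<And>i. poly.coeff p i \<in> A" "\<And>i. i \<ge> Suc N \<Longrightarrow> poly.coeff p i = 0"
    using assms unfolding adjoin_def by auto
  have "degree p \<le> N" using p(3) by (intro degree_le) auto
  then have "y = (\<Sum>i\<le>N. poly.coeff p i * x ^ i)"
    unfolding p(1) by (subst poly_as_sum_of_monoms'[symmetric, of p N]) (auto simp: poly_sum poly_monom)
  then show ?thesis using that p(2) by blast
qed

text \<open>Chevalley's device: with \<open>t\<close> the inverse of a uniformizer, such a ring
  above the integers turns out to be a valuation ring in which the uniformizer is not a
  unit.\<close>

definition maximal_without :: "'k::field \<Rightarrow> 'k set \<Rightarrow> bool" where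
  "maximal_without t A \<longleftrightarrow> subring_set A \<and> t \<notin> A \<and> (\<forall>B. subring_set B \<and> A \<subseteq> B \<and> t \<notin> B \<longrightarrow> B = A)"

lemma maximal_withoutD:
  "maximal_without t A \<Longrightarrow> subring_set B \<Longrightarrow> A \<subseteq> B \<Longrightarrow> t \<notin> B \<Longrightarrow> B = A"
  unfolding maximal_without_def by blast

lemma maximal_without_exists:
  assumes "subring_set R" "t \<notin> R" obtains A where "R \<subseteq> A" "maximal_without t A"
proof -
  let ?\<A> = "{A. subring_set A \<and> R \<subseteq> A \<and> t \<notin> A}"
  have "\<exists>M\<in>?\<A>. \<forall>X\<in>?\<A>. M \<subseteq> X \<longrightarrow> X = M"
  proof (rule subset_Zorn_nonempty)
    show "?\<A> \<noteq> {}" using assms by auto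
    fix \<C> assume ne: "\<C> \<noteq> {}" and ch: "subset.chain ?\<A> \<C>"
    have C: "subring_set X" "R \<subseteq> X" "t \<notin> X" if "X \<in> \<C>" for X
      using ch that by (auto simp: subset.chain_def)
    have "subring_set (\<Union>\<C>)"
      unfolding subring_set_def
    proof (intro conjI ballI)
      obtain X where "X \<in> \<C>" using ne by blast
      then show "1 \<in> \<Union>\<C>" using subring_set_one[OF C(1)] by blast
      fix x y assume "x \<in> \<Union>\<C>" "y \<in> \<Union>\<C>"
      then obtain X Y where XY: "X \<in> \<C>" "x \<in> X" "Y \<in> \<C>" "y \<in> Y" by auto
      then have "X \<subseteq> Y \<or> Y \<subseteq> X" using ch by (auto simp: subset.chain_def)
      then obtain Z where Z: "Z \<in> \<C>" "x \<in> Z" "y \<in> Z" using XY by blast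
      show "x - y \<in> \<Union>\<C>" "x * y \<in> \<Union>\<C>"
        using subring_set_diff[OF C(1)[OF Z(1)] Z(2,3)] subring_set_mult[OF C(1)[OF Z(1)] Z(2,3)] Z(1) by auto
    qed
    moreover have "R \<subseteq> \<Union>\<C>" using ne C(2) by blast
    moreover have "t \<notin> \<Union>\<C>" using C(3) by blast
    ultimately show "\<Union>\<C> \<in> ?\<A>" by simp
  qed
  then obtain M where M: "M \<in> ?\<A>" "\<forall>X\<in>?\<A>. M \<subseteq> X \<longrightarrow> X = M" by (elim bexE)
  have "maximal_without t M"
    unfolding maximal_without_def
  proof (intro conjI allI impI)
    show "subring_set M" "t \<notin> M" using M(1) by auto
    fix B assume "subring_set B \<and> M \<subseteq> B \<and> t \<notin> B"
    then show "B = M" using M(1) by (intro M(2)[rule_format]) auto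
  qed
  then show ?thesis using that M(1) by blast
qed

text \<open>Write \<open>t - b = t * (1 - inverse t * b)\<close> and allow all elements
  \<open>1 - inverse t * b\<close> as denominators. The resulting ring still omits \<open>t\<close>,
  because \<open>t = a * inverse (1 - inverse t * b)\<close> would give \<open>t = a + b\<close>. By
  maximality it is \<open>A\<close>, so these elements are already invertible in
  \<open>A\<close>.\<close>

lemma maximal_without_unit:
  fixes A :: "'k::field set"
  assumes max: "maximal_without t A" and t: "inverse t \<in> A" "t \<noteq> 0" and b: "b \<in> A"
  shows "inverse (t - b) \<in> A" "t - b \<noteq> 0"
proof -
  have A: "subring_set A" and tA: "t \<notin> A" using max by (auto simp: maximal_without_def)
  note closed = subring_set_one[OF A] subring_set_diff[OF A] subring_set_add[OF A] subring_set_mult[OF A]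
  let ?u = "\<lambda>b. 1 - inverse t * b"
  have tb: "t - b \<noteq> 0" if "b \<in> A" for b using that tA by auto
  then show "t - b \<noteq> 0" using b .
  have u0: "?u b \<noteq> 0" if "b \<in> A" for b
  proof -
    have "t * ?u b = t - b" using t(2) by (simp add: right_diff_distrib flip: mult.assoc)
    then show ?thesis using tb[OF that] by auto
  qed
  let ?B = "{a * inverse (?u b) | a b. a \<in> A \<and> b \<in> A}"
  have "subring_set ?B"
    unfolding subring_set_def
  proof (intro conjI ballI)
    have "1 = 1 * inverse (?u 0)" by simp
    then show "1 \<in> ?B" using closed(1) subring_set_zero[OF A] by blast
    fix x y assume "x \<in> ?B" "y \<in> ?B"
    then obtain a b c d where ab: "x = a * inverse (?u b)" "y = c * inverse (?u d)"
      "a \<in> A" "b \<in> A" "c \<in> A" "d \<in> A" by auto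
    \<comment> \<open>The product of two denominators is the denominator belonging to
      \<open>?e\<close>.\<close>
    let ?e = "b + d - inverse t * (b * d)"
    have e: "?e \<in> A" "?u ?e = ?u b * ?u d"
      using ab t by (auto intro!: closed simp: algebra_simps)
    have "x - y = (a * ?u d - c * ?u b) * inverse (?u ?e)" "x * y = (a * c) * inverse (?u ?e)"
    proof -
      have "a * inverse p - c * inverse q = (a * q - c * p) * inverse (p * q)" if "p \<noteq> 0" "q \<noteq> 0" for p q :: 'k
        using that by (simp add: field_simps)
      from this[OF u0[OF ab(4)] u0[OF ab(6)]] show "x - y = (a * ?u d - c * ?u b) * inverse (?u ?e)"
        unfolding ab(1,2) e(2) .
      show "x * y = (a * c) * inverse (?u ?e)" unfolding ab(1,2) e(2) by (simp add: mult_ac)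
    qed
    moreover have "a * ?u d - c * ?u b \<in> A" "a * c \<in> A" using ab t by (auto intro!: closed)
    ultimately show "x - y \<in> ?B" "x * y \<in> ?B" using e(1) by blast+
  qed
  moreover have "A \<subseteq> ?B"
  proof
    fix a assume "a \<in> A"
    then have "a = a * inverse (?u 0)" "a \<in> A" "0 \<in> A" using subring_set_zero[OF A] by auto
    then show "a \<in> ?B" by blast
  qed
  moreover have "t \<notin> ?B"
  proof
    assume "t \<in> ?B"
    then obtain a b where ab: "t = a * inverse (?u b)" "a \<in> A" "b \<in> A" by auto
    then have "t * ?u b = a" using u0 by (simp add: field_simps)
    then have "t = a + b" using t by (simp add: algebra_simps)
    then show False using ab tA closed by auto
  qed
  ultimately have "?B = A" by (rule maximal_withoutD[OF max])
  moreover have "inverse t * inverse (?u b) \<in> ?B" using t b by blast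
  moreover have "inverse (t - b) = inverse t * inverse (?u b)"
  proof -
    have "t - b = t * ?u b" using t(2) by (simp add: right_diff_distrib flip: mult.assoc)
    then show ?thesis by (simp add: inverse_mult_distrib)
  qed
  ultimately show "inverse (t - b) \<in> A" by simp
qed

text \<open>
  If neither \<open>x\<close> nor its inverse lies in \<open>A\<close>, then \<open>t\<close> is a polynomial in each of them; of two such
  expressions of minimal degree, the shorter one can be used to shorten the longer one.
\<close>

lemma maximal_without_reduce:
  assumes max: "maximal_without t A" and t: "inverse t \<in> A" "t \<noteq> 0" and x: "x \<noteq> 0"
    and "t \<in> adjoin A x (Suc m)" "t \<in> adjoin A (inverse x) (Suc n)" "n \<le> m" "m > 0"
  shows "t \<in> adjoin A x m"
proof -
  have A: "subring_set A" using max by (auto simp: maximal_without_def)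
  obtain a where a: "\<And>i. a i \<in> A" "t = (\<Sum>i\<le>m. a i * x ^ i)"
    using adjoin_SucE[OF assms(5)] by metis
  obtain b where b: "\<And>i. b i \<in> A" "t = (\<Sum>i\<le>n. b i * inverse x ^ i)"
    using adjoin_SucE[OF assms(6)] by metis
  have "t = b 0 + (\<Sum>i<n. b (Suc i) * inverse x ^ Suc i)"
    unfolding b(2) lessThan_Suc_atMost[symmetric] by (subst sum.lessThan_Suc_shift) simp
  \<comment> \<open>Every remaining negative power of \<open>x\<close> has exponent at most
    \<open>n\<close>, and \<open>n \<le> m\<close>, so multiplication by \<open>x ^ m\<close> leaves
    exponents from 0 to \<open>m - 1\<close>. Dividing by the unit \<open>t - b 0\<close> writes
    \<open>x ^ m\<close> through lower powers, and this is substituted for the top term of the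
    expression of \<open>t\<close>.\<close>
  then have "(t - b 0) * x ^ m = (\<Sum>i<n. b (Suc i) * (inverse x ^ Suc i * x ^ m))"
    by (simp add: algebra_simps sum_distrib_left sum_distrib_right)
  also have "\<dots> = (\<Sum>i<n. b (Suc i) * x ^ (m - Suc i))"
  proof (rule sum.cong)
    fix i assume "i \<in> {..<n}"
    then have "x ^ m = x ^ Suc i * x ^ (m - Suc i)" using \<open>n \<le> m\<close> by (simp flip: power_add power_Suc)
    moreover have "inverse x ^ Suc i * x ^ Suc i = 1"
      using x by (simp flip: power_mult_distrib del: power_Suc)
    ultimately have "inverse x ^ Suc i * x ^ m = x ^ (m - Suc i)"
      by (metis mult.assoc mult_1_left)
    then show "b (Suc i) * (inverse x ^ Suc i * x ^ m) = b (Suc i) * x ^ (m - Suc i)" by simp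
  qed simp
  also have "\<dots> \<in> adjoin A x m"
    using \<open>m > 0\<close> by (intro adjoin_sum[OF A] adjoin_scale[OF A] adjoin_power[OF A] b) auto
  finally have "inverse (t - b 0) * ((t - b 0) * x ^ m) \<in> adjoin A x m"
    by (rule adjoin_scale[OF A maximal_without_unit(1)[OF max t b(1)]])
  then have xm: "x ^ m \<in> adjoin A x m"
    using maximal_without_unit(2)[OF max t b(1)] by (simp flip: mult.assoc)
  have "t = (\<Sum>i<m. a i * x ^ i) + a m * x ^ m"
    unfolding a(2) lessThan_Suc_atMost[symmetric] by simp
  also have "\<dots> \<in> adjoin A x m"
    by (intro adjoin_add[OF A] adjoin_sum[OF A] adjoin_scale[OF A] adjoin_power[OF A] a xm) auto
  finally show ?thesis .
qed

lemma maximal_without_valuation_ring: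
  assumes max: "maximal_without t A" and t: "inverse t \<in> A" "t \<noteq> 0"
  shows "x \<in> A \<or> inverse x \<in> A"
proof (rule ccontr)
  assume neg: "\<not> ?thesis"
  have A: "subring_set A" and tA: "t \<notin> A" using max by (auto simp: maximal_without_def)
  have x: "x \<noteq> 0" using neg subring_set_zero[OF A] by auto
  \<comment> \<open>The ring \<open>A[y]\<close> contains \<open>A\<close> properly, so by
    maximality it contains \<open>t\<close>.\<close>
  have ex: "\<exists>N. t \<in> adjoin A y (Suc N)" if "y \<notin> A" for y
  proof -
    have "y \<in> (\<Union>N. adjoin A y N)" using adjoin_power[OF A, of 1 2 y] by auto
    moreover have "A \<subseteq> (\<Union>N. adjoin A y N)"
      using adjoin_scale[OF A _ adjoin_power[OF A, of 0 1 y]] by fastforce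
    ultimately have "t \<in> (\<Union>N. adjoin A y N)"
      using maximal_withoutD[OF max adjoin_subring[OF A, of y]] that by metis
    then obtain N where "t \<in> adjoin A y N" by blast
    moreover have "adjoin A y N \<subseteq> adjoin A y (Suc N)" unfolding adjoin_def by auto
    ultimately show ?thesis by blast
  qed
  \<comment> \<open>The least degree bound of an expression for \<open>t\<close> in
    \<open>y\<close>; the successor appears because \<open>adjoin A y N\<close> has degrees strictly
    below \<open>N\<close>. Degree bound 0 would put \<open>t\<close> into \<open>A\<close>.\<close>
  define m where "m y = (LEAST N. t \<in> adjoin A y (Suc N))" for y
  have m: "t \<in> adjoin A y (Suc (m y))" if "y \<notin> A" for y
    unfolding m_def using ex[OF that] by (rule LeastI_ex)
  have m0: "m y > 0" if y: "y \<notin> A" for y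
  proof (rule ccontr)
    assume "\<not> m y > 0"
    then have "t \<in> adjoin A y (Suc 0)" using m[OF y] by simp
    then obtain a where "\<And>i. a i \<in> A" "t = (\<Sum>i\<le>0. a i * y ^ i)" using adjoin_SucE by metis
    then show False using tA by simp
  qed
  have min: "t \<notin> adjoin A y (m y)" if y: "y \<notin> A" for y
  proof -
    have "m y - 1 < (LEAST N. t \<in> adjoin A y (Suc N))" using m0[OF y] unfolding m_def by linarith
    then have "t \<notin> adjoin A y (Suc (m y - 1))" by (rule not_less_Least)
    then show ?thesis using m0[OF y] by simp
  qed
  show False
  proof (cases "m (inverse x) \<le> m x")
    case True
    then show False
      using maximal_without_reduce[OF max t x m[of x] m[of "inverse x"] _ m0[of x]] min[of x] neg by simp
  next
    case False
    then show False
      using maximal_without_reduce[OF max t, of "inverse x" "m (inverse x)" "m x"] m[of "inverse x"] m[of x]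
        x m0[of "inverse x"] min[of "inverse x"] neg by simp
  qed
qed

section \<open>Units and terms of least value in a valuation ring\<close>

definition units_set :: "'k::field set \<Rightarrow> 'k set" where
  "units_set A = {u \<in> A. u \<noteq> 0 \<and> inverse u \<in> A}"

lemma units_set_mult: "subring_set A \<Longrightarrow> x \<in> units_set A \<Longrightarrow> y \<in> units_set A \<Longrightarrow> x * y \<in> units_set A"
  by (simp add: units_set_def subring_set_mult)

lemma units_set_inverse: "x \<in> units_set A \<Longrightarrow> inverse x \<in> units_set A"
  by (simp add: units_set_def)

lemma units_set_power: "subring_set A \<Longrightarrow> x \<in> units_set A \<Longrightarrow> x ^ n \<in> units_set A"
  by (simp add: units_set_def subring_set_power flip: power_inverse)

text \<open>A valuation ring is local. One of the two quotients lies in \<open>A\<close>, say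
  \<open>x * inverse y\<close>; if \<open>x + y\<close> were a unit, then
  \<open>inverse y = (1 + x * inverse y) * inverse (x + y)\<close> would lie in \<open>A\<close> and
  \<open>y\<close> would be a unit.\<close>

lemma non_units_add:
  assumes A: "subring_set A" and val: "\<And>x. x \<in> A \<or> inverse x \<in> A"
    and x: "x \<in> A - units_set A" and y: "y \<in> A - units_set A"
  shows "x + y \<in> A - units_set A"
proof -
  have *: "x + y \<notin> units_set A"
    if "x \<in> A - units_set A" "y \<in> A - units_set A" "x * inverse y \<in> A" "y \<noteq> 0" for x y
  proof
    assume u: "x + y \<in> units_set A"
    have "(1 + x * inverse y) * inverse (x + y) \<in> A"
      using that(3) u A by (auto simp: units_set_def intro: subring_set_mult subring_set_add subring_set_one)
    moreover have "(1 + x * inverse y) * inverse (x + y) = inverse y"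
    proof -
      have "(1 + x * inverse y) = inverse y * (x + y)" using \<open>y \<noteq> 0\<close> by (simp add: field_simps)
      then show ?thesis using u by (simp add: units_set_def)
    qed
    ultimately show False using that by (auto simp: units_set_def)
  qed
  have "x + y \<notin> units_set A"
  proof (cases "x = 0 \<or> y = 0")
    case True
    then show ?thesis using x y by auto
  next
    case False
    have "x * inverse y \<in> A \<or> y * inverse x \<in> A" using val[of "x * inverse y"] by (simp add: mult.commute)
    then show ?thesis using *[OF x y] *[OF y x] False by (auto simp: add.commute)
  qed
  then show ?thesis using x y subring_set_add[OF A] by auto
qed

lemma non_units_sum:
  assumes A: "subring_set A" and val: "\<And>x. x \<in> A \<or> inverse x \<in> A"
  shows "finite S \<Longrightarrow> (\<And>i. i \<in> S \<Longrightarrow> f i \<in> A - units_set A) \<Longrightarrow> sum f S \<in> A - units_set A"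
proof (induction rule: finite_induct)
  case empty
  then show ?case using subring_set_zero[OF A] by (simp add: units_set_def)
next
  case (insert i S)
  then show ?case using non_units_add[OF A val] by simp
qed

text \<open>Divisibility in \<open>A\<close> is a total preorder on the nonzero elements, so a
  finite family has a member dividing all the others.\<close>

lemma valuation_ring_min:
  assumes A: "subring_set A" and val: "\<And>x. x \<in> A \<or> inverse x \<in> A"
  shows "finite S \<Longrightarrow> S \<noteq> {} \<Longrightarrow> (\<And>i. i \<in> S \<Longrightarrow> T i \<noteq> 0) \<Longrightarrow> \<exists>i\<in>S. \<forall>j\<in>S. T j * inverse (T i) \<in> A"
proof (induction rule: finite_ne_induct)
  case (singleton i)
  then show ?case using subring_set_one[OF A] by simp
next
  case (insert k S)
  then obtain i where i: "i \<in> S" "\<And>j. j \<in> S \<Longrightarrow> T j * inverse (T i) \<in> A" by auto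
  have nz: "T i \<noteq> 0" "T k \<noteq> 0" using insert.prems i(1) by auto
  show ?case
  proof (cases "T k * inverse (T i) \<in> A")
    case True
    then have "\<forall>j\<in>insert k S. T j * inverse (T i) \<in> A" using i by simp
    then show ?thesis using i(1) by blast
  next
    case False
    then have ik: "T i * inverse (T k) \<in> A" using val[of "T k * inverse (T i)"] by (simp add: mult.commute)
    have "T j * inverse (T k) \<in> A" if "j \<in> S" for j
    proof -
      have "T j * inverse (T k) = (T j * inverse (T i)) * (T i * inverse (T k))" using nz by simp
      then show ?thesis using subring_set_mult[OF A i(2)[OF that] ik] by metis
    qed
    then have "\<forall>j\<in>insert k S. T j * inverse (T k) \<in> A" using nz subring_set_one[OF A] by simp
    then show ?thesis by blast
  qed
qed

text \<open>After division by a term of least value, the other terms lie in \<open>A\<close> and add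
  up to \<open>- 1\<close>. As non-units are closed under addition, one of them is a unit. In other
  words, the least value in a vanishing sum is attained twice.\<close>

lemma vanishing_sum_unit_ratio:
  assumes A: "subring_set A" and val: "\<And>x. x \<in> A \<or> inverse x \<in> A"
    and S: "finite S" "S \<noteq> {}" "\<And>i. i \<in> S \<Longrightarrow> T i \<noteq> 0" "sum T S = 0"
  obtains i j where "i \<in> S" "j \<in> S" "i \<noteq> j" "T j * inverse (T i) \<in> units_set A"
proof -
  obtain i where i: "i \<in> S" "\<And>j. j \<in> S \<Longrightarrow> T j * inverse (T i) \<in> A"
    using valuation_ring_min[OF A val S(1,2), of T] S(3) by auto
  have "\<exists>j\<in>S - {i}. T j * inverse (T i) \<in> units_set A"
  proof (rule ccontr)
    assume "\<not> ?thesis"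
    then have "T j * inverse (T i) \<in> A - units_set A" if "j \<in> S - {i}" for j using i that by auto
    then have *: "(\<Sum>j\<in>S - {i}. T j * inverse (T i)) \<in> A - units_set A"
      using S(1) by (intro non_units_sum[OF A val]) auto
    have "(\<Sum>j\<in>S. T j * inverse (T i)) = 0" using S(4) by (simp flip: sum_distrib_right)
    then have "(\<Sum>j\<in>S - {i}. T j * inverse (T i)) = - 1"
      using S(1,3) i(1) by (simp add: sum.remove add_eq_0_iff)
    moreover have "- 1 \<in> units_set A"
      using subring_set_minus[OF A subring_set_one[OF A]] by (simp add: units_set_def)
    ultimately show False using * by simp
  qed
  then show ?thesis using that i(1) by blast
qed

section \<open>The real valuation defined by a valuation ring\<close>

context field_embedding
begin

context
  fixes \<omega> :: "'f \<Rightarrow> int" and \<pi> :: 'f and A :: "'k set"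
  assumes alg: "\<And>z. \<exists>p. p \<noteq> 0 \<and> poly (map_poly \<phi> p) z = 0"
    and \<omega>: "valuation (\<lambda>x. real_of_int (\<omega> x))"
    and A: "subring_set A" and val: "\<And>x. x \<in> A \<or> inverse x \<in> A"
    and A_base: "\<And>x. \<phi> x \<in> A \<longleftrightarrow> x = 0 \<or> 0 \<le> \<omega> x"
begin

text \<open>\<open>x ^ k\<close> and \<open>\<phi> c\<close> differ by a unit of \<open>A\<close>,
  so a valuation with ring \<open>A\<close> that extends \<open>\<omega>\<close> can only take the
  value \<open>\<omega> c / k\<close> at \<open>x\<close>.\<close>

definition commensurable :: "'k \<Rightarrow> nat \<Rightarrow> 'f \<Rightarrow> bool" where
  "commensurable x k c \<longleftrightarrow> 0 < k \<and> c \<noteq> 0 \<and> x ^ k * inverse (\<phi> c) \<in> units_set A"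

text \<open>The choice is harmless: all commensurable pairs give the same quotient, by
  \<open>commensurable_unique\<close>. The value 0 at 0 is a default.\<close>

definition extended_val :: "'k \<Rightarrow> real" where
  "extended_val x = (if x = 0 then 0
     else SOME r. \<exists>k c. commensurable x k c \<and> r = of_int (\<omega> c) / real k)"

lemma base_unit: "\<phi> c \<in> units_set A \<longleftrightarrow> c \<noteq> 0 \<and> \<omega> c = 0"
proof (cases "c = 0")
  case False
  have "real_of_int (\<omega> (inverse c)) = real_of_int (- \<omega> c)"
    using valuation_inverse[OF \<omega> False] by simp
  then have inv: "\<omega> (inverse c) = - \<omega> c" by (simp only: of_int_eq_iff)
  have "inverse (\<phi> c) \<in> A \<longleftrightarrow> \<omega> c \<le> 0"
    using A_base[of "inverse c"] False unfolding inv hom_inverse by simp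
  then have "\<phi> c \<in> units_set A \<longleftrightarrow> 0 \<le> \<omega> c \<and> \<omega> c \<le> 0"
    unfolding units_set_def mem_Collect_eq using False A_base[of c] hom_eq_0_iff[of c] by blast
  moreover have "\<omega> c = 0 \<longleftrightarrow> 0 \<le> \<omega> c \<and> \<omega> c \<le> 0" by linarith
  ultimately show ?thesis using False by blast
qed (simp add: units_set_def)

text \<open>In a polynomial relation for \<open>x\<close> two nonzero terms have a unit as quotient.
  Their powers of \<open>x\<close> differ by \<open>x ^ (j - i)\<close>, which is therefore
  comparable with a quotient of coefficients.\<close>

lemma commensurable_exists:
  assumes x: "x \<noteq> 0" shows "\<exists>k c. commensurable x k c"
proof -
  obtain p where p: "p \<noteq> 0" "poly (map_poly \<phi> p) x = 0" using alg by blast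
  define T where "T i = \<phi> (poly.coeff p i) * x ^ i" for i
  define S where "S = {i. i \<le> degree p \<and> poly.coeff p i \<noteq> 0}"
  have "poly (map_poly \<phi> p) x = (\<Sum>i\<le>degree p. T i)"
    unfolding T_def
    by (subst poly_as_sum_of_monoms'[symmetric, of "map_poly \<phi> p" "degree p"])
       (simp_all add: map_poly_degree_leq poly_sum poly_monom coeff_map_poly)
  also have "\<dots> = sum T S"
    by (rule sum.mono_neutral_right) (auto simp: S_def T_def)
  finally have sum: "sum T S = 0" using p by simp
  have fin: "finite S" by (simp add: S_def)
  have "degree p \<in> S" using p(1) by (simp add: S_def)
  then have ne: "S \<noteq> {}" by blast
  have nz: "T i \<noteq> 0" if "i \<in> S" for i using that x by (simp add: S_def T_def)
  obtain i j where ij: "i \<in> S" "j \<in> S" "i \<noteq> j" "T j * inverse (T i) \<in> units_set A"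
    by (rule vanishing_sum_unit_ratio[OF A val fin ne nz sum])
  have *: "\<exists>k c. commensurable x k c" if "i < j" "i \<in> S" "j \<in> S" "T j * inverse (T i) \<in> units_set A" for i j
  proof -
    define k where "k = j - i"
    define c where "c = poly.coeff p i * inverse (poly.coeff p j)"
    have "T j * inverse (T i) = x ^ k * inverse (\<phi> c)"
    proof -
      have "x ^ j = x ^ i * x ^ k" using that(1) by (simp add: k_def flip: power_add)
      moreover have "inverse (\<phi> c) = \<phi> (poly.coeff p j) * inverse (\<phi> (poly.coeff p i))"
        by (simp add: c_def mult.commute)
      ultimately show ?thesis using x by (simp add: T_def mult_ac)
    qed
    then have "commensurable x k c"
      using that by (simp add: commensurable_def c_def k_def S_def)
    then show ?thesis by blast
  qed
  show ?thesis
  proof (cases "i < j")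
    case True
    then show ?thesis using * ij by blast
  next
    case False
    have "T i * inverse (T j) \<in> units_set A" using units_set_inverse[OF ij(4)] by (simp add: mult.commute)
    then show ?thesis using *[of j i] ij False by simp
  qed
qed

lemma val_power: "c \<noteq> 0 \<Longrightarrow> \<omega> (c ^ n) = int n * \<omega> c"
proof -
  assume "c \<noteq> 0"
  then have "real_of_int (\<omega> (c ^ n)) = real n * real_of_int (\<omega> c)" by (rule valuation_power[OF \<omega>])
  then have "real_of_int (\<omega> (c ^ n)) = real_of_int (int n * \<omega> c)" by simp
  then show ?thesis by (simp only: of_int_eq_iff)
qed

lemma val_mult: "c \<noteq> 0 \<Longrightarrow> d \<noteq> 0 \<Longrightarrow> \<omega> (c * d) = \<omega> c + \<omega> d"
proof -
  assume "c \<noteq> 0" "d \<noteq> 0"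
  then have "real_of_int (\<omega> (c * d)) = real_of_int (\<omega> c + \<omega> d)" using valuation_mult[OF \<omega>] by simp
  then show ?thesis by (simp only: of_int_eq_iff)
qed

text \<open>Both \<open>c ^ l\<close> and \<open>d ^ k\<close> agree with \<open>x ^ (k * l)\<close>
  up to units of \<open>A\<close>. Their quotient is a unit coming from the base field, and such
  units have valuation 0.\<close>

lemma commensurable_unique:
  assumes x: "x \<noteq> 0" and "commensurable x k c" "commensurable x l d"
  shows "of_int (\<omega> c) / real k = of_int (\<omega> d) / real l"
proof -
  have kl: "k > 0" "l > 0" "c \<noteq> 0" "d \<noteq> 0" and u: "x ^ k * inverse (\<phi> c) \<in> units_set A"
    "x ^ l * inverse (\<phi> d) \<in> units_set A" using assms by (auto simp: commensurable_def)
  have "(x ^ k * inverse (\<phi> c)) ^ l * inverse ((x ^ l * inverse (\<phi> d)) ^ k) \<in> units_set A"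
    by (rule units_set_mult[OF A units_set_power[OF A u(1)] units_set_inverse[OF units_set_power[OF A u(2)]]])
  also have "(x ^ k * inverse (\<phi> c)) ^ l * inverse ((x ^ l * inverse (\<phi> d)) ^ k) = \<phi> (d ^ k * inverse (c ^ l))"
  proof -
    have "x ^ (l * k) \<noteq> 0" using x by simp
    then show ?thesis using kl
      by (simp add: power_mult_distrib inverse_mult_distrib power_inverse mult.commute[of k l] flip: power_mult)
  qed
  finally have "\<omega> (d ^ k * inverse (c ^ l)) = 0" unfolding base_unit by blast
  moreover have "\<omega> ((d ^ k * inverse (c ^ l)) * c ^ l) = \<omega> (d ^ k * inverse (c ^ l)) + \<omega> (c ^ l)"
    using kl by (intro val_mult) simp_all
  moreover have "(d ^ k * inverse (c ^ l)) * c ^ l = d ^ k" using kl by simp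
  ultimately have "\<omega> (d ^ k) = \<omega> (c ^ l)" by simp
  then have "int k * \<omega> d = int l * \<omega> c" using kl by (simp add: val_power)
  then have "real_of_int (int k * \<omega> d) = real_of_int (int l * \<omega> c)" by (rule arg_cong)
  then have "real k * of_int (\<omega> d) = real l * of_int (\<omega> c)" by simp
  then show ?thesis using kl by (simp add: frac_eq_eq mult.commute)
qed

lemma extended_val_eq:
  assumes x: "x \<noteq> 0" and c: "commensurable x k c"
  shows "extended_val x = of_int (\<omega> c) / real k"
proof -
  have "\<exists>k c. commensurable x k c \<and> extended_val x = of_int (\<omega> c) / real k"
    unfolding extended_val_def using x c by (simp del: ex_simps) (rule someI_ex, blast)
  then obtain l d where "commensurable x l d" "extended_val x = of_int (\<omega> d) / real l" by blast
  then show ?thesis using commensurable_unique[OF x] c by metis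
qed

lemma extended_val_base: "c \<noteq> 0 \<Longrightarrow> extended_val (\<phi> c) = of_int (\<omega> c)"
  using extended_val_eq[of "\<phi> c" 1 c] subring_set_one[OF A] by (simp add: commensurable_def units_set_def)

lemma extended_val_mult:
  assumes "x \<noteq> 0" "y \<noteq> 0" shows "extended_val (x * y) = extended_val x + extended_val y"
proof -
  obtain k c l d where kc: "commensurable x k c" "commensurable y l d"
    using commensurable_exists assms by meson
  then have kl: "k > 0" "l > 0" "c \<noteq> 0" "d \<noteq> 0" and u: "x ^ k * inverse (\<phi> c) \<in> units_set A"
    "y ^ l * inverse (\<phi> d) \<in> units_set A" by (auto simp: commensurable_def)
  have "(x ^ k * inverse (\<phi> c)) ^ l * (y ^ l * inverse (\<phi> d)) ^ k \<in> units_set A"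
    by (rule units_set_mult[OF A units_set_power[OF A u(1)] units_set_power[OF A u(2)]])
  also have "(x ^ k * inverse (\<phi> c)) ^ l * (y ^ l * inverse (\<phi> d)) ^ k =
      (x * y) ^ (k * l) * inverse (\<phi> (c ^ l * d ^ k))"
    by (simp add: power_mult_distrib inverse_mult_distrib power_inverse mult.commute[of l k] mult_ac
        flip: power_mult)
  finally have "commensurable (x * y) (k * l) (c ^ l * d ^ k)" using kl by (simp add: commensurable_def)
  then have "extended_val (x * y) = of_int (\<omega> (c ^ l * d ^ k)) / real (k * l)"
    using assms by (intro extended_val_eq) auto
  also have "\<dots> = of_int (\<omega> c) / real k + of_int (\<omega> d) / real l"
  proof -
    have "real_of_int (\<omega> (c ^ l * d ^ k)) = real l * of_int (\<omega> c) + real k * of_int (\<omega> d)"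
      using kl by (simp add: val_mult val_power)
    then show ?thesis using kl by (simp add: add_frac_eq)
  qed
  finally show ?thesis using extended_val_eq assms kc by simp
qed

text \<open>Membership of \<open>x ^ k\<close> in \<open>A\<close> is decided by \<open>c\<close>.
  It passes down to \<open>x\<close> because valuation rings are integrally closed: if
  \<open>x\<close> were not in \<open>A\<close>, then \<open>inverse x\<close> would be, and
  \<open>x = x ^ k * inverse x ^ (k - 1)\<close>.\<close>

lemma extended_val_nonneg:
  assumes x: "x \<noteq> 0" shows "0 \<le> extended_val x \<longleftrightarrow> x \<in> A"
proof -
  obtain k c where kc: "commensurable x k c" using commensurable_exists[OF x] by blast
  then have k: "k > 0" "c \<noteq> 0" and u: "x ^ k * inverse (\<phi> c) \<in> units_set A" by (auto simp: commensurable_def)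
  have "x ^ k \<in> A \<longleftrightarrow> \<phi> c \<in> A"
  proof -
    have "x ^ k = (x ^ k * inverse (\<phi> c)) * \<phi> c" "\<phi> c = inverse (x ^ k * inverse (\<phi> c)) * x ^ k"
      using k x by (auto simp: field_simps)
    then show ?thesis using u subring_set_mult[OF A] unfolding units_set_def
      by (metis (no_types, lifting) mem_Collect_eq)
  qed
  moreover have "x ^ k \<in> A \<longleftrightarrow> x \<in> A"
  proof
    assume *: "x ^ k \<in> A"
    show "x \<in> A"
    proof (rule ccontr)
      assume "x \<notin> A"
      then have "inverse x \<in> A" using val by blast
      then have "x ^ k * inverse x ^ (k - 1) \<in> A" 
        by (intro subring_set_mult[OF A *] subring_set_power[OF A])
      moreover have "x ^ k * inverse x ^ (k - 1) = x"
        using x k(1) by (cases k) (simp_all add: power_inverse)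
      ultimately show False using \<open>x \<notin> A\<close> by simp
    qed
  qed (rule subring_set_power[OF A])
  moreover have "0 \<le> extended_val x \<longleftrightarrow> 0 \<le> \<omega> c"
    using k by (simp add: extended_val_eq[OF x kc] zero_le_divide_iff)
  ultimately show ?thesis using A_base[of c] k by blast
qed

text \<open>If \<open>y\<close> has at least the value of \<open>x\<close>, then
  \<open>inverse x * y\<close> lies in \<open>A\<close>, hence so does its sum with 1, and
  \<open>x + y\<close> is \<open>x\<close> times that sum.\<close>

lemma extended_valuation: "valuation extended_val"
proof -
  have *: "extended_val x \<le> extended_val (x + y)"
    if "x \<noteq> 0" "y \<noteq> 0" "x + y \<noteq> 0" "extended_val x \<le> extended_val y" for x y
  proof -
    define q where "q = inverse x * y"
    have q: "q \<noteq> 0" and xq: "x * q = y" using that by (simp_all add: q_def)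
    have "extended_val (x * q) = extended_val x + extended_val q" by (rule extended_val_mult[OF that(1) q])
    then have "0 \<le> extended_val q" using that(4) unfolding xq by simp
    then have "1 + q \<in> A"
      unfolding extended_val_nonneg[OF q] by (rule subring_set_add[OF A subring_set_one[OF A]])
    moreover have sum: "x + y = x * (1 + q)" using xq by (simp add: distrib_left)
    then have nz: "1 + q \<noteq> 0" using that(3) by auto
    ultimately have "0 \<le> extended_val (1 + q)" by (simp add: extended_val_nonneg)
    then show ?thesis unfolding sum extended_val_mult[OF that(1) nz] by simp
  qed
  show ?thesis unfolding valuation_def
  proof (intro conjI allI impI)
    fix x y :: 'k assume xy: "x \<noteq> 0" "y \<noteq> 0" "x + y \<noteq> 0"
    show "min (extended_val x) (extended_val y) \<le> extended_val (x + y)"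
    proof (cases "extended_val x \<le> extended_val y")
      case True
      then show ?thesis using *[OF xy True] by simp
    next
      case False
      then have "extended_val y \<le> extended_val (y + x)" using xy by (intro *) (simp_all add: add.commute)
      then show ?thesis by (simp add: add.commute)
    qed
  qed (rule extended_val_mult)
qed

end

text \<open>The subring is taken maximal above the image of the integers of \<open>\<omega>\<close>
  and without the inverse of \<open>\<phi> \<pi>\<close>. Omitting this one element is enough to
  make it meet the base field exactly in the integers.\<close>

lemma valuation_extension_exists:
  assumes alg: "\<And>z. \<exists>p. p \<noteq> 0 \<and> poly (map_poly \<phi> p) z = 0"
    and \<omega>: "valuation (\<lambda>x. real_of_int (\<omega> x))" and \<pi>: "\<pi> \<noteq> 0" "\<omega> \<pi> = 1"
  shows "\<exists>v. valuation v \<and> (\<forall>x. x \<noteq> 0 \<longrightarrow> v (\<phi> x) = of_int (\<omega> x))"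
proof -
  let ?I = "{x. val_ge (\<lambda>x. real_of_int (\<omega> x)) x 0}"
  have one: "\<omega> 1 = 0" using valuation_one[OF \<omega>] by simp
  have sub_I: "subring_set (\<phi> ` ?I)"
    unfolding subring_set_def
  proof (intro conjI ballI)
    have "1 \<in> ?I" by (simp add: val_ge_def one)
    from imageI[OF this, of \<phi>] show "1 \<in> \<phi> ` ?I" by simp
    fix x y assume "x \<in> \<phi> ` ?I" "y \<in> \<phi> ` ?I"
    then obtain a b where ab: "x = \<phi> a" "y = \<phi> b" "a \<in> ?I" "b \<in> ?I" by blast
    then have "a - b \<in> ?I" "a * b \<in> ?I"
      using val_ge_diff[OF \<omega>, of a 0 b] val_ge_mult[OF \<omega>, of a 0 b 0] by auto
    then show "x - y \<in> \<phi> ` ?I" "x * y \<in> \<phi> ` ?I"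
      unfolding ab(1,2) hom_diff[symmetric] hom_mult[symmetric] by blast+
  qed
  have inv_pi: "\<omega> (inverse \<pi>) = - 1" using valuation_inverse[OF \<omega> \<pi>(1)] \<pi>(2) by simp
  have t_I: "inverse (\<phi> \<pi>) \<notin> \<phi> ` ?I"
  proof
    assume "inverse (\<phi> \<pi>) \<in> \<phi> ` ?I"
    then obtain a where a: "\<phi> (inverse \<pi>) = \<phi> a" "a \<in> ?I" by auto
    then have "\<phi> (inverse \<pi> - a) = 0" by simp
    then have "inverse \<pi> = a" unfolding hom_eq_0_iff by simp
    then show False using a(2) \<pi> inv_pi by (auto simp: val_ge_def)
  qed
  obtain A where sub: "\<phi> ` ?I \<subseteq> A" and max: "maximal_without (inverse (\<phi> \<pi>)) A"
    by (rule maximal_without_exists[OF sub_I t_I])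
  have A: "subring_set A" and tA: "inverse (\<phi> \<pi>) \<notin> A" using max by (simp_all add: maximal_without_def)
  have in_A: "\<phi> x \<in> A" if "x = 0 \<or> 0 \<le> \<omega> x" for x using sub that by (auto simp: val_ge_def)
  have val: "x \<in> A \<or> inverse x \<in> A" for x
    using maximal_without_valuation_ring[OF max] in_A[of \<pi>] \<pi> by simp
  have base: "\<phi> x \<in> A \<longleftrightarrow> x = 0 \<or> 0 \<le> \<omega> x" for x
  proof
    assume xA: "\<phi> x \<in> A"
    show "x = 0 \<or> 0 \<le> \<omega> x"
    proof (rule ccontr)
      assume neg: "\<not> (x = 0 \<or> 0 \<le> \<omega> x)"
      \<comment> \<open>Since \<open>\<omega>\<close> is integer-valued, \<open>\<omega> x\<close>
        is at most \<open>- 1\<close>, so this product is integral. Multiplying it by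
        \<open>x\<close> would put the inverse of the uniformizer into \<open>A\<close>.\<close>
      have "real_of_int (\<omega> (inverse x * inverse \<pi>)) = - of_int (\<omega> x) - 1"
        using neg \<pi> by (simp add: valuation_mult[OF \<omega>] valuation_inverse[OF \<omega>])
      then have "0 \<le> \<omega> (inverse x * inverse \<pi>)" using neg by linarith
      then have "\<phi> (inverse x * inverse \<pi>) \<in> A" by (intro in_A disjI2)
      then have "\<phi> x * \<phi> (inverse x * inverse \<pi>) \<in> A" using xA by (intro subring_set_mult[OF A])
      then show False using tA neg by (simp flip: mult.assoc)
    qed
  qed (rule in_A)
  have "valuation (extended_val \<omega> A)" using alg \<omega> A val base by (rule extended_valuation)
  moreover have "extended_val \<omega> A (\<phi> x) = of_int (\<omega> x)" if "x \<noteq> 0" for x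
    using alg \<omega> A val base that by (rule extended_val_base)
  ultimately show ?thesis by blast
qed

end

subsection \<open>The topology on matrices over the algebraic closure of a local field\<close>

interpretation to_ac: field_embedding "to_ac :: 'f::field \<Rightarrow> 'f alg_closure"
  by unfold_locales simp_all

lemma ext_val_valuation:
  fixes \<omega> :: "'f::field \<Rightarrow> int"
  assumes "nonarch_local_field \<omega>" shows "valuation (ext_val \<omega>)"
proof -
  let ?ext = "\<lambda>v. v 0 = 0 \<and> (\<forall>x. x \<noteq> 0 \<longrightarrow> v (to_ac x :: 'f alg_closure) = real_of_int (\<omega> x)) \<and> valuation v"
  have alg: "\<exists>p::'f poly. p \<noteq> 0 \<and> poly (map_poly to_ac p) z = 0" for z
    using alg_closure_algebraic by metis
  note field = assms[unfolded nonarch_local_field_def, folded complete_valuation_def]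
  have "\<exists>\<pi>. \<pi> \<noteq> 0 \<and> \<omega> \<pi> = 1" using field by (elim conjE)
  then obtain \<pi> where \<pi>: "\<pi> \<noteq> 0" "\<omega> \<pi> = 1" by blast
  have \<omega>: "valuation (\<lambda>x. real_of_int (\<omega> x))"
  proof -
    have *: "\<And>x y. x \<noteq> 0 \<Longrightarrow> y \<noteq> 0 \<Longrightarrow> \<omega> (x * y) = \<omega> x + \<omega> y"
      "\<And>x y. x \<noteq> 0 \<Longrightarrow> y \<noteq> 0 \<Longrightarrow> x + y \<noteq> 0 \<Longrightarrow> min (\<omega> x) (\<omega> y) \<le> \<omega> (x + y)"
      using conjunct1[OF field] conjunct1[OF conjunct2[OF field]] by blast+
    show ?thesis unfolding valuation_def
    proof (intro conjI allI impI)
      fix x y :: 'f assume "x \<noteq> 0" "y \<noteq> 0" "x + y \<noteq> 0"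
      from *(2)[OF this] show "min (real_of_int (\<omega> x)) (real_of_int (\<omega> y)) \<le> real_of_int (\<omega> (x + y))"
        by linarith
    qed (simp add: *)
  qed
  have compl: "complete_valuation \<omega>"
    using field by (elim conjE)
  obtain v where v: "valuation v" "\<And>x. x \<noteq> 0 \<Longrightarrow> v (to_ac x :: 'f alg_closure) = real_of_int (\<omega> x)"
    using to_ac.valuation_extension_exists[OF alg \<omega> \<pi>] by blast
  have "\<exists>!v. ?ext v"
  proof (rule ex1I)
    \<comment> \<open>The existence result says nothing at 0, where the description prescribes 0;
      the value there is overwritten.\<close>
    show "?ext (v(0 := 0))" using v by (simp add: valuation_def)
    fix w assume w: "?ext w"
    note w0 = conjunct1[OF w] and w = conjunct2[OF conjunct2[OF w]] conjunct1[OF conjunct2[OF w], rule_format]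
    have "w x = v x" if "x \<noteq> 0" for x
    proof (rule antisym)
      show "w x \<le> v x" by (rule to_ac.extension_le[of \<omega> \<pi>]) (use alg compl \<pi> v w that in auto)
      show "v x \<le> w x" by (rule to_ac.extension_le[of \<omega> \<pi>]) (use alg compl \<pi> v w that in auto)
    qed
    then show "w = v(0 := 0)" using w0 by (simp add: fun_eq_iff)
  qed
  from theI'[OF this] have "valuation (THE v. ?ext v)" by (elim conjE)
  then show ?thesis by (simp only: ext_val_def valuation_def)
qed

section \<open>Ultrametric balls of matrices\<close>

definition near :: "('k::field \<Rightarrow> real) \<Rightarrow> real \<Rightarrow> 'k \<Rightarrow> 'k \<Rightarrow> bool" where
  "near v r a b \<longleftrightarrow> a = b \<or> r < v (a - b)"

definition mat_ball :: "('k::field \<Rightarrow> real) \<Rightarrow> nat \<Rightarrow> 'k mat \<Rightarrow> real \<Rightarrow> 'k mat set" where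
  "mat_ball v n x r = {y \<in> carrier_mat n n. \<forall>i<n. \<forall>j<n. near v r (y $$ (i, j)) (x $$ (i, j))}"

text \<open>\<open>mat_topology\<close> applies the abstraction function \<open>topology\<close> to
  a predicate, so its open sets are known only after the predicate is seen to be a topology. Larger
  \<open>r\<close> means smaller balls, hence the maximum for intersections.\<close>

lemma openin_mat_topology:
  "openin (mat_topology v n) U \<longleftrightarrow> U \<subseteq> carrier_mat n n \<and> (\<forall>x\<in>U. \<exists>r. mat_ball v n x r \<subseteq> U)"
proof -
  let ?op = "\<lambda>U. U \<subseteq> carrier_mat n n \<and> (\<forall>x\<in>U. \<exists>r. mat_ball v n x r \<subseteq> U)"
  have mono: "mat_ball v n x (max r s) \<subseteq> mat_ball v n x r \<inter> mat_ball v n x s" for x r s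
    unfolding mat_ball_def near_def by auto
  have "istopology ?op"
    unfolding istopology_def
  proof (intro conjI allI impI)
    fix S T assume "?op S" "?op T"
    show "S \<inter> T \<subseteq> carrier_mat n n" using \<open>?op S\<close> by blast
    show "\<forall>x\<in>S \<inter> T. \<exists>r. mat_ball v n x r \<subseteq> S \<inter> T"
    proof
      fix x assume x: "x \<in> S \<inter> T"
      obtain r where r: "mat_ball v n x r \<subseteq> S" using \<open>?op S\<close> x by blast
      obtain s where s: "mat_ball v n x s \<subseteq> T" using \<open>?op T\<close> x by blast
      have "mat_ball v n x (max r s) \<subseteq> S \<inter> T" using mono[of x r s] r s by blast
      then show "\<exists>r. mat_ball v n x r \<subseteq> S \<inter> T" by blast
    qed
  next
    fix \<K> assume *: "\<forall>K\<in>\<K>. ?op K"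
    show "\<Union>\<K> \<subseteq> carrier_mat n n" using * by blast
    show "\<forall>x\<in>\<Union>\<K>. \<exists>r. mat_ball v n x r \<subseteq> \<Union>\<K>"
    proof
      fix x assume "x \<in> \<Union>\<K>"
      then obtain K where K: "K \<in> \<K>" "x \<in> K" by blast
      then obtain r where "mat_ball v n x r \<subseteq> K" using * by blast
      then have "mat_ball v n x r \<subseteq> \<Union>\<K>" using K(1) by blast
      then show "\<exists>r. mat_ball v n x r \<subseteq> \<Union>\<K>" by blast
    qed
  qed
  moreover have "mat_topology v n = topology ?op"
    unfolding mat_topology_def mat_ball_def near_def
    by (rule arg_cong[where f = topology], rule ext) (simp add: subset_iff Ball_def imp_conjL)
  ultimately show ?thesis by (simp add: topology_inverse')
qed

lemma topspace_mat_topology [simp]: "topspace (mat_topology v n) = carrier_mat n n"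
proof -
  have "openin (mat_topology v n) (carrier_mat n n)"
    unfolding openin_mat_topology by (auto simp: mat_ball_def)
  then show ?thesis
    using openin_mat_topology[of v n] unfolding topspace_def by blast
qed

context
  fixes v :: "'k::field \<Rightarrow> real"
  assumes v: "valuation v"
begin

lemma near_sym: "near v r a b \<Longrightarrow> near v r b a"
  unfolding near_def using valuation_minus[OF v, of "a - b"] by auto

lemma near_trans:
  assumes "near v r a b" "near v r b c" shows "near v r a c"
proof (cases "a = b \<or> b = c")
  case True
  then show ?thesis using assms by auto
next
  case False
  then have ab: "r < v (a - b)" "r < v (b - c)" using assms by (auto simp: near_def)
  have "val_ge v ((a - b) + (b - c)) (min (v (a - b)) (v (b - c)))"
    by (intro val_ge_add[OF v]) (auto simp: val_ge_def)
  then show ?thesis using ab by (auto simp: near_def val_ge_def)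
qed

text \<open>By the ultrametric inequality a ball contains the ball of the same radius around each of
  its points.\<close>

lemma open_mat_ball: "openin (mat_topology v n) (mat_ball v n x r)"
  unfolding openin_mat_topology
proof (intro conjI ballI exI)
  show "mat_ball v n x r \<subseteq> carrier_mat n n" by (auto simp: mat_ball_def)
  fix y assume "y \<in> mat_ball v n x r"
  then show "mat_ball v n y r \<subseteq> mat_ball v n x r"
    unfolding mat_ball_def using near_trans by blast
qed

text \<open>The radius is the valuation of the difference of two distinct entries. As
  \<open>near\<close> is strict, a common point of the two balls would make this valuation greater
  than itself.\<close>

lemma Hausdorff_mat_topology: "Hausdorff_space (mat_topology v n)"
  unfolding Hausdorff_space_def
proof (intro allI impI)
  fix x y assume "x \<in> topspace (mat_topology v n) \<and> y \<in> topspace (mat_topology v n) \<and> x \<noteq> y"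
  then have xy: "x \<in> carrier_mat n n" "y \<in> carrier_mat n n" "x \<noteq> y" by auto
  then obtain i j where ij: "i < n" "j < n" "x $$ (i, j) \<noteq> y $$ (i, j)"
    by (metis carrier_matD(1) carrier_matD(2) eq_matI)
  let ?r = "v (x $$ (i, j) - y $$ (i, j))"
  have "x \<in> mat_ball v n x ?r" "y \<in> mat_ball v n y ?r"
    using xy by (auto simp: mat_ball_def near_def)
  moreover have "disjnt (mat_ball v n x ?r) (mat_ball v n y ?r)"
    unfolding disjnt_iff
  proof (intro allI notI)
    fix z assume "z \<in> mat_ball v n x ?r \<and> z \<in> mat_ball v n y ?r"
    then have "near v ?r (z $$ (i, j)) (x $$ (i, j))" "near v ?r (z $$ (i, j)) (y $$ (i, j))"
      using ij by (auto simp: mat_ball_def)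
    then have "near v ?r (x $$ (i, j)) (y $$ (i, j))" using near_trans near_sym by blast
    then show False using ij by (simp add: near_def)
  qed
  ultimately show "\<exists>U V. openin (mat_topology v n) U \<and> openin (mat_topology v n) V \<and> x \<in> U \<and> y \<in> V \<and> disjnt U V"
    using open_mat_ball by blast
qed

lemma continuous_map_mat_mult:
  assumes g: "g \<in> carrier_mat n n"
  shows "continuous_map (mat_topology v n) (mat_topology v n) (\<lambda>x. g * x)"
  unfolding continuous_map_def topspace_mat_topology
proof (intro conjI allI impI)
  show "(\<lambda>x. g * x) \<in> carrier_mat n n \<rightarrow> carrier_mat n n" using g by auto
  fix U assume U: "openin (mat_topology v n) U"
  \<comment> \<open>A common bound for the loss of valuation caused by multiplication with an entry
    of \<open>g\<close>.\<close>
  define M where "M = (\<Sum>i<n. \<Sum>k<n. \<bar>v (g $$ (i, k))\<bar>)"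
  have M: "- M \<le> v (g $$ (i, k))" if "i < n" "k < n" for i k
  proof -
    have "\<bar>v (g $$ (i, k))\<bar> \<le> (\<Sum>k<n. \<bar>v (g $$ (i, k))\<bar>)"
      using that by (intro member_le_sum) auto
    also have "\<dots> \<le> M" unfolding M_def using that
      by (intro member_le_sum[of i "{..<n}" "\<lambda>i. \<Sum>k<n. \<bar>v (g $$ (i, k))\<bar>"]) (auto intro: sum_nonneg)
    finally show ?thesis by linarith
  qed
  show "openin (mat_topology v n) {x \<in> carrier_mat n n. g * x \<in> U}"
    unfolding openin_mat_topology
  proof (intro conjI ballI)
    show "{x \<in> carrier_mat n n. g * x \<in> U} \<subseteq> carrier_mat n n" by auto
    fix x assume "x \<in> {x \<in> carrier_mat n n. g * x \<in> U}"
    then have x: "x \<in> carrier_mat n n" "g * x \<in> U" by auto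
    obtain r where r: "mat_ball v n (g * x) r \<subseteq> U" using U x(2) unfolding openin_mat_topology by blast
    \<comment> \<open>\<open>M\<close> pays for the entries of \<open>g\<close>; the 1 turns the
      non-strict estimate for the sum into the strict one of \<open>near\<close>.\<close>
    have "mat_ball v n x (r + 1 + M) \<subseteq> {x \<in> carrier_mat n n. g * x \<in> U}"
    proof
      fix y assume y: "y \<in> mat_ball v n x (r + 1 + M)"
      then have yc: "y \<in> carrier_mat n n" by (simp add: mat_ball_def)
      have "near v r ((g * y) $$ (i, j)) ((g * x) $$ (i, j))" if ij: "i < n" "j < n" for i j
      proof -
        have eq: "(g * y) $$ (i, j) - (g * x) $$ (i, j) = (\<Sum>k<n. g $$ (i, k) * (y $$ (k, j) - x $$ (k, j)))"
          using g x yc ij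
          by (simp add: scalar_prod_def right_diff_distrib sum_subtractf lessThan_atLeast0)
        have "val_ge v (\<Sum>k<n. g $$ (i, k) * (y $$ (k, j) - x $$ (k, j))) (r + 1)"
        proof (rule val_ge_sum[OF v])
          fix k assume "k \<in> {..<n}"
          then have k: "k < n" by simp
          have "near v (r + 1 + M) (y $$ (k, j)) (x $$ (k, j))" using y ij k by (simp add: mat_ball_def)
          then have "val_ge v (y $$ (k, j) - x $$ (k, j)) (r + 1 + M)" by (auto simp: near_def val_ge_def)
          moreover have "val_ge v (g $$ (i, k)) (- M)" using M[OF ij(1) k] by (simp add: val_ge_def)
          ultimately have "val_ge v (g $$ (i, k) * (y $$ (k, j) - x $$ (k, j))) (- M + (r + 1 + M))"
            by (intro val_ge_mult[OF v])
          then show "val_ge v (g $$ (i, k) * (y $$ (k, j) - x $$ (k, j))) (r + 1)" by simp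
        qed
        then show ?thesis unfolding eq[symmetric] val_ge_def near_def by auto
      qed
      then have "g * y \<in> mat_ball v n (g * x) r" using g yc by (simp add: mat_ball_def)
      then show "y \<in> {x \<in> carrier_mat n n. g * x \<in> U}" using r yc by auto
    qed
    then show "\<exists>r. mat_ball v n x r \<subseteq> {x \<in> carrier_mat n n. g * x \<in> U}" by blast
  qed
qed

end

section \<open>Hecke rings of compact open subgroups\<close>

lemma (in group) mem_l_coset_iff:
  assumes "A \<subseteq> carrier G" "x \<in> carrier G" "y \<in> carrier G" shows "y \<in> x <# A \<longleftrightarrow> inv x \<otimes> y \<in> A"
proof
  assume *: "inv x \<otimes> y \<in> A"
  have "y = x \<otimes> (inv x \<otimes> y)" using assms by (simp add: m_assoc[symmetric])
  then show "y \<in> x <# A" using * unfolding l_coset_def by blast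
qed (use assms in \<open>auto simp: l_coset_def m_assoc[symmetric]\<close>)

lemma (in group) mem_r_coset_iff:
  assumes "A \<subseteq> carrier G" "x \<in> carrier G" "y \<in> carrier G" shows "y \<in> A #> x \<longleftrightarrow> y \<otimes> inv x \<in> A"
proof
  assume *: "y \<otimes> inv x \<in> A"
  have "y = (y \<otimes> inv x) \<otimes> x" using assms by (simp add: m_assoc)
  then show "y \<in> A #> x" using * unfolding r_coset_def by blast
qed (use assms in \<open>auto simp: r_coset_def m_assoc\<close>)

lemma (in group) subgroup_mult_mem_iff:
  assumes K: "subgroup K G" and j: "j \<in> K" "j' \<in> K" and x: "x \<in> carrier G"
  shows "j \<otimes> x \<otimes> j' \<in> K \<longleftrightarrow> x \<in> K"
proof
  assume "j \<otimes> x \<otimes> j' \<in> K"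
  then have "inv j \<otimes> (j \<otimes> x \<otimes> j') \<otimes> inv j' \<in> K"
    by (rule subgroup.m_closed[OF K subgroup.m_closed[OF K subgroup.m_inv_closed[OF K j(1)]]
          subgroup.m_inv_closed[OF K j(2)]])
  then show "x \<in> K"
    using subgroup.mem_carrier[OF K j(1)] subgroup.mem_carrier[OF K j(2)] x
    by (simp add: m_assoc) (simp add: m_assoc[symmetric])
qed (intro subgroup.m_closed[OF K] j)

text \<open>Volume 1 serves as normalization and also as evidence that \<open>J\<close> is
  measurable. A compact set around \<open>J\<close> puts the unit \<open>indicator J\<close> among
  the compactly supported functions.\<close>

locale hecke_pair = group G for G :: "'a monoid" (structure) +
  fixes \<T> \<mu> J
  assumes topspace: "topspace \<T> = carrier G"
    and hausdorff: "Hausdorff_space \<T>"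
    and continuous_translation: "g \<in> carrier G \<Longrightarrow> continuous_map \<T> \<T> (\<lambda>x. g \<otimes> x)"
    and haar: "haar_measure G \<T> \<mu>"
    and J: "subgroup J G"
    and vol: "emeasure \<mu> J = 1"
    and J_bounded: "\<exists>C. compactin \<T> C \<and> J \<subseteq> C"
begin

definition lcoset :: "'a \<Rightarrow> 'a set" where
  "lcoset a = {x \<in> carrier G. inv a \<otimes> x \<in> J}"

lemma lcoset_eq: assumes a: "a \<in> carrier G" shows "lcoset a = a <# J"
  using l_coset_subset_G[OF subgroup.subset[OF J] a] mem_l_coset_iff[OF subgroup.subset[OF J] a]
  unfolding lcoset_def by blast

lemma lcoset_self: "a \<in> carrier G \<Longrightarrow> a \<in> lcoset a"
  by (simp add: lcoset_def subgroup.one_closed[OF J])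

lemma lcoset_eqI: "a \<in> carrier G \<Longrightarrow> b \<in> lcoset a \<Longrightarrow> lcoset b = lcoset a"
  using l_repr_independence[OF _ _ J, of b a] lcoset_eq by (auto simp: lcoset_def)

lemma lcoset_disjoint:
  assumes "a \<in> carrier G" "b \<in> carrier G" "x \<in> lcoset a" "x \<in> lcoset b" shows "lcoset a = lcoset b"
  using lcoset_eqI[OF assms(1,3)] lcoset_eqI[OF assms(2,4)] by simp

lemma lcoset_mult:
  assumes "a \<in> carrier G" "b \<in> carrier G" "x \<in> carrier G"
  shows "x \<in> lcoset (a \<otimes> b) \<longleftrightarrow> inv a \<otimes> x \<in> lcoset b"
  using assms by (simp add: lcoset_def inv_mult_group m_assoc)

lemma space_eq: "space \<mu> = carrier G"
  using haar by (simp add: haar_measure_def)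

lemma emeasure_lcoset:
  assumes "a \<in> carrier G" shows "lcoset a \<in> sets \<mu>" "emeasure \<mu> (lcoset a) = 1"
proof -
  \<comment> \<open>Sets outside the sigma-algebra have measure 0 by convention, so a set of measure
    1 is measurable.\<close>
  have "J \<in> sets \<mu>" using vol emeasure_notin_sets by fastforce
  then show *: "emeasure \<mu> (lcoset a) = 1"
    using haar assms vol unfolding lcoset_eq[OF assms] haar_measure_def by simp
  show "lcoset a \<in> sets \<mu>" using * emeasure_notin_sets by fastforce
qed

lemma compact_in_sets:
  assumes "compactin \<T> C" shows "C \<in> sets \<mu>" "emeasure \<mu> C < \<infinity>"
proof -
  have sets: "sets \<mu> = sigma_sets (carrier G) {U. openin \<T> U}" using haar by (simp add: haar_measure_def)
  have "closedin \<T> C" by (rule compactin_imp_closedin[OF hausdorff assms])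
  then have "C \<subseteq> carrier G" "openin \<T> (carrier G - C)" unfolding closedin_def topspace by auto
  then have "carrier G - (carrier G - C) \<in> sets \<mu>"
    unfolding sets by (intro sigma_sets.Compl sigma_sets.Basic) simp
  then show "C \<in> sets \<mu>" using \<open>C \<subseteq> carrier G\<close> by (simp add: double_diff)
  show "emeasure \<mu> C < \<infinity>" using haar assms by (simp add: haar_measure_def)
qed

text \<open>Disjoint cosets have volume 1, so only finitely many of them fit into a compact set.\<close>

lemma finite_cosets:
  assumes "compactin \<T> C" "S \<subseteq> carrier G" "\<And>s. s \<in> S \<Longrightarrow> lcoset s \<subseteq> C"
  shows "finite (lcoset ` S)"
proof (rule ccontr)
  assume inf: "infinite (lcoset ` S)"
  obtain m :: nat where m: "emeasure \<mu> C < of_nat m"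
    using compact_in_sets(2)[OF assms(1)] ennreal_Ex_less_of_nat[of "emeasure \<mu> C"] by auto
  obtain \<D> where D: "\<D> \<subseteq> lcoset ` S" "finite \<D>" "card \<D> = m"
    using infinite_arbitrarily_large[OF inf] by metis
  have D1: "D \<in> sets \<mu>" "emeasure \<mu> D = 1" "D \<subseteq> C" if "D \<in> \<D>" for D
    using that D(1) assms(2,3) emeasure_lcoset by (auto simp: subset_iff image_iff)
  have "disjoint_family_on (\<lambda>D. D) \<D>"
    unfolding disjoint_family_on_def
  proof (intro ballI impI)
    fix D E assume DE: "D \<in> \<D>" "E \<in> \<D>" "D \<noteq> E"
    then obtain s t where st: "s \<in> S" "t \<in> S" "D = lcoset s" "E = lcoset t" using D(1) by blast
    then show "D \<inter> E = {}" using lcoset_disjoint[of s t] assms(2) DE(3) by blast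
  qed
  then have "(\<Sum>D\<in>\<D>. emeasure \<mu> D) = emeasure \<mu> (\<Union>D\<in>\<D>. D)"
    by (intro sum_emeasure) (use D1 D(2) in auto)
  also have "\<dots> \<le> emeasure \<mu> C"
    using D1(3) compact_in_sets(1)[OF assms(1)] by (intro emeasure_mono) auto
  finally have "of_nat m \<le> emeasure \<mu> C" using D1 D(3) by simp
  then show False using m by simp
qed

text \<open>Equality is demanded only on the group, where the measure lives. Cosets may be repeated,
  so that a convolution can be expanded over pairs of indices.\<close>

definition coset_sum :: "('a \<Rightarrow> real) \<Rightarrow> 'i set \<Rightarrow> ('i \<Rightarrow> real) \<Rightarrow> ('i \<Rightarrow> 'a) \<Rightarrow> bool" where
  "coset_sum f I c b \<longleftrightarrow> finite I \<and> (\<forall>i\<in>I. b i \<in> carrier G) \<and>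
     (\<forall>x\<in>carrier G. f x = (\<Sum>i\<in>I. c i * indicator (lcoset (b i)) x))"

lemma coset_sum_integral:
  assumes "coset_sum f I c b"
  shows "integrable \<mu> f" "(LINT y|\<mu>. f y) = (\<Sum>i\<in>I. c i)"
proof -
  have I: "finite I" "\<And>i. i \<in> I \<Longrightarrow> b i \<in> carrier G"
    "\<And>x. x \<in> space \<mu> \<Longrightarrow> f x = (\<Sum>i\<in>I. c i * indicator (lcoset (b i)) x)"
    using assms by (auto simp: coset_sum_def space_eq)
  have ind: "has_bochner_integral \<mu> (\<lambda>x. c i * indicator (lcoset (b i)) x) (c i)" if "i \<in> I" for i
  proof -
    have "has_bochner_integral \<mu> (indicator (lcoset (b i))) (measure \<mu> (lcoset (b i)))"
      using emeasure_lcoset[OF I(2)[OF that]] by (intro has_bochner_integral_real_indicator) auto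
    moreover have "measure \<mu> (lcoset (b i)) = 1"
      using emeasure_lcoset[OF I(2)[OF that]] by (simp add: measure_def)
    ultimately show ?thesis by (metis has_bochner_integral_mult_right mult.right_neutral)
  qed
  have "has_bochner_integral \<mu> (\<lambda>x. \<Sum>i\<in>I. c i * indicator (lcoset (b i)) x) (\<Sum>i\<in>I. c i)"
    by (intro has_bochner_integral_sum ind)
  moreover have "has_bochner_integral \<mu> f (\<Sum>i\<in>I. c i) \<longleftrightarrow>
      has_bochner_integral \<mu> (\<lambda>x. \<Sum>i\<in>I. c i * indicator (lcoset (b i)) x) (\<Sum>i\<in>I. c i)"
    by (rule has_bochner_integral_cong) (simp_all only: I(3))
  ultimately have "has_bochner_integral \<mu> f (\<Sum>i\<in>I. c i)" by blast
  then show "integrable \<mu> f" "(LINT y|\<mu>. f y) = (\<Sum>i\<in>I. c i)"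
    by (auto simp: has_bochner_integral_iff)
qed

definition left_inv :: "('a \<Rightarrow> real) \<Rightarrow> bool" where
  "left_inv h \<longleftrightarrow> (\<forall>j\<in>J. \<forall>x\<in>carrier G. h (j \<otimes> x) = h x)"

text \<open>With \<open>y\<close> equal to \<open>b\<close> times an element of \<open>J\<close>,
  left invariance of \<open>h\<close> absorbs the inverse of that element. This makes the second
  factor of a convolution integrand constant on left cosets.\<close>

lemma left_inv_lcoset:
  assumes h: "left_inv h" and b: "b \<in> carrier G" and y: "y \<in> lcoset b" and x: "x \<in> carrier G"
  shows "h (inv y \<otimes> x) = h (inv b \<otimes> x)"
proof -
  have yc: "y \<in> carrier G" and j: "inv b \<otimes> y \<in> J" using y by (auto simp: lcoset_def)
  have "inv b \<otimes> x = (inv b \<otimes> y) \<otimes> (inv y \<otimes> x)"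
    using b yc x by (metis inv_closed m_assoc m_closed r_inv l_one)
  then show ?thesis using h j yc x unfolding left_inv_def by simp
qed

lemma coset_sum_integrand:
  assumes f: "coset_sum f I c b" and h: "left_inv h" and x: "x \<in> carrier G"
  shows "coset_sum (\<lambda>y. f y * h (inv y \<otimes> x)) I (\<lambda>i. c i * h (inv (b i) \<otimes> x)) b"
proof -
  have "c i * indicator (lcoset (b i)) y * h (inv y \<otimes> x) = c i * h (inv (b i) \<otimes> x) * indicator (lcoset (b i)) y"
    if "i \<in> I" for i y
    using left_inv_lcoset[OF h _ _ x, of "b i" y] f that unfolding coset_sum_def
    by (cases "y \<in> lcoset (b i)") auto
  note eq = this
  show ?thesis unfolding coset_sum_def
  proof (intro conjI ballI)
    fix y assume "y \<in> carrier G"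
    then have "f y = (\<Sum>i\<in>I. c i * indicator (lcoset (b i)) y)" using f unfolding coset_sum_def by blast
    then show "f y * h (inv y \<otimes> x) = (\<Sum>i\<in>I. c i * h (inv (b i) \<otimes> x) * indicator (lcoset (b i)) y)"
      by (simp only: sum_distrib_right eq cong: sum.cong)
  qed (use f in \<open>auto simp: coset_sum_def\<close>)
qed

text \<open>The integrand is constant on each coset of volume 1, so the integral is the sum of its
  values at the representatives.\<close>

lemma convolution_expansion:
  assumes f: "coset_sum f I c b" and h: "left_inv h" and x: "x \<in> carrier G"
  shows "convolution G \<mu> f h x = (\<Sum>i\<in>I. c i * h (inv (b i) \<otimes> x))"
  unfolding convolution_def using x coset_sum_integral(2)[OF coset_sum_integrand[OF assms]] by simp

lemma coset_sum_convolution: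
  assumes f: "coset_sum f I c b" and g: "coset_sum g K d e" "left_inv g"
  shows "coset_sum (convolution G \<mu> f g) (I \<times> K) (\<lambda>(i, k). c i * d k) (\<lambda>(i, k). b i \<otimes> e k)"
  unfolding coset_sum_def
proof (intro conjI ballI)
  show "finite (I \<times> K)" using f g by (simp add: coset_sum_def)
  show "(case p of (i, k) \<Rightarrow> b i \<otimes> e k) \<in> carrier G" if "p \<in> I \<times> K" for p
    using that f g by (auto simp: coset_sum_def)
  fix x assume x: "x \<in> carrier G"
  have "convolution G \<mu> f g x = (\<Sum>i\<in>I. c i * g (inv (b i) \<otimes> x))"
    by (rule convolution_expansion[OF f g(2) x])
  also have "\<dots> = (\<Sum>i\<in>I. \<Sum>k\<in>K. c i * d k * indicator (lcoset (b i \<otimes> e k)) x)"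
  proof (rule sum.cong)
    fix i assume i: "i \<in> I"
    then have bi: "b i \<in> carrier G" using f by (simp add: coset_sum_def)
    have ek: "e k \<in> carrier G" if "k \<in> K" for k using g that by (simp add: coset_sum_def)
    have "g (inv (b i) \<otimes> x) = (\<Sum>k\<in>K. d k * indicator (lcoset (e k)) (inv (b i) \<otimes> x))"
      using g(1) bi x by (simp add: coset_sum_def)
    also have "\<dots> = (\<Sum>k\<in>K. d k * indicator (lcoset (b i \<otimes> e k)) x)"
      using lcoset_mult[OF bi ek x] by (intro sum.cong) (auto simp: indicator_def)
    finally show "c i * g (inv (b i) \<otimes> x) = (\<Sum>k\<in>K. c i * d k * indicator (lcoset (b i \<otimes> e k)) x)"
      by (simp add: sum_distrib_left mult.assoc)
  qed simp
  also have "\<dots> = (\<Sum>p\<in>I \<times> K. (case p of (i, k) \<Rightarrow> c i * d k) * indicator (lcoset (case p of (i, k) \<Rightarrow> b i \<otimes> e k)) x)"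
    by (simp add: sum.cartesian_product split_def)
  finally show "convolution G \<mu> f g x = \<dots>" .
qed

definition hecke_fun :: "'a set \<Rightarrow> ('a \<Rightarrow> real) set" where
  "hecke_fun Y = {f. range f \<subseteq> \<int> \<and> (\<forall>x. x \<notin> Y \<longrightarrow> f x = 0) \<and>
     (\<exists>C. compactin \<T> C \<and> (\<forall>x. x \<notin> C \<longrightarrow> f x = 0)) \<and>
     (\<forall>j\<in>J. \<forall>j'\<in>J. \<forall>x\<in>carrier G. f (j \<otimes> x \<otimes> j') = f x)}"

lemma
  assumes f: "f \<in> hecke_fun Y"
  shows hecke_fun_Ints: "f x \<in> \<int>"
    and hecke_fun_support: "x \<notin> Y \<Longrightarrow> f x = 0"
    and hecke_fun_compact: "\<exists>C. compactin \<T> C \<and> (\<forall>x. x \<notin> C \<longrightarrow> f x = 0)"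
    and hecke_fun_biinv: "j \<in> J \<Longrightarrow> j' \<in> J \<Longrightarrow> x \<in> carrier G \<Longrightarrow> f (j \<otimes> x \<otimes> j') = f x"
    and hecke_fun_left: "j \<in> J \<Longrightarrow> x \<in> carrier G \<Longrightarrow> f (j \<otimes> x) = f x"
    and hecke_fun_right: "j \<in> J \<Longrightarrow> x \<in> carrier G \<Longrightarrow> f (x \<otimes> j) = f x"
proof -
  show "f x \<in> \<int>" "x \<notin> Y \<Longrightarrow> f x = 0" "\<exists>C. compactin \<T> C \<and> (\<forall>x. x \<notin> C \<longrightarrow> f x = 0)"
    using f by (auto simp: hecke_fun_def)
  show *: "\<And>j j' x. j \<in> J \<Longrightarrow> j' \<in> J \<Longrightarrow> x \<in> carrier G \<Longrightarrow> f (j \<otimes> x \<otimes> j') = f x"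
    using f by (auto simp: hecke_fun_def)
  show "j \<in> J \<Longrightarrow> x \<in> carrier G \<Longrightarrow> f (j \<otimes> x) = f x"
    using *[OF _ subgroup.one_closed[OF J]] subgroup.mem_carrier[OF J] by fastforce
  show "j \<in> J \<Longrightarrow> x \<in> carrier G \<Longrightarrow> f (x \<otimes> j) = f x"
    using *[OF subgroup.one_closed[OF J]] subgroup.mem_carrier[OF J] by fastforce
qed

lemma hecke_fun_left_inv: "f \<in> hecke_fun Y \<Longrightarrow> left_inv f"
  by (simp add: left_inv_def hecke_fun_left)

text \<open>Right invariance makes \<open>f\<close> constant on left cosets, and those in its
  support lie inside a compact set, so they are finite in number; \<open>A\<close> holds one
  representative of each. That \<open>A\<close> lies in the support is what controls the support of
  convolutions.\<close>

lemma hecke_fun_expansion: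
  assumes f: "f \<in> hecke_fun Y" shows "\<exists>A. A \<subseteq> {x. f x \<noteq> 0} \<and> coset_sum f A f (\<lambda>a. a)"
proof -
  obtain C where C: "compactin \<T> C" "\<And>x. x \<notin> C \<Longrightarrow> f x = 0" using hecke_fun_compact[OF f] by blast
  have CG: "C \<subseteq> carrier G" using compactin_subset_topspace[OF C(1)] topspace by simp
  define S where "S = {x. f x \<noteq> 0}"
  have SC: "S \<subseteq> C" using C(2) by (auto simp: S_def)
  have const: "f x = f s" if "s \<in> carrier G" "x \<in> lcoset s" for s x
  proof -
    have "x = s \<otimes> (inv s \<otimes> x)" using that by (auto simp: lcoset_def m_assoc[symmetric])
    then show ?thesis using hecke_fun_right[OF f, of "inv s \<otimes> x" s] that by (auto simp: lcoset_def)
  qed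
  have "lcoset s \<subseteq> C" if "s \<in> S" for s
    using const[of s] that SC CG C(2) by (fastforce simp: S_def)
  then have fin: "finite (lcoset ` S)" using finite_cosets[OF C(1)] SC CG by blast
  obtain A where A: "A \<subseteq> S" "lcoset ` S = lcoset ` A" "inj_on lcoset A"
    using subset_image_inj[of "lcoset ` S" lcoset S] by auto
  have finA: "finite A" using fin A by (simp add: finite_image_iff)
  have AG: "A \<subseteq> carrier G" using A(1) SC CG by blast
  have "f x = (\<Sum>a\<in>A. f a * indicator (lcoset a) x)" if x: "x \<in> carrier G" for x
  proof (cases "x \<in> S")
    case True
    then obtain a where a: "a \<in> A" "lcoset x = lcoset a" using A(2) by (metis imageE imageI)
    have xa: "x \<in> lcoset a" using lcoset_self[OF x] a by simp
    have "indicator (lcoset b) x = (if b = a then 1 else 0 :: real)" if "b \<in> A" for b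
      using lcoset_disjoint[of a b x] xa A(3) a(1) that AG by (auto simp: indicator_def inj_on_def)
    then have "(\<Sum>b\<in>A. f b * indicator (lcoset b) x) = (\<Sum>b\<in>A. if b = a then f b else 0)"
      by (intro sum.cong) auto
    also have "\<dots> = f a" using finA a(1) by simp
    finally show ?thesis using const[of a x] xa a(1) AG by auto
  next
    case False
    then have "indicator (lcoset a) x = (0::real)" if "a \<in> A" for a
      using const[of a x] that A(1) AG by (auto simp: indicator_def S_def)
    then show ?thesis using False by (simp add: S_def)
  qed
  then have "coset_sum f A f (\<lambda>a. a)" using finA AG by (auto simp: coset_sum_def)
  then show ?thesis using A(1) unfolding S_def by blast
qed

lemma indicator_J_in_hecke_fun:
  assumes "J \<subseteq> Y" shows "indicator J \<in> hecke_fun Y"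
  unfolding hecke_fun_def
proof (intro CollectI conjI ballI)
  show "range (indicator J :: 'a \<Rightarrow> real) \<subseteq> \<int>" by (auto simp: indicator_def)
  show "\<forall>x. x \<notin> Y \<longrightarrow> indicator J x = (0::real)" using assms by (auto simp: indicator_def)
  show "\<exists>C. compactin \<T> C \<and> (\<forall>x. x \<notin> C \<longrightarrow> indicator J x = (0::real))"
    using J_bounded by (auto simp: indicator_def)
  fix j j' x assume j: "j \<in> J" "j' \<in> J" and x: "x \<in> carrier G"
  then show "indicator J (j \<otimes> x \<otimes> j') = (indicator J x :: real)"
    by (simp add: indicator_def subgroup_mult_mem_iff[OF J])
qed

lemma convolution_in_hecke_fun:
  assumes Y: "subgroup Y G" and f: "f \<in> hecke_fun Y" and g: "g \<in> hecke_fun Y"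
  shows "convolution G \<mu> f g \<in> hecke_fun Y"
proof -
  obtain A where A: "A \<subseteq> {x. f x \<noteq> 0}" "coset_sum f A f (\<lambda>a. a)" using hecke_fun_expansion[OF f] by blast
  obtain C where C: "compactin \<T> C" "\<And>x. x \<notin> C \<Longrightarrow> g x = 0" using hecke_fun_compact[OF g] by blast
  have AY: "A \<subseteq> Y" using A(1) hecke_fun_support[OF f] by blast
  have AG: "A \<subseteq> carrier G" and finA: "finite A" using A(2) by (auto simp: coset_sum_def)
  have gl: "left_inv g" by (rule hecke_fun_left_inv[OF g])
  let ?c = "convolution G \<mu> f g"
  have eq: "?c x = (\<Sum>a\<in>A. f a * g (inv a \<otimes> x))" if "x \<in> carrier G" for x
    by (rule convolution_expansion[OF A(2) gl that])
  have out: "?c x = 0" if "x \<notin> carrier G" for x using that by (simp add: convolution_def)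
  show ?thesis unfolding hecke_fun_def
  proof (intro CollectI conjI ballI allI impI)
    have "?c x \<in> \<int>" for x
      by (cases "x \<in> carrier G")
        (auto simp: eq out intro!: Ints_sum Ints_mult hecke_fun_Ints[OF f] hecke_fun_Ints[OF g])
    then show "range ?c \<subseteq> \<int>" by blast
  next
    fix x assume x: "x \<notin> Y"
    show "?c x = 0"
    proof (cases "x \<in> carrier G")
      case True
      have "g (inv a \<otimes> x) = 0" if "a \<in> A" for a
      proof (rule hecke_fun_support[OF g], rule)
        assume "inv a \<otimes> x \<in> Y"
        then have "a \<otimes> (inv a \<otimes> x) \<in> Y" using that AY by (intro subgroup.m_closed[OF Y, of a "inv a \<otimes> x"]) auto
        then show False using x True that AG by (auto simp: m_assoc[symmetric])
      qed
      then show ?thesis by (simp add: eq[OF True])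
    qed (rule out)
  next
    \<comment> \<open>By the expansion, the convolution vanishes outside the finitely many
      translates of the compact set \<open>C\<close> by the representatives of
      \<open>f\<close>.\<close>
    let ?D = "\<Union>a\<in>A. (\<lambda>x. a \<otimes> x) ` C"
    have "compactin \<T> ?D"
      using finA AG by (intro compactin_Union) (auto intro!: image_compactin[OF C(1)] continuous_translation)
    moreover have "?c x = 0" if x: "x \<notin> ?D" for x
    proof (cases "x \<in> carrier G")
      case True
      have "g (inv a \<otimes> x) = 0" if a: "a \<in> A" for a
      proof (rule C(2), rule)
        assume "inv a \<otimes> x \<in> C"
        then have "a \<otimes> (inv a \<otimes> x) \<in> ?D" using a by blast
        moreover have "a \<otimes> (inv a \<otimes> x) = x" using True a AG by (auto simp: m_assoc[symmetric])
        ultimately show False using x by simp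
      qed
      then show ?thesis by (simp add: eq[OF True])
    qed (rule out)
    ultimately show "\<exists>D. compactin \<T> D \<and> (\<forall>x. x \<notin> D \<longrightarrow> ?c x = 0)" by blast
  next
    fix j j' x assume j: "j \<in> J" "j' \<in> J" and x: "x \<in> carrier G"
    have jc: "j \<in> carrier G" "j' \<in> carrier G" using j subgroup.mem_carrier[OF J] by auto
    \<comment> \<open>Left invariance of \<open>f\<close> allows its representatives to be
      translated by \<open>inv j\<close>. This moves \<open>j\<close> into the argument of
      \<open>g\<close>.\<close>
    have "coset_sum f A f (\<lambda>a. inv j \<otimes> a)"
      unfolding coset_sum_def
    proof (intro conjI ballI)
      show "finite A" by (rule finA)
      show "inv j \<otimes> a \<in> carrier G" if "a \<in> A" for a using that AG jc by auto
      fix y assume y: "y \<in> carrier G"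
      have "f y = f (j \<otimes> y)" using hecke_fun_left[OF f j(1) y] by simp
      also have "\<dots> = (\<Sum>a\<in>A. f a * indicator (lcoset a) (j \<otimes> y))" using A(2) jc y by (simp add: coset_sum_def)
      also have "\<dots> = (\<Sum>a\<in>A. f a * indicator (lcoset (inv j \<otimes> a)) y)"
        using lcoset_mult[of "inv j" _ y] jc y AG by (intro sum.cong) (auto simp: indicator_def)
      finally show "f y = (\<Sum>a\<in>A. f a * indicator (lcoset (inv j \<otimes> a)) y)" .
    qed
    from convolution_expansion[OF this gl x] have "?c x = (\<Sum>a\<in>A. f a * g (inv (inv j \<otimes> a) \<otimes> x))" .
    also have "\<dots> = (\<Sum>a\<in>A. f a * g (inv a \<otimes> (j \<otimes> x \<otimes> j')))"
    proof (rule sum.cong)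
      fix a assume "a \<in> A"
      then have a: "a \<in> carrier G" using AG by blast
      have "g (inv (inv j \<otimes> a) \<otimes> x) = g ((inv a \<otimes> (j \<otimes> x)) \<otimes> j')"
        using a jc x by (subst hecke_fun_right[OF g j(2)]) (auto simp: inv_mult_group m_assoc)
      then show "f a * g (inv (inv j \<otimes> a) \<otimes> x) = f a * g (inv a \<otimes> (j \<otimes> x \<otimes> j'))"
        using a jc x by (simp add: m_assoc)
    qed simp
    also have "\<dots> = ?c (j \<otimes> x \<otimes> j')" using jc x by (subst eq) auto
    finally show "?c (j \<otimes> x \<otimes> j') = ?c x" by simp
  qed
qed

text \<open>Expanding over representatives \<open>a\<close> of \<open>f\<close> and \<open>b\<close>
  of \<open>g\<close>, both sides become the double sum of
  \<open>f a * g b * h (inv (a \<otimes> b) \<otimes> x)\<close>.\<close>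

lemma convolution_assoc:
  assumes f: "f \<in> hecke_fun Y" and g: "g \<in> hecke_fun Y" and h: "h \<in> hecke_fun Y"
    and gh: "convolution G \<mu> g h \<in> hecke_fun Y"
  shows "convolution G \<mu> (convolution G \<mu> f g) h = convolution G \<mu> f (convolution G \<mu> g h)"
proof
  fix x
  show "convolution G \<mu> (convolution G \<mu> f g) h x = convolution G \<mu> f (convolution G \<mu> g h) x"
  proof (cases "x \<in> carrier G")
    case x: True
    obtain A where A: "coset_sum f A f (\<lambda>a. a)" using hecke_fun_expansion[OF f] by blast
    obtain B where B: "coset_sum g B g (\<lambda>a. a)" using hecke_fun_expansion[OF g] by blast
    have AB: "A \<subseteq> carrier G" "B \<subseteq> carrier G" using A B by (auto simp: coset_sum_def)
    note inv = hecke_fun_left_inv[OF g] hecke_fun_left_inv[OF h] hecke_fun_left_inv[OF gh]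
    have "convolution G \<mu> (convolution G \<mu> f g) h x =
        (\<Sum>p\<in>A \<times> B. (case p of (a, b) \<Rightarrow> f a * g b) * h (inv (case p of (a, b) \<Rightarrow> a \<otimes> b) \<otimes> x))"
      by (rule convolution_expansion[OF coset_sum_convolution[OF A B inv(1)] inv(2) x])
    also have "\<dots> = (\<Sum>a\<in>A. \<Sum>b\<in>B. f a * g b * h (inv (a \<otimes> b) \<otimes> x))"
      by (simp add: sum.cartesian_product split_def)
    also have "\<dots> = (\<Sum>a\<in>A. f a * convolution G \<mu> g h (inv a \<otimes> x))"
    proof (rule sum.cong)
      fix a assume "a \<in> A"
      then have a: "a \<in> carrier G" using AB by blast
      have "convolution G \<mu> g h (inv a \<otimes> x) = (\<Sum>b\<in>B. g b * h (inv b \<otimes> (inv a \<otimes> x)))"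
        using a x by (intro convolution_expansion[OF B inv(2)]) auto
      also have "\<dots> = (\<Sum>b\<in>B. g b * h (inv (a \<otimes> b) \<otimes> x))"
        using a x AB by (intro sum.cong) (auto simp: inv_mult_group m_assoc subset_iff)
      finally show "(\<Sum>b\<in>B. f a * g b * h (inv (a \<otimes> b) \<otimes> x)) = f a * convolution G \<mu> g h (inv a \<otimes> x)"
        by (simp add: sum_distrib_left mult.assoc)
    qed simp
    also have "\<dots> = convolution G \<mu> f (convolution G \<mu> g h) x"
      by (rule convolution_expansion[OF A inv(3) x, symmetric])
    finally show ?thesis .
  qed (simp add: convolution_def)
qed

section \<open>Ring axioms for convolution\<close>

lemma hecke_ring_carrier [simp]: "carrier (hecke_ring G \<T> \<mu> J Y) = hecke_fun Y"
  by (simp add: hecke_ring_def hecke_fun_def)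

lemma hecke_fun_add:
  assumes f: "f \<in> hecke_fun Y" and g: "g \<in> hecke_fun Y" shows "(\<lambda>x. f x + g x) \<in> hecke_fun Y"
proof -
  obtain C D where CD: "compactin \<T> C" "\<forall>x. x \<notin> C \<longrightarrow> f x = 0" "compactin \<T> D" "\<forall>x. x \<notin> D \<longrightarrow> g x = 0"
    using hecke_fun_compact[OF f] hecke_fun_compact[OF g] by blast
  have "compactin \<T> (C \<union> D)" "\<forall>x. x \<notin> C \<union> D \<longrightarrow> f x + g x = 0" using CD by (auto intro: compactin_Un)
  then have "\<exists>C. compactin \<T> C \<and> (\<forall>x. x \<notin> C \<longrightarrow> f x + g x = 0)" by blast
  moreover have "range (\<lambda>x. f x + g x) \<subseteq> \<int>"
    using hecke_fun_Ints[OF f] hecke_fun_Ints[OF g] by (auto intro: Ints_add)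
  ultimately show ?thesis
    using hecke_fun_support[OF f] hecke_fun_support[OF g] hecke_fun_biinv[OF f] hecke_fun_biinv[OF g]
    unfolding hecke_fun_def by simp
qed

lemma hecke_fun_int_multiple:
  assumes f: "f \<in> hecke_fun Y" shows "(\<lambda>x. of_int z * f x) \<in> hecke_fun Y"
proof -
  have "range (\<lambda>x. of_int z * f x) \<subseteq> \<int>" using hecke_fun_Ints[OF f] by (auto intro: Ints_mult)
  moreover have "\<exists>C. compactin \<T> C \<and> (\<forall>x. x \<notin> C \<longrightarrow> of_int z * f x = 0)"
    using hecke_fun_compact[OF f] by auto
  ultimately show ?thesis
    using hecke_fun_support[OF f] hecke_fun_biinv[OF f] unfolding hecke_fun_def by simp
qed

lemma hecke_fun_zero: "(\<lambda>_. 0) \<in> hecke_fun Y"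
  by (auto simp: hecke_fun_def intro: exI[of _ "{}"])

lemma hecke_fun_mono: "Y \<subseteq> Z \<Longrightarrow> hecke_fun Y \<subseteq> hecke_fun Z"
  unfolding hecke_fun_def by blast

lemma hecke_fun_add_group: "abelian_group (hecke_ring G \<T> \<mu> J Y)"
proof (rule abelian_groupI)
  let ?R = "hecke_ring G \<T> \<mu> J Y"
  show "\<exists>g\<in>carrier ?R. g \<oplus>\<^bsub>?R\<^esub> f = \<zero>\<^bsub>?R\<^esub>" if "f \<in> carrier ?R" for f
    using that hecke_fun_int_multiple[of f Y "- 1"]
    by (intro bexI[of _ "\<lambda>x. - f x"]) (simp_all add: hecke_ring_def hecke_fun_def)
qed (use hecke_fun_add hecke_fun_zero in \<open>auto simp: hecke_ring_def hecke_fun_def[symmetric] add_ac\<close>)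

lemma hecke_ring_is_ring:
  assumes Y: "subgroup Y G" and JY: "J \<subseteq> Y"
  shows "ring (hecke_ring G \<T> \<mu> J Y)"
proof -
  let ?R = "hecke_ring G \<T> \<mu> J Y"
  have mult [simp]: "f \<otimes>\<^bsub>?R\<^esub> g = convolution G \<mu> f g" for f g by (simp add: hecke_ring_def)
  have add [simp]: "f \<oplus>\<^bsub>?R\<^esub> g = (\<lambda>x. f x + g x)" for f g by (simp add: hecke_ring_def)
  have one [simp]: "\<one>\<^bsub>?R\<^esub> = indicator J" by (simp add: hecke_ring_def)
  note conv = convolution_in_hecke_fun[OF Y]
  have out: "f x = 0" if "f \<in> hecke_fun Y" "x \<notin> carrier G" for f x
    using hecke_fun_support[OF that(1)] subgroup.mem_carrier[OF Y] that(2) by blast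
  \<comment> \<open>\<open>J\<close> is the left coset of the unit, so the identity of the ring has
    an expansion with a single term.\<close>
  have expansion_J: "coset_sum (indicator J) {\<one>} (\<lambda>_. 1) (\<lambda>a. a)"
    by (auto simp: coset_sum_def lcoset_def indicator_def)
  have lone: "convolution G \<mu> (indicator J) f = f" if f: "f \<in> hecke_fun Y" for f
  proof
    fix x show "convolution G \<mu> (indicator J) f x = f x"
    proof (cases "x \<in> carrier G")
      case True
      then show ?thesis using convolution_expansion[OF expansion_J hecke_fun_left_inv[OF f] True] by simp
    qed (simp add: convolution_def out[OF f])
  qed
  have rone: "convolution G \<mu> f (indicator J) = f" if f: "f \<in> hecke_fun Y" for f
  proof
    fix x show "convolution G \<mu> f (indicator J) x = f x"
    proof (cases "x \<in> carrier G")
      case True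
      obtain A where A: "coset_sum f A f (\<lambda>a. a)" using hecke_fun_expansion[OF f] by blast
      have "convolution G \<mu> f (indicator J) x = (\<Sum>a\<in>A. f a * indicator J (inv a \<otimes> x))"
        by (rule convolution_expansion[OF A hecke_fun_left_inv[OF indicator_J_in_hecke_fun[OF JY]] True])
      also have "\<dots> = (\<Sum>a\<in>A. f a * indicator (lcoset a) x)" using True by (simp add: lcoset_def indicator_def)
      also have "\<dots> = f x" using A True by (simp add: coset_sum_def)
      finally show ?thesis .
    qed (simp add: convolution_def out[OF f])
  qed
  \<comment> \<open>The two first factors have different expansions, so additivity is taken from the
    integral. In the other distributive law a single expansion of \<open>h\<close> serves all
    terms.\<close>
  have ldist: "convolution G \<mu> (\<lambda>x. f x + g x) h = (\<lambda>x. convolution G \<mu> f h x + convolution G \<mu> g h x)"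
    if f: "f \<in> hecke_fun Y" and g: "g \<in> hecke_fun Y" and h: "h \<in> hecke_fun Y" for f g h
  proof
    fix x
    show "convolution G \<mu> (\<lambda>x. f x + g x) h x = convolution G \<mu> f h x + convolution G \<mu> g h x"
    proof (cases "x \<in> carrier G")
      case True
      obtain A where A: "coset_sum f A f (\<lambda>a. a)" using hecke_fun_expansion[OF f] by blast
      obtain B where B: "coset_sum g B g (\<lambda>a. a)" using hecke_fun_expansion[OF g] by blast
      note int = coset_sum_integral(1)[OF coset_sum_integrand[OF A hecke_fun_left_inv[OF h] True]]
        coset_sum_integral(1)[OF coset_sum_integrand[OF B hecke_fun_left_inv[OF h] True]]
      show ?thesis unfolding convolution_def using True
        by (simp add: distrib_right Bochner_Integration.integral_add[OF int])
    qed (simp add: convolution_def)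
  qed
  have rdist: "convolution G \<mu> h (\<lambda>x. f x + g x) = (\<lambda>x. convolution G \<mu> h f x + convolution G \<mu> h g x)"
    if f: "f \<in> hecke_fun Y" and g: "g \<in> hecke_fun Y" and h: "h \<in> hecke_fun Y" for f g h
  proof
    fix x
    show "convolution G \<mu> h (\<lambda>x. f x + g x) x = convolution G \<mu> h f x + convolution G \<mu> h g x"
    proof (cases "x \<in> carrier G")
      case True
      obtain A where A: "coset_sum h A h (\<lambda>a. a)" using hecke_fun_expansion[OF h] by blast
      note inv = hecke_fun_left_inv[OF f] hecke_fun_left_inv[OF g] hecke_fun_left_inv[OF hecke_fun_add[OF f g]]
      show ?thesis
        unfolding inv[THEN convolution_expansion[OF A _ True]]
        by (simp add: distrib_left sum.distrib)
    qed (simp add: convolution_def)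
  qed
  have "monoid ?R"
    by (rule monoidI) (auto simp: conv indicator_J_in_hecke_fun[OF JY] lone rone intro!: convolution_assoc)
  then show ?thesis
    by (intro ringI hecke_fun_add_group) (auto simp: ldist rdist)
qed

end

section \<open>Tensor products with free abelian groups\<close>

lemma free_Abelian_hom_unique:
  assumes "group G" "h \<in> hom (free_Abelian_group S) G" "k \<in> hom (free_Abelian_group S) G"
    and eq: "\<And>s. s \<in> S \<Longrightarrow> h (frag_of s) = k (frag_of s)" and x: "x \<in> carrier (free_Abelian_group S)"
  shows "h x = k x"
proof -
  interpret h: group_hom "free_Abelian_group S" G h
    using assms by (simp add: group_hom_def group_hom_axioms_def)
  interpret k: group_hom "free_Abelian_group S" G k
    using assms by (simp add: group_hom_def group_hom_axioms_def)
  \<comment> \<open>The induction principle builds elements by differences, whereas homomorphisms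
    are known to respect products and inverses.\<close>
  have diff: "f (a - b) = f a \<otimes>\<^bsub>G\<^esub> inv\<^bsub>G\<^esub> (f b)"
    if "group_hom (free_Abelian_group S) G f" "Poly_Mapping.keys a \<subseteq> S" "Poly_Mapping.keys b \<subseteq> S" for f a b
  proof -
    interpret f: group_hom "free_Abelian_group S" G f by (rule that(1))
    have "f (a \<otimes>\<^bsub>free_Abelian_group S\<^esub> inv\<^bsub>free_Abelian_group S\<^esub> b) = f a \<otimes>\<^bsub>G\<^esub> inv\<^bsub>G\<^esub> (f b)"
    proof -
      have "a \<in> carrier (free_Abelian_group S)" "b \<in> carrier (free_Abelian_group S)" using that by simp_all
      then show ?thesis by (simp only: f.hom_mult f.hom_inv group.inv_closed[OF group_free_Abelian_group])
    qed
    then show ?thesis using that by simp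
  qed
  have keys: "Poly_Mapping.keys x \<subseteq> S" using x by simp
  show ?thesis
  proof (rule free_Abelian_group_induct[OF keys, of "\<lambda>x. h x = k x"])
    show "h 0 = k 0" using h.hom_one k.hom_one by simp
    show "h (a - b) = k (a - b)"
      if "Poly_Mapping.keys a \<subseteq> S" "Poly_Mapping.keys b \<subseteq> S" "h a = k a" "h b = k b" for a b
      using that by (simp add: diff[OF h.group_hom_axioms] diff[OF k.group_hom_axioms])
  qed (rule eq)
qed

locale group_tensor =
  A: group A + B: group B for A :: "'a monoid" and B :: "'b monoid"
begin

abbreviation "FA \<equiv> free_Abelian_group (carrier A \<times> carrier B)"
abbreviation "proj x \<equiv> tensor_relations A B #>\<^bsub>FA\<^esub> x"

lemma relations_normal: "tensor_relations A B \<lhd> FA"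
proof -
  have "subgroup (tensor_relations A B) FA"
    unfolding tensor_relations_def
  proof (rule group.generate_is_subgroup[OF group_free_Abelian_group], rule subsetI)
    have diff: "frag_of p - frag_of q - frag_of r \<in> carrier FA"
      if "p \<in> carrier A \<times> carrier B" "q \<in> carrier A \<times> carrier B" "r \<in> carrier A \<times> carrier B" for p q r
      using that keys_diff[of "frag_of p - frag_of q" "frag_of r"] keys_diff[of "frag_of p" "frag_of q"]
      by auto
    fix x assume "x \<in> {frag_of (a \<otimes>\<^bsub>A\<^esub> a', b) - frag_of (a, b) - frag_of (a', b) | a a' b.
         a \<in> carrier A \<and> a' \<in> carrier A \<and> b \<in> carrier B} \<union>
      {frag_of (a, b \<otimes>\<^bsub>B\<^esub> b') - frag_of (a, b) - frag_of (a, b') | a b b'.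
         a \<in> carrier A \<and> b \<in> carrier B \<and> b' \<in> carrier B}"
    then show "x \<in> carrier FA"
      by (elim UnE CollectE exE conjE) (simp_all only:, (rule diff; simp)+)
  qed
  then show ?thesis by (rule comm_group.subgroup_imp_normal[OF abelian_free_Abelian_group])
qed

lemma proj_hom: "(\<lambda>x. proj x) \<in> hom FA (tensor A B)"
  unfolding tensor_def by (rule normal.r_coset_hom_Mod[OF relations_normal])

lemma tensor_comm_group: "comm_group (tensor A B)"
proof (rule group.group_comm_groupI)
  show "group (tensor A B)" unfolding tensor_def by (rule normal.factorgroup_is_group[OF relations_normal])
  fix X Y assume "X \<in> carrier (tensor A B)" "Y \<in> carrier (tensor A B)"
  then obtain x y where xy: "x \<in> carrier FA" "y \<in> carrier FA" "X = proj x" "Y = proj y"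
    unfolding tensor_def FactGroup_def RCOSETS_def by auto
  show "X \<otimes>\<^bsub>tensor A B\<^esub> Y = Y \<otimes>\<^bsub>tensor A B\<^esub> X"
    unfolding xy(3,4) hom_mult[OF proj_hom xy(1,2), symmetric] hom_mult[OF proj_hom xy(2,1), symmetric]
    by (simp add: add.commute)
qed

lemma proj_cong:
  assumes "x - y \<in> tensor_relations A B" "x \<in> carrier FA" "y \<in> carrier FA" shows "proj x = proj y"
proof -
  have "x = (x - y) \<otimes>\<^bsub>FA\<^esub> y" by simp
  then have "x \<in> proj y" using assms(1) unfolding r_coset_def by blast
  then show ?thesis
    using group.repr_independence[OF group_free_Abelian_group _ assms(3) normal.axioms(1)[OF relations_normal]]
    by metis
qed

lemma pure_tensor_proj: "pure_tensor A B a b = proj (frag_of (a, b))"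
  by (simp add: pure_tensor_def)

lemma pure_tensor_closed: "a \<in> carrier A \<Longrightarrow> b \<in> carrier B \<Longrightarrow> pure_tensor A B a b \<in> carrier (tensor A B)"
  unfolding pure_tensor_proj by (rule hom_in_carrier[OF proj_hom]) simp

lemma proj_relation:
  assumes "frag_of p - frag_of q - frag_of r \<in> tensor_relations A B"
    and "p \<in> carrier A \<times> carrier B" "q \<in> carrier A \<times> carrier B" "r \<in> carrier A \<times> carrier B"
  shows "proj (frag_of p) = proj (frag_of q) \<otimes>\<^bsub>tensor A B\<^esub> proj (frag_of r)"
proof -
  have mem: "frag_of p \<in> carrier FA" "frag_of q \<in> carrier FA" "frag_of r \<in> carrier FA"
    using assms(2-4) by simp_all
  have "frag_of q \<otimes>\<^bsub>FA\<^esub> frag_of r \<in> carrier FA"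
    using group.is_monoid[OF group_free_Abelian_group] mem(2,3) by (rule monoid.m_closed)
  then show ?thesis
    unfolding hom_mult[OF proj_hom mem(2,3), symmetric] using assms(1) mem(1)
    by (intro proj_cong) (simp_all only: mult_free_Abelian_group diff_diff_eq)
qed

lemma pure_tensor_hom_left:
  assumes b: "b \<in> carrier B" shows "(\<lambda>a. pure_tensor A B a b) \<in> hom A (tensor A B)"
proof (rule homI)
  fix a a' assume a: "a \<in> carrier A" "a' \<in> carrier A"
  have "frag_of (a \<otimes>\<^bsub>A\<^esub> a', b) - frag_of (a, b) - frag_of (a', b) \<in> tensor_relations A B"
    unfolding tensor_relations_def using a b by (intro generate.incl) blast
  then show "pure_tensor A B (a \<otimes>\<^bsub>A\<^esub> a') b = pure_tensor A B a b \<otimes>\<^bsub>tensor A B\<^esub> pure_tensor A B a' b"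
    unfolding pure_tensor_proj using a b by (intro proj_relation) auto
qed (rule pure_tensor_closed[OF _ b])

lemma pure_tensor_hom_right:
  assumes a: "a \<in> carrier A" shows "(\<lambda>b. pure_tensor A B a b) \<in> hom B (tensor A B)"
proof (rule homI)
  fix b b' assume b: "b \<in> carrier B" "b' \<in> carrier B"
  have "frag_of (a, b \<otimes>\<^bsub>B\<^esub> b') - frag_of (a, b) - frag_of (a, b') \<in> tensor_relations A B"
    unfolding tensor_relations_def using a b by (intro generate.incl) blast
  then show "pure_tensor A B a (b \<otimes>\<^bsub>B\<^esub> b') = pure_tensor A B a b \<otimes>\<^bsub>tensor A B\<^esub> pure_tensor A B a b'"
    unfolding pure_tensor_proj using a b by (intro proj_relation) auto
qed (rule pure_tensor_closed[OF a])

end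

text \<open>The maps \<open>e \<sigma>\<close> and \<open>p \<sigma>\<close> display
  \<open>H\<close> as the direct sum of copies of \<open>B\<close>, and so is the tensor product.
  \<open>\<Psi>\<close> sends \<open>f\<close> to the sum of the pure tensors of
  \<open>\<sigma>\<close> and \<open>p \<sigma> f\<close>. In place of an inverse there is a
  surjection \<open>\<Phi>\<close> from the free group on all pairs onto \<open>H\<close> that kills
  the tensor relations and satisfies \<open>\<Psi> (\<Phi> x) = proj x\<close>. Then
  \<open>\<Psi>\<close> is onto, and elements with equal images have preimages under
  \<open>\<Phi>\<close> differing by a relation.\<close>

lemma tensor_free_Abelian_iso:
  fixes B :: "'b monoid" and H :: "'h monoid" and \<Omega> :: "'w set"
  assumes B: "comm_group B" and H: "comm_group H"
    and e: "\<And>\<sigma>. \<sigma> \<in> \<Omega> \<Longrightarrow> e \<sigma> \<in> hom B H" and p: "\<And>\<sigma>. \<sigma> \<in> \<Omega> \<Longrightarrow> p \<sigma> \<in> hom H B"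
    and pe: "\<And>\<sigma> \<tau> b. \<sigma> \<in> \<Omega> \<Longrightarrow> \<tau> \<in> \<Omega> \<Longrightarrow> b \<in> carrier B \<Longrightarrow> p \<sigma> (e \<tau> b) = (if \<sigma> = \<tau> then b else \<one>\<^bsub>B\<^esub>)"
    and gen: "carrier H \<subseteq> generate H (\<Union>\<sigma>\<in>\<Omega>. e \<sigma> ` carrier B)"
  shows "\<exists>\<Psi>\<in>iso H (tensor (free_Abelian_group \<Omega>) B). \<forall>\<sigma>\<in>\<Omega>. \<forall>b\<in>carrier B.
    \<Psi> (e \<sigma> b) = pure_tensor (free_Abelian_group \<Omega>) B (frag_of \<sigma>) b"
proof -
  let ?A = "free_Abelian_group \<Omega>"
  interpret B: comm_group B by (rule B)
  interpret H: comm_group H by (rule H)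
  interpret group_tensor ?A B by (simp add: group_tensor_def B.group_axioms)
  let ?T = "tensor ?A B"
  interpret T: comm_group ?T by (rule tensor_comm_group)
  define t where "t \<sigma> b = pure_tensor ?A B (frag_of \<sigma>) b" for \<sigma> b
  have t: "t \<sigma> \<in> hom B ?T" if "\<sigma> \<in> \<Omega>" for \<sigma>
    unfolding t_def using that by (intro pure_tensor_hom_right) simp
  have t_one: "t \<sigma> \<one>\<^bsub>B\<^esub> = \<one>\<^bsub>?T\<^esub>" if "\<sigma> \<in> \<Omega>" for \<sigma>
    by (rule hom_one[OF t[OF that] B.group_axioms T.group_axioms])
  have gens: "(\<Union>\<sigma>\<in>\<Omega>. e \<sigma> ` carrier B) \<subseteq> carrier H" using hom_in_carrier[OF e] by blast
  have p_one: "p \<sigma> \<one>\<^bsub>H\<^esub> = \<one>\<^bsub>B\<^esub>" if "\<sigma> \<in> \<Omega>" for \<sigma>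
    by (rule hom_one[OF p[OF that] H.group_axioms B.group_axioms])
  have fin_e: "finite {\<sigma> \<in> \<Omega>. p \<sigma> (e \<tau> b) \<noteq> \<one>\<^bsub>B\<^esub>}" if "\<tau> \<in> \<Omega>" "b \<in> carrier B" for \<tau> b
  proof (rule finite_subset[of _ "{\<tau>}"], rule subsetI)
    fix \<sigma> assume "\<sigma> \<in> {\<sigma> \<in> \<Omega>. p \<sigma> (e \<tau> b) \<noteq> \<one>\<^bsub>B\<^esub>}"
    then show "\<sigma> \<in> {\<tau>}" using pe[of \<sigma> \<tau> b] that by (cases "\<sigma> = \<tau>") simp_all
  qed simp
  \<comment> \<open>Each generator \<open>e \<tau> b\<close> has at most one nontrivial component,
    and finiteness survives products and inverses.\<close>
  have fin: "finite {\<sigma> \<in> \<Omega>. p \<sigma> f \<noteq> \<one>\<^bsub>B\<^esub>}" if "f \<in> carrier H" for f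
  proof -
    have "f \<in> generate H (\<Union>\<sigma>\<in>\<Omega>. e \<sigma> ` carrier B)" using gen that by blast
    then show ?thesis
    proof induction
      case one
      have "{\<sigma> \<in> \<Omega>. p \<sigma> \<one>\<^bsub>H\<^esub> \<noteq> \<one>\<^bsub>B\<^esub>} = {}" using p_one by blast
      then show ?case by (simp only: finite.emptyI)
    next
      case (incl h)
      then show ?case using fin_e by blast
    next
      case (inv h)
      then obtain \<tau> b where h: "\<tau> \<in> \<Omega>" "b \<in> carrier B" "h = e \<tau> b" by blast
      then have hc: "h \<in> carrier H" using hom_in_carrier[OF e] by blast
      have "p \<sigma> (inv\<^bsub>H\<^esub> h) = \<one>\<^bsub>B\<^esub>" if "\<sigma> \<in> \<Omega>" "p \<sigma> h = \<one>\<^bsub>B\<^esub>" for \<sigma>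
        using group_hom.hom_inv[of H B "p \<sigma>" h] p[OF that(1)] that(2) hc
        by (simp add: group_hom_def group_hom_axioms_def H.group_axioms B.group_axioms)
      then have "{\<sigma> \<in> \<Omega>. p \<sigma> (inv\<^bsub>H\<^esub> h) \<noteq> \<one>\<^bsub>B\<^esub>} \<subseteq> {\<sigma> \<in> \<Omega>. p \<sigma> h \<noteq> \<one>\<^bsub>B\<^esub>}" by blast
      then show ?case using fin_e[OF h(1,2)] unfolding h(3) by (rule finite_subset)
    next
      case (eng h k)
      have hk: "h \<in> carrier H" "k \<in> carrier H"
        using eng(1,2) H.generate_in_carrier[OF gens] by blast+
      have "{\<sigma> \<in> \<Omega>. p \<sigma> (h \<otimes>\<^bsub>H\<^esub> k) \<noteq> \<one>\<^bsub>B\<^esub>} \<subseteq> {\<sigma> \<in> \<Omega>. p \<sigma> h \<noteq> \<one>\<^bsub>B\<^esub>} \<union> {\<sigma> \<in> \<Omega>. p \<sigma> k \<noteq> \<one>\<^bsub>B\<^esub>}"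
        using hom_mult[OF p hk] by auto
      then show ?case using eng(3,4) by (meson finite_UnI finite_subset)
    qed
  qed
  \<comment> \<open>\<open>gfinprod\<close> multiplies over the factors different from the unit,
    which are finitely many by \<open>fin\<close>, even when \<open>\<Omega>\<close> is
    infinite.\<close>
  define \<Psi> where "\<Psi> f = gfinprod ?T (\<lambda>\<sigma>. t \<sigma> (p \<sigma> f)) \<Omega>" for f
  have tp: "(\<lambda>\<sigma>. t \<sigma> (p \<sigma> f)) \<in> \<Omega> \<rightarrow> carrier ?T" if "f \<in> carrier H" for f
    using hom_in_carrier[OF t] hom_in_carrier[OF p] that by blast
  have fin_t: "finite {\<sigma> \<in> \<Omega>. t \<sigma> (p \<sigma> f) \<noteq> \<one>\<^bsub>?T\<^esub>}" if "f \<in> carrier H" for f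
  proof (rule finite_subset[OF _ fin[OF that]])
    show "{\<sigma> \<in> \<Omega>. t \<sigma> (p \<sigma> f) \<noteq> \<one>\<^bsub>?T\<^esub>} \<subseteq> {\<sigma> \<in> \<Omega>. p \<sigma> f \<noteq> \<one>\<^bsub>B\<^esub>}"
      using t_one by auto
  qed
  have \<Psi>_hom: "\<Psi> \<in> hom H ?T"
  proof (rule homI)
    show "\<Psi> f \<in> carrier ?T" if "f \<in> carrier H" for f
      unfolding \<Psi>_def by (rule T.gfinprod_closed[OF tp[OF that]])
    fix f g assume fg: "f \<in> carrier H" "g \<in> carrier H"
    have "\<Psi> (f \<otimes>\<^bsub>H\<^esub> g) = gfinprod ?T (\<lambda>\<sigma>. t \<sigma> (p \<sigma> f) \<otimes>\<^bsub>?T\<^esub> t \<sigma> (p \<sigma> g)) \<Omega>"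
      unfolding \<Psi>_def
    proof (rule T.gfinprod_cong[OF refl])
      show "(\<lambda>\<sigma>. t \<sigma> (p \<sigma> (f \<otimes>\<^bsub>H\<^esub> g))) \<in> \<Omega> \<rightarrow> carrier ?T" by (rule tp) (use fg in simp)
      fix \<sigma>
      show "\<sigma> \<in> \<Omega> =simp=> t \<sigma> (p \<sigma> (f \<otimes>\<^bsub>H\<^esub> g)) = t \<sigma> (p \<sigma> f) \<otimes>\<^bsub>?T\<^esub> t \<sigma> (p \<sigma> g)"
        unfolding simp_implies_def
        using fg by (simp add: hom_mult[OF p] hom_mult[OF t] hom_in_carrier[OF p])
    qed
    also have "\<dots> = \<Psi> f \<otimes>\<^bsub>?T\<^esub> \<Psi> g"
      unfolding \<Psi>_def by (rule T.gfinprod_distrib) (use fg fin_t tp in auto)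
    finally show "\<Psi> (f \<otimes>\<^bsub>H\<^esub> g) = \<Psi> f \<otimes>\<^bsub>?T\<^esub> \<Psi> g" .
  qed
  have \<Psi>_e: "\<Psi> (e \<tau> b) = t \<tau> b" if \<tau>: "\<tau> \<in> \<Omega>" and b: "b \<in> carrier B" for \<tau> b
  proof -
    have eb: "e \<tau> b \<in> carrier H" by (rule hom_in_carrier[OF e[OF \<tau>] b])
    have tb: "t \<tau> b \<in> carrier ?T" by (rule hom_in_carrier[OF t[OF \<tau>] b])
    have "gfinprod ?T (\<lambda>\<sigma>. t \<sigma> (p \<sigma> (e \<tau> b))) \<Omega> = gfinprod ?T (\<lambda>_. t \<tau> b) {\<tau>}"
    proof (rule T.gfinprod_mono_neutral_cong_right)
      show "{\<tau>} \<subseteq> \<Omega>" using \<tau> by simp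
      show "t \<sigma> (p \<sigma> (e \<tau> b)) = \<one>\<^bsub>?T\<^esub>" if "\<sigma> \<in> \<Omega> - {\<tau>}" for \<sigma>
        using that pe[of \<sigma> \<tau> b] \<tau> b t_one by auto
      show "t \<sigma> (p \<sigma> (e \<tau> b)) = t \<tau> b" if "\<sigma> \<in> {\<tau>}" for \<sigma>
        using that pe[of \<tau> \<tau> b] \<tau> b by simp
      show "(\<lambda>\<sigma>. t \<sigma> (p \<sigma> (e \<tau> b))) \<in> \<Omega> \<rightarrow> carrier ?T" by (rule tp[OF eb])
    qed
    also have "\<dots> = t \<tau> b" using tb by (simp add: T.gfinprod_eq_finprod T.finprod_insert)
    finally show ?thesis unfolding \<Psi>_def .
  qed
  \<comment> \<open>\<open>\<Phi>\<close> is built in two stages: \<open>k b\<close> extends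
    \<open>\<sigma> \<mapsto> e \<sigma> b\<close> to the free group on \<open>\<Omega>\<close>, and
    \<open>\<Phi>\<close> extends the resulting function of pairs.\<close>
  have "\<exists>k. k \<in> hom ?A H \<and> (\<forall>\<sigma>\<in>\<Omega>. k (frag_of \<sigma>) = e \<sigma> b)" if "b \<in> carrier B" for b
  proof -
    have "(\<lambda>\<sigma>. e \<sigma> b) ` \<Omega> \<subseteq> carrier H" using hom_in_carrier[OF e _ ] that by blast
    then show ?thesis using H.free_Abelian_group_universal[of "\<lambda>\<sigma>. e \<sigma> b" \<Omega>] by metis
  qed
  then obtain k where k: "\<And>b. b \<in> carrier B \<Longrightarrow> k b \<in> hom ?A H"
    and k_frag: "\<And>b \<sigma>. b \<in> carrier B \<Longrightarrow> \<sigma> \<in> \<Omega> \<Longrightarrow> k b (frag_of \<sigma>) = e \<sigma> b"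
    by metis
  have "(\<lambda>(a, b). k b a) ` (carrier ?A \<times> carrier B) \<subseteq> carrier H"
    using hom_in_carrier[OF k] by auto
  then obtain \<Phi> where \<Phi>: "\<Phi> \<in> hom FA H"
    and \<Phi>_frag: "\<And>a b. a \<in> carrier ?A \<Longrightarrow> b \<in> carrier B \<Longrightarrow> \<Phi> (frag_of (a, b)) = k b a"
    using H.free_Abelian_group_universal[of "\<lambda>(a, b). k b a" "carrier ?A \<times> carrier B"]
    by (metis SigmaI case_prod_conv)
  interpret \<Phi>: group_hom FA H \<Phi>
    using \<Phi> by (simp add: group_hom_def group_hom_axioms_def H.group_axioms)
  \<comment> \<open>Uniqueness of homomorphisms on free groups is used twice, to reduce to a pair
    \<open>(a, b)\<close> and then to \<open>a = frag_of \<sigma>\<close>.\<close>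
  have comp: "\<Psi> (\<Phi> x) = proj x" if x: "x \<in> carrier FA" for x
  proof (rule free_Abelian_hom_unique[OF T.group_axioms _ proj_hom _ x, of "\<lambda>x. \<Psi> (\<Phi> x)"])
    show "(\<lambda>x. \<Psi> (\<Phi> x)) \<in> hom FA ?T" using hom_compose[OF \<Phi> \<Psi>_hom] by (simp add: comp_def)
    fix s assume "s \<in> carrier ?A \<times> carrier B"
    then obtain a b where s: "s = (a, b)" "a \<in> carrier ?A" "b \<in> carrier B" by blast
    have "\<Psi> (k b a) = pure_tensor ?A B a b"
    proof (rule free_Abelian_hom_unique[OF T.group_axioms _ pure_tensor_hom_left[OF s(3)] _ s(2),
          of "\<lambda>a. \<Psi> (k b a)"])
      show "(\<lambda>a. \<Psi> (k b a)) \<in> hom ?A ?T" using hom_compose[OF k[OF s(3)] \<Psi>_hom] by (simp add: comp_def)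
      show "\<Psi> (k b (frag_of \<sigma>)) = pure_tensor ?A B (frag_of \<sigma>) b" if "\<sigma> \<in> \<Omega>" for \<sigma>
        using \<Psi>_e[OF that s(3)] k_frag[OF s(3) that] by (simp add: t_def)
    qed
    then show "\<Psi> (\<Phi> (frag_of s)) = proj (frag_of s)"
      using \<Phi>_frag[OF s(2,3)] by (simp add: s(1) pure_tensor_proj)
  qed
  have \<Phi>_surj: "\<Phi> ` carrier FA = carrier H"
  proof
    show "\<Phi> ` carrier FA \<subseteq> carrier H" using \<Phi>.hom_closed by blast
    have "(\<Union>\<sigma>\<in>\<Omega>. e \<sigma> ` carrier B) \<subseteq> \<Phi> ` carrier FA"
    proof
      fix h assume "h \<in> (\<Union>\<sigma>\<in>\<Omega>. e \<sigma> ` carrier B)"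
      then obtain \<sigma> b where h: "\<sigma> \<in> \<Omega>" "b \<in> carrier B" "h = e \<sigma> b" by blast
      then have "h = \<Phi> (frag_of (frag_of \<sigma>, b))" using \<Phi>_frag[of "frag_of \<sigma>" b] k_frag by simp
      moreover have "frag_of (frag_of \<sigma>, b) \<in> carrier FA" using h by simp
      ultimately show "h \<in> \<Phi> ` carrier FA" by blast
    qed
    then show "carrier H \<subseteq> \<Phi> ` carrier FA"
      using gen H.generate_subgroup_incl[OF _ \<Phi>.img_is_subgroup] by blast
  qed
  have k_mult: "k (b \<otimes>\<^bsub>B\<^esub> b') a = k b a \<otimes>\<^bsub>H\<^esub> k b' a"
    if b: "b \<in> carrier B" "b' \<in> carrier B" and a: "a \<in> carrier ?A" for a b b'
  proof (rule free_Abelian_hom_unique[OF H.group_axioms _ H.hom_group_mult[OF k[OF b(1)] k[OF b(2)]] _ a,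
        of "k (b \<otimes>\<^bsub>B\<^esub> b')"])
    show "k (b \<otimes>\<^bsub>B\<^esub> b') \<in> hom ?A H" using b by (intro k) simp
    show "k (b \<otimes>\<^bsub>B\<^esub> b') (frag_of \<sigma>) = k b (frag_of \<sigma>) \<otimes>\<^bsub>H\<^esub> k b' (frag_of \<sigma>)" if "\<sigma> \<in> \<Omega>" for \<sigma>
      using b that by (simp add: k_frag hom_mult[OF e])
  qed
  have rel: "\<Phi> x = \<one>\<^bsub>H\<^esub>" if "x \<in> tensor_relations ?A B" for x
  proof -
    have "tensor_relations ?A B \<subseteq> kernel FA H \<Phi>"
      unfolding tensor_relations_def
    proof (rule \<Phi>.G.generate_subgroup_incl[OF _ \<Phi>.subgroup_kernel], rule subsetI)
      have mem: "x - y - z \<in> kernel FA H \<Phi>"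
        if xyz: "x \<in> carrier FA" "y \<in> carrier FA" "z \<in> carrier FA" "\<Phi> x = \<Phi> y \<otimes>\<^bsub>H\<^esub> \<Phi> z" for x y z
      proof -
        have yz: "y \<otimes>\<^bsub>FA\<^esub> z \<in> carrier FA" using xyz by (intro \<Phi>.G.m_closed)
        then have eq: "x - y - z = x \<otimes>\<^bsub>FA\<^esub> inv\<^bsub>FA\<^esub> (y \<otimes>\<^bsub>FA\<^esub> z)"
          by (subst inv_free_Abelian_group) (simp_all add: diff_diff_eq)
        show ?thesis unfolding eq kernel_def mem_Collect_eq using xyz yz
          by (simp only: \<Phi>.hom_mult \<Phi>.hom_inv \<Phi>.G.m_closed \<Phi>.G.inv_closed \<Phi>.hom_closed H.r_inv H.m_closed simp_thms)
      qed
      fix x assume "x \<in> {frag_of (a \<otimes>\<^bsub>?A\<^esub> a', b) - frag_of (a, b) - frag_of (a', b) | a a' b.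
           a \<in> carrier ?A \<and> a' \<in> carrier ?A \<and> b \<in> carrier B} \<union>
        {frag_of (a, b \<otimes>\<^bsub>B\<^esub> b') - frag_of (a, b) - frag_of (a, b') | a b b'.
           a \<in> carrier ?A \<and> b \<in> carrier B \<and> b' \<in> carrier B}"
      then consider
        (l) a a' b where "a \<in> carrier ?A" "a' \<in> carrier ?A" "b \<in> carrier B"
          "x = frag_of (a \<otimes>\<^bsub>?A\<^esub> a', b) - frag_of (a, b) - frag_of (a', b)" |
        (r) a b b' where "a \<in> carrier ?A" "b \<in> carrier B" "b' \<in> carrier B"
          "x = frag_of (a, b \<otimes>\<^bsub>B\<^esub> b') - frag_of (a, b) - frag_of (a, b')"
        by blast
      then show "x \<in> kernel FA H \<Phi>"
      proof cases
        case l
        have "a \<otimes>\<^bsub>?A\<^esub> a' \<in> carrier ?A" using l(1,2) by (rule A.m_closed)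
        then show ?thesis unfolding l(4) using l(1-3)
          by (intro mem) (simp_all only: \<Phi>_frag hom_mult[OF k] frag_of_in_free_Abelian_group mem_Sigma_iff simp_thms)
      next
        case r
        have "b \<otimes>\<^bsub>B\<^esub> b' \<in> carrier B" using r(2,3) by (rule B.m_closed)
        then show ?thesis unfolding r(4) using r(1-3)
          by (intro mem) (simp_all only: \<Phi>_frag k_mult frag_of_in_free_Abelian_group mem_Sigma_iff simp_thms)
      qed
    qed
    then show ?thesis using that unfolding kernel_def by blast
  qed
  have "\<Psi> \<in> iso H ?T"
  proof (rule isoI[OF \<Psi>_hom], rule bij_betwI')
    fix f g assume fg: "f \<in> carrier H" "g \<in> carrier H"
    show "\<Psi> f = \<Psi> g \<longleftrightarrow> f = g"
    proof
      assume eq: "\<Psi> f = \<Psi> g"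
      obtain x y where xy: "x \<in> carrier FA" "\<Phi> x = f" "y \<in> carrier FA" "\<Phi> y = g"
        using fg unfolding \<Phi>_surj[symmetric] by blast
      have "proj x = proj y"
        using eq unfolding xy(2,4)[symmetric] comp[OF xy(1)] comp[OF xy(3)] .
      moreover have "x \<in> proj x"
        by (rule group.rcos_self[OF group_free_Abelian_group xy(1) normal.axioms(1)[OF relations_normal]])
      ultimately obtain r where r: "r \<in> tensor_relations ?A B" "x = r \<otimes>\<^bsub>FA\<^esub> y"
        unfolding r_coset_def by blast
      have "r \<in> carrier FA"
        by (rule subgroup.mem_carrier[OF normal.axioms(1)[OF relations_normal] r(1)])
      then have "\<Phi> x = \<Phi> r \<otimes>\<^bsub>H\<^esub> \<Phi> y" unfolding r(2) using xy(3) by (rule \<Phi>.hom_mult)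
      then show "f = g" using rel[OF r(1)] xy fg by simp
    qed simp
  next
    show "\<Psi> f \<in> carrier ?T" if "f \<in> carrier H" for f by (rule hom_in_carrier[OF \<Psi>_hom that])
  next
    fix X assume "X \<in> carrier ?T"
    then obtain x where x: "x \<in> carrier FA" "X = proj x"
      unfolding tensor_def FactGroup_def RCOSETS_def by auto
    show "\<exists>f\<in>carrier H. X = \<Psi> f"
      by (rule bexI[of _ "\<Phi> x"]) (simp_all only: comp[OF x(1)] x(2) \<Phi>.hom_closed[OF x(1)])
  qed
  then show ?thesis using \<Psi>_e unfolding t_def by blast
qed

section \<open>Hecke rings and semidirect products\<close>

text \<open>\<open>with_multiplication\<close> keeps the group operation of \<open>T\<close> as
  addition, so an isomorphism of additive groups is enough to carry over the product and the
  unit.\<close>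

lemma transport_multiplication:
  assumes H: "ring H" and T: "group T" and \<Psi>: "\<Psi> \<in> iso (add_monoid H) T"
  shows "\<exists>m e. ring (with_multiplication T m e) \<and> \<Psi> \<in> ring_iso H (with_multiplication T m e)"
proof -
  interpret H: ring H by (rule H)
  have hom: "\<Psi> \<in> hom (add_monoid H) T" and bij: "bij_betw \<Psi> (carrier H) (carrier T)"
    using \<Psi> by (simp_all add: iso_def)
  define inv\<Psi> where "inv\<Psi> = inv_into (carrier H) \<Psi>"
  define m where "m x y = \<Psi> (inv\<Psi> x \<otimes>\<^bsub>H\<^esub> inv\<Psi> y)" for x y
  let ?R = "with_multiplication T m (\<Psi> \<one>\<^bsub>H\<^esub>)"
  have inv: "inv\<Psi> (\<Psi> x) = x" if "x \<in> carrier H" for x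
    using bij_betw_inv_into_left[OF bij that] by (simp add: inv\<Psi>_def)
  have iso: "\<Psi> \<in> ring_iso H ?R"
  proof (rule ring_iso_memI)
    show "\<Psi> x \<in> carrier ?R" if "x \<in> carrier H" for x
      using hom_in_carrier[OF hom, of x] that by (simp add: with_multiplication_def)
    show "\<Psi> (x \<otimes>\<^bsub>H\<^esub> y) = \<Psi> x \<otimes>\<^bsub>?R\<^esub> \<Psi> y" if "x \<in> carrier H" "y \<in> carrier H" for x y
      using that by (simp add: with_multiplication_def m_def inv)
    show "\<Psi> (x \<oplus>\<^bsub>H\<^esub> y) = \<Psi> x \<oplus>\<^bsub>?R\<^esub> \<Psi> y" if "x \<in> carrier H" "y \<in> carrier H" for x y
      using hom_mult[OF hom, of x y] that by (simp add: with_multiplication_def)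
    show "\<Psi> \<one>\<^bsub>H\<^esub> = \<one>\<^bsub>?R\<^esub>" by (simp add: with_multiplication_def)
    show "bij_betw \<Psi> (carrier H) (carrier ?R)" using bij by (simp add: with_multiplication_def)
  qed
  have "\<Psi> \<zero>\<^bsub>H\<^esub> = \<one>\<^bsub>T\<^esub>" using hom_one[OF hom H.a_group T] by simp
  \<comment> \<open>The image ring is delivered with the image of 0 as its zero; this is the zero
    that \<open>with_multiplication\<close> provides.\<close>
  then have "?R\<lparr>zero := \<Psi> \<zero>\<^bsub>H\<^esub>\<rparr> = ?R" by (simp add: with_multiplication_def)
  then have "ring ?R" using H.ring_iso_imp_img_ring[OF iso] by simp
  with iso show ?thesis by blast
qed

text \<open>\<open>Y\<close> plays the part of \<open>G1b\<close>. The building enters only through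
  \<open>norm\<close>, and the Kottwitz kernel only through \<open>Y\<close>, with
  \<open>Waff\<close> described as the set of cosets contained in it.\<close>

locale hecke_semidirect = hecke_pair G \<T> \<mu> J
  for G :: "'a monoid" (structure) and \<T> \<mu> J +
  fixes N Mb Y :: "'a set" and \<Omega> Waff :: "'a set set" and W :: "'a set monoid"
    and i :: "'a set \<Rightarrow> 'a \<Rightarrow> real"
  assumes N: "subgroup N G" and Mb: "Mb \<lhd> G\<lparr>carrier := N\<rparr>" and MbJ: "Mb \<subseteq> J"
    and Y: "subgroup Y G" and JY: "J \<subseteq> Y"
    and W: "W = G\<lparr>carrier := N\<rparr> Mod Mb"
    and Waff: "Waff = {w \<in> carrier W. w \<subseteq> Y}"
    and semi: "semidirect W Waff \<Omega>"
    and norm: "\<And>\<sigma> x. \<sigma> \<in> \<Omega> \<Longrightarrow> x \<in> \<sigma> \<Longrightarrow> x <# J = J #> x"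
    and i: "i = (\<lambda>w. indicator (J <#> w <#> J))"
    and basis: "int_basis (carrier W) i (carrier (hecke_ring G \<T> \<mu> J (carrier G)))"
begin

abbreviation conv (infixl "\<star>" 70) where "conv \<equiv> convolution G \<mu>"
abbreviation "H \<equiv> hecke_ring G \<T> \<mu> J (carrier G)"
abbreviation "Haff \<equiv> hecke_ring G \<T> \<mu> J Y"

lemma J_sub: "J \<subseteq> carrier G" by (rule subgroup.subset[OF J])

lemma Mb_subgroup: "subgroup Mb G"
  using incl_subgroup[OF N] normal.axioms(1)[OF Mb] by simp

lemma Mb_J: "Mb <#> J = J" "J <#> Mb = J"
proof -
  have "\<one> \<in> Mb" by (rule subgroup.one_closed[OF Mb_subgroup])
  then have "J \<subseteq> Mb <#> J" "J \<subseteq> J <#> Mb"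
    using J_sub unfolding set_mult_def by (force simp: subset_iff)+
  moreover have "Mb <#> J \<subseteq> J" "J <#> Mb \<subseteq> J"
    using MbJ subgroup.m_closed[OF J] unfolding set_mult_def by blast+
  ultimately show "Mb <#> J = J" "J <#> Mb = J" by blast+
qed

lemma W_group: "group W"
  unfolding W by (rule normal.factorgroup_is_group[OF Mb])

lemma W_mult: "w \<otimes>\<^bsub>W\<^esub> w' = w <#> w'"
  by (simp add: W FactGroup_def set_mult_def)

lemma W_one: "\<one>\<^bsub>W\<^esub> = Mb"
  by (simp add: W FactGroup_def)

lemma W_carrier: "w \<in> carrier W \<longleftrightarrow> (\<exists>x\<in>N. w = Mb #> x)"
  by (auto simp: W FactGroup_def RCOSETS_def r_coset_def)

lemma W_elem:
  assumes w: "w \<in> carrier W" and x: "x \<in> w"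
  shows "x \<in> N" "x \<in> carrier G" "w = Mb #> x" "w = x <# Mb"
proof -
  obtain y where y: "y \<in> N" "w = Mb #> y" using w W_carrier by blast
  have yc: "y \<in> carrier G" by (rule subgroup.mem_carrier[OF N y(1)])
  obtain m where m: "m \<in> Mb" "x = m \<otimes> y" using x unfolding y(2) r_coset_def by blast
  have "Mb \<subseteq> N" using subgroup.subset[OF normal.axioms(1)[OF Mb]] by simp
  then show xN: "x \<in> N" unfolding m(2) using m(1) y(1) by (intro subgroup.m_closed[OF N]) auto
  then show "x \<in> carrier G" by (rule subgroup.mem_carrier[OF N])
  show eq: "w = Mb #> x"
    using repr_independence[OF _ yc Mb_subgroup] x unfolding y(2) by blast
  have "Mb #>\<^bsub>G\<lparr>carrier := N\<rparr>\<^esub> x = x <#\<^bsub>G\<lparr>carrier := N\<rparr>\<^esub> Mb"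
    using normal.coset_eq[OF Mb] xN by simp
  then show "w = x <# Mb" unfolding eq r_coset_def l_coset_def by simp
qed

lemma W_sub: "w \<in> carrier W \<Longrightarrow> w \<subseteq> carrier G"
  using W_elem(2) by blast

lemma W_nonempty: "w \<in> carrier W \<Longrightarrow> \<exists>x. x \<in> w"
  using W_carrier subgroup.one_closed[OF Mb_subgroup] unfolding r_coset_def by blast

lemma Omega_subgroup: "subgroup \<Omega> W" and Waff_normal: "Waff \<lhd> W"
  and Waff_Omega: "Waff \<inter> \<Omega> = {Mb}" and Waff_mult_Omega: "Waff <#>\<^bsub>W\<^esub> \<Omega> = carrier W"
  using semi by (simp_all add: semidirect_def W_one)

lemma Omega_W: "\<sigma> \<in> \<Omega> \<Longrightarrow> \<sigma> \<in> carrier W"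
  by (rule subgroup.mem_carrier[OF Omega_subgroup])

lemma i_in_H: "w \<in> carrier W \<Longrightarrow> i w \<in> hecke_fun (carrier G)"
  using basis by (simp add: int_basis_def)

section \<open>Convolution with the elements of the alcove stabilizer\<close>

definition lift :: "'a set \<Rightarrow> 'a" where
  "lift \<sigma> = (SOME x. x \<in> \<sigma>)"

context
  fixes \<sigma> assumes \<sigma>: "\<sigma> \<in> \<Omega>"
begin

lemma lift_mem: "lift \<sigma> \<in> \<sigma>"
  unfolding lift_def using W_nonempty[OF Omega_W[OF \<sigma>]] by (rule someI_ex)

lemma lift_carrier: "lift \<sigma> \<in> carrier G"
  using W_elem(2)[OF Omega_W[OF \<sigma>] lift_mem] .

lemma lift_norm: "lift \<sigma> <# J = J #> lift \<sigma>"
  by (rule norm[OF \<sigma> lift_mem])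

lemma J_sigma: "J <#> \<sigma> = lift \<sigma> <# J" "\<sigma> <#> J = lift \<sigma> <# J"
proof -
  have Mb_sub: "Mb \<subseteq> carrier G" by (rule subgroup.subset[OF Mb_subgroup])
  have "J <#> \<sigma> = (J <#> Mb) #> lift \<sigma>"
    by (subst W_elem(3)[OF Omega_W[OF \<sigma>] lift_mem]) (rule setmult_rcos_assoc[OF J_sub Mb_sub lift_carrier])
  then show "J <#> \<sigma> = lift \<sigma> <# J" by (simp only: Mb_J lift_norm)
  have "\<sigma> <#> J = {lift \<sigma>} <#> Mb <#> J"
    by (subst W_elem(4)[OF Omega_W[OF \<sigma>] lift_mem]) (simp only: l_coset_eq_set_mult)
  also have "\<dots> = {lift \<sigma>} <#> (Mb <#> J)"
    by (rule set_mult_assoc) (use lift_carrier Mb_sub J_sub in auto)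
  finally show "\<sigma> <#> J = lift \<sigma> <# J" by (simp only: Mb_J l_coset_eq_set_mult)
qed

lemma i_sigma: "i \<sigma> = indicator (lcoset (lift \<sigma>))"
proof -
  have "J <#> \<sigma> <#> J = {lift \<sigma>} <#> J <#> J" unfolding J_sigma(1) l_coset_eq_set_mult ..
  also have "\<dots> = {lift \<sigma>} <#> (J <#> J)"
    by (rule set_mult_assoc) (use lift_carrier J_sub in auto)
  also have "\<dots> = lcoset (lift \<sigma>)"
    unfolding subgroup_mult_id[OF J] lcoset_eq[OF lift_carrier] l_coset_eq_set_mult ..
  finally show ?thesis unfolding i by simp
qed

lemma coset_sum_i: "coset_sum (i \<sigma>) {lift \<sigma>} (\<lambda>_. 1) (\<lambda>a. a)"
  by (simp add: coset_sum_def i_sigma lift_carrier)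

lemma conv_i_left:
  assumes "f \<in> hecke_fun Z" "y \<in> carrier G" shows "(i \<sigma> \<star> f) y = f (inv (lift \<sigma>) \<otimes> y)"
  using convolution_expansion[OF coset_sum_i hecke_fun_left_inv[OF assms(1)] assms(2)] by simp

lemma lift_norm_mem:
  assumes g: "g \<in> carrier G" shows "inv (lift \<sigma>) \<otimes> g \<in> J \<longleftrightarrow> g \<otimes> inv (lift \<sigma>) \<in> J"
  unfolding mem_l_coset_iff[OF J_sub lift_carrier g, symmetric] mem_r_coset_iff[OF J_sub lift_carrier g, symmetric]
    lift_norm ..

text \<open>The expansion runs over representatives of \<open>f\<close>. As
  \<open>lift \<sigma>\<close> normalizes \<open>J\<close>, the condition that
  \<open>inv a \<otimes> y\<close> lies in its coset says that
  \<open>y \<otimes> inv (lift \<sigma>)\<close> lies in the coset of \<open>a\<close>; what remains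
  is the expansion of \<open>f\<close> at that point.\<close>

lemma conv_i_right:
  assumes f: "f \<in> hecke_fun Z" and y: "y \<in> carrier G" shows "(f \<star> i \<sigma>) y = f (y \<otimes> inv (lift \<sigma>))"
proof -
  obtain A where A: "coset_sum f A f (\<lambda>a. a)" using hecke_fun_expansion[OF f] by blast
  then have AG: "a \<in> A \<Longrightarrow> a \<in> carrier G" for a by (auto simp: coset_sum_def)
  have mem: "inv a \<otimes> y \<in> lcoset (lift \<sigma>) \<longleftrightarrow> y \<otimes> inv (lift \<sigma>) \<in> lcoset a" if a: "a \<in> carrier G" for a
    using lift_norm_mem[of "inv a \<otimes> y"] a y lift_carrier by (simp add: lcoset_def m_assoc)
  from convolution_expansion[OF A hecke_fun_left_inv[OF i_in_H[OF Omega_W[OF \<sigma>]]] y]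
  have "(f \<star> i \<sigma>) y = (\<Sum>a\<in>A. f a * indicator (lcoset (lift \<sigma>)) (inv a \<otimes> y))" by (simp add: i_sigma)
  also have "\<dots> = (\<Sum>a\<in>A. f a * indicator (lcoset a) (y \<otimes> inv (lift \<sigma>)))"
    using mem AG by (intro sum.cong) (auto simp: indicator_def)
  also have "\<dots> = f (y \<otimes> inv (lift \<sigma>))" using A y lift_carrier by (simp add: coset_sum_def)
  finally show ?thesis .
qed

end

lemma i_zero_outside:
  assumes "w \<in> carrier W" "y \<notin> carrier G" shows "i w y = 0"
  using hecke_fun_support[OF i_in_H[OF assms(1)] assms(2)] .

lemma JwJ_sub: "w \<in> carrier W \<Longrightarrow> J <#> w <#> J \<subseteq> carrier G"
  by (intro set_mult_closed J_sub W_sub)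

lemma i_mult_left:
  assumes \<sigma>: "\<sigma> \<in> \<Omega>" and w: "w \<in> carrier W" shows "i \<sigma> \<star> i w = i (\<sigma> \<otimes>\<^bsub>W\<^esub> w)"
proof
  fix y
  have \<sigma>w: "\<sigma> \<otimes>\<^bsub>W\<^esub> w \<in> carrier W"
    by (rule monoid.m_closed[OF group.is_monoid[OF W_group] Omega_W[OF \<sigma>] w])
  note sub = J_sub W_sub[OF Omega_W[OF \<sigma>]] W_sub[OF w]
  have "J <#> (\<sigma> <#> w) <#> J = J <#> \<sigma> <#> w <#> J"
    by (subst set_mult_assoc[OF sub]) (rule refl)
  also have "\<dots> = {lift \<sigma>} <#> J <#> w <#> J" unfolding J_sigma(1)[OF \<sigma>] l_coset_eq_set_mult ..
  also have "\<dots> = {lift \<sigma>} <#> (J <#> w <#> J)"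
    using sub lift_carrier[OF \<sigma>] by (simp add: set_mult_assoc set_mult_closed)
  finally have eq: "J <#> (\<sigma> <#> w) <#> J = {lift \<sigma>} <#> (J <#> w <#> J)" .
  show "(i \<sigma> \<star> i w) y = i (\<sigma> \<otimes>\<^bsub>W\<^esub> w) y"
  proof (cases "y \<in> carrier G")
    case True
    then show ?thesis
      using conv_i_left[OF \<sigma> i_in_H[OF w] True] mem_l_coset_iff[OF JwJ_sub[OF w] lift_carrier[OF \<sigma>] True]
      by (simp add: i W_mult eq indicator_def l_coset_eq_set_mult)
  next
    case False
    then show ?thesis using i_zero_outside[OF \<sigma>w False] by (simp add: convolution_def)
  qed
qed

lemma i_mult_right:
  assumes \<sigma>: "\<sigma> \<in> \<Omega>" and w: "w \<in> carrier W" shows "i w \<star> i \<sigma> = i (w \<otimes>\<^bsub>W\<^esub> \<sigma>)"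
proof
  fix y
  have w\<sigma>: "w \<otimes>\<^bsub>W\<^esub> \<sigma> \<in> carrier W"
    by (rule monoid.m_closed[OF group.is_monoid[OF W_group] w Omega_W[OF \<sigma>]])
  note sub = J_sub W_sub[OF Omega_W[OF \<sigma>]] W_sub[OF w]
  have "J <#> (w <#> \<sigma>) <#> J = J <#> w <#> (\<sigma> <#> J)"
    using sub by (simp add: set_mult_assoc set_mult_closed)
  also have "\<dots> = J <#> w <#> (J <#> {lift \<sigma>})"
    unfolding J_sigma(2)[OF \<sigma>] lift_norm[OF \<sigma>] r_coset_eq_set_mult ..
  also have "\<dots> = (J <#> w <#> J) <#> {lift \<sigma>}"
    using sub lift_carrier[OF \<sigma>] by (simp add: set_mult_assoc set_mult_closed)
  finally have eq: "J <#> (w <#> \<sigma>) <#> J = (J <#> w <#> J) <#> {lift \<sigma>}" .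
  show "(i w \<star> i \<sigma>) y = i (w \<otimes>\<^bsub>W\<^esub> \<sigma>) y"
  proof (cases "y \<in> carrier G")
    case True
    then show ?thesis
      using conv_i_right[OF \<sigma> i_in_H[OF w] True] mem_r_coset_iff[OF JwJ_sub[OF w] lift_carrier[OF \<sigma>] True]
      by (simp add: i W_mult eq indicator_def r_coset_eq_set_mult)
  next
    case False
    then show ?thesis using i_zero_outside[OF w\<sigma> False] by (simp add: convolution_def)
  qed
qed

section \<open>Decomposition of the Hecke ring along cosets of \<open>Y\<close>\<close>

lemma hecke_fun_restrict: "f \<in> hecke_fun Z \<Longrightarrow> (\<And>x. x \<notin> Y \<Longrightarrow> f x = 0) \<Longrightarrow> f \<in> hecke_fun Y"
  by (simp add: hecke_fun_def)

lemma hecke_fun_Y: "f \<in> hecke_fun Y \<Longrightarrow> f \<in> hecke_fun (carrier G)"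
  using hecke_fun_mono[OF subgroup.subset[OF Y]] by blast

lemma i_in_Haff: "w \<in> Waff \<Longrightarrow> i w \<in> hecke_fun Y"
proof (rule hecke_fun_restrict)
  assume w: "w \<in> Waff"
  then show "i w \<in> hecke_fun (carrier G)" using i_in_H by (simp add: Waff)
  have "J <#> w <#> J \<subseteq> Y"
    using w JY subgroup.m_closed[OF Y] unfolding Waff set_mult_def by blast
  then show "i w x = 0" if "x \<notin> Y" for x using that by (auto simp: i indicator_def)
qed

lemma H_ring: "ring H"
  by (rule hecke_ring_is_ring[OF subgroup_self J_sub])

lemma Haff_ring: "ring Haff"
  by (rule hecke_ring_is_ring[OF Y JY])

lemma mult_eq [simp]: "f \<otimes>\<^bsub>hecke_ring G \<T> \<mu> J Z\<^esub> g = f \<star> g"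
  by (simp add: hecke_ring_def)

lemma add_eq [simp]: "f \<oplus>\<^bsub>hecke_ring G \<T> \<mu> J Z\<^esub> g = (\<lambda>x. f x + g x)"
  by (simp add: hecke_ring_def)

lemma zero_eq [simp]: "\<zero>\<^bsub>hecke_ring G \<T> \<mu> J Z\<^esub> = (\<lambda>_. 0)"
  by (simp add: hecke_ring_def)

text \<open>The projection belonging to \<open>\<sigma>\<close>: restrict \<open>f\<close> to the
  coset \<open>lift \<sigma> <# Y\<close> and translate back. It undoes convolution with
  \<open>i \<sigma>\<close> on affine functions.\<close>

definition component :: "'a set \<Rightarrow> ('a \<Rightarrow> real) \<Rightarrow> 'a \<Rightarrow> real" where
  "component \<sigma> f y = (if y \<in> Y then f (lift \<sigma> \<otimes> y) else 0)"

lemma component_closed: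
  assumes \<sigma>: "\<sigma> \<in> \<Omega>" and f: "f \<in> hecke_fun (carrier G)" shows "component \<sigma> f \<in> hecke_fun Y"
  unfolding hecke_fun_def
proof (intro CollectI conjI ballI allI impI)
  let ?x = "lift \<sigma>"
  note x = lift_carrier[OF \<sigma>]
  show "range (component \<sigma> f) \<subseteq> \<int>" using hecke_fun_Ints[OF f] by (auto simp: component_def)
  show "component \<sigma> f y = 0" if "y \<notin> Y" for y using that by (simp add: component_def)
  obtain C where C: "compactin \<T> C" "\<And>y. y \<notin> C \<Longrightarrow> f y = 0" using hecke_fun_compact[OF f] by blast
  have "compactin \<T> ((\<lambda>y. inv ?x \<otimes> y) ` C)"
    using x by (intro image_compactin[OF C(1)] continuous_translation) simp
  moreover have "component \<sigma> f y = 0" if "y \<notin> (\<lambda>y. inv ?x \<otimes> y) ` C" for y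
  proof (cases "y \<in> Y")
    case True
    then have "y \<in> carrier G" using subgroup.mem_carrier[OF Y] by blast
    then have "y = inv ?x \<otimes> (?x \<otimes> y)" using x by (simp add: m_assoc[symmetric])
    then have "?x \<otimes> y \<notin> C" using that by blast
    then show ?thesis using C(2) by (simp add: component_def)
  qed (simp add: component_def)
  ultimately show "\<exists>C. compactin \<T> C \<and> (\<forall>y. y \<notin> C \<longrightarrow> component \<sigma> f y = 0)" by blast
  fix j j' y assume j: "j \<in> J" "j' \<in> J" and y: "y \<in> carrier G"
  have jc: "j \<in> carrier G" "j' \<in> carrier G" using j J_sub by auto
  have mem: "j \<otimes> y \<otimes> j' \<in> Y \<longleftrightarrow> y \<in> Y" using j JY y by (intro subgroup_mult_mem_iff[OF Y]) auto
  \<comment> \<open>Left invariance survives the translation because \<open>j\<close> can be moved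
    past \<open>?x\<close>, at the price of another element \<open>k\<close> of
    \<open>J\<close>.\<close>
  have "?x \<otimes> j \<in> J #> ?x" using j(1) unfolding lift_norm[OF \<sigma>, symmetric] l_coset_def by blast
  then obtain k where k: "k \<in> J" "?x \<otimes> j = k \<otimes> ?x" unfolding r_coset_def by blast
  have kc: "k \<in> carrier G" using k J_sub by blast
  have "?x \<otimes> (j \<otimes> y \<otimes> j') = (?x \<otimes> j) \<otimes> y \<otimes> j'" using x jc y by (simp add: m_assoc)
  also have "\<dots> = k \<otimes> (?x \<otimes> y) \<otimes> j'" unfolding k(2) using kc x jc y by (simp add: m_assoc)
  finally have "f (?x \<otimes> (j \<otimes> y \<otimes> j')) = f (?x \<otimes> y)"
    using hecke_fun_biinv[OF f k(1) j(2), of "?x \<otimes> y"] x y by simp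
  then show "component \<sigma> f (j \<otimes> y \<otimes> j') = component \<sigma> f y" by (simp add: component_def mem)
qed

text \<open>The quotient of \<open>\<sigma>\<close> by \<open>\<tau>\<close> then has an element in
  \<open>Y\<close>. As \<open>Mb\<close> lies in \<open>Y\<close>, the whole coset does, so it
  belongs to both \<open>Waff\<close> and \<open>\<Omega>\<close> and is trivial.\<close>

lemma lift_separates:
  assumes \<sigma>: "\<sigma> \<in> \<Omega>" and \<tau>: "\<tau> \<in> \<Omega>" and mem: "inv (lift \<tau>) \<otimes> lift \<sigma> \<in> Y" shows "\<sigma> = \<tau>"
proof -
  interpret W: group W by (rule W_group)
  note W = Omega_W[OF \<sigma>] Omega_W[OF \<tau>]
  let ?w = "inv\<^bsub>W\<^esub> \<tau> \<otimes>\<^bsub>W\<^esub> \<sigma>"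
  have w: "?w \<in> \<Omega>"
    by (rule subgroup.m_closed[OF Omega_subgroup subgroup.m_inv_closed[OF Omega_subgroup \<tau>] \<sigma>])
  have \<tau>w: "\<tau> <#> ?w = \<sigma>"
    using W by (simp add: W_mult[symmetric] W.m_assoc[symmetric])
  obtain t s where ts: "t \<in> \<tau>" "s \<in> ?w" "lift \<sigma> = t \<otimes> s"
    using lift_mem[OF \<sigma>] \<tau>w unfolding set_mult_def by blast
  have "t \<in> lift \<tau> <# Mb" using ts(1) W_elem(4)[OF W(2) lift_mem[OF \<tau>]] by simp
  then obtain m where m: "m \<in> Mb" "t = lift \<tau> \<otimes> m" unfolding l_coset_def by blast
  have c: "lift \<tau> \<in> carrier G" "m \<in> carrier G" "s \<in> carrier G"
    using lift_carrier[OF \<tau>] subgroup.mem_carrier[OF Mb_subgroup m(1)] W_elem(2)[OF Omega_W[OF w] ts(2)] .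
  have mY: "m \<in> Y" using m MbJ JY by blast
  have "inv (lift \<tau>) \<otimes> lift \<sigma> = m \<otimes> s"
    unfolding ts(3) m(2) using c by (simp add: m_assoc[symmetric])
  then have "inv m \<otimes> (m \<otimes> s) \<in> Y"
    using mem by (intro subgroup.m_closed[OF Y subgroup.m_inv_closed[OF Y mY]]) simp
  then have sY: "s \<in> Y" using c by (simp add: m_assoc[symmetric])
  have "?w \<subseteq> Y"
  proof
    fix z assume "z \<in> ?w"
    then obtain m' where "m' \<in> Mb" "z = m' \<otimes> s"
      using W_elem(3)[OF Omega_W[OF w] ts(2)] unfolding r_coset_def by blast
    then show "z \<in> Y" using sY MbJ JY by (auto intro: subgroup.m_closed[OF Y])
  qed
  then have "?w \<in> Waff \<inter> \<Omega>" using w Omega_W[OF w] by (simp add: Waff)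
  then have "?w = \<one>\<^bsub>W\<^esub>" by (simp add: Waff_Omega W_one)
  then show ?thesis using W by (metis W.inv_closed W.inv_equality W.inv_inv)
qed

lemma component_i:
  assumes \<sigma>: "\<sigma> \<in> \<Omega>" and \<tau>: "\<tau> \<in> \<Omega>" and h: "h \<in> hecke_fun Y"
  shows "component \<sigma> (i \<tau> \<star> h) = (if \<sigma> = \<tau> then h else (\<lambda>_. 0))"
proof
  fix y
  note c = lift_carrier[OF \<sigma>] lift_carrier[OF \<tau>]
  show "component \<sigma> (i \<tau> \<star> h) y = (if \<sigma> = \<tau> then h else (\<lambda>_. 0)) y"
  proof (cases "y \<in> Y")
    case y: True
    then have yc: "y \<in> carrier G" using subgroup.mem_carrier[OF Y] by blast
    have "component \<sigma> (i \<tau> \<star> h) y = h (inv (lift \<tau>) \<otimes> (lift \<sigma> \<otimes> y))"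
      using y yc c conv_i_left[OF \<tau> h, of "lift \<sigma> \<otimes> y"] by (simp add: component_def)
    also have "\<dots> = h (inv (lift \<tau>) \<otimes> lift \<sigma> \<otimes> y)" using c yc by (simp add: m_assoc)
    also have "\<dots> = (if \<sigma> = \<tau> then h else (\<lambda>_. 0)) y"
    proof (cases "\<sigma> = \<tau>")
      case True
      then show ?thesis using c yc by simp
    next
      case False
      have "inv (lift \<tau>) \<otimes> lift \<sigma> \<otimes> y \<notin> Y"
      proof
        assume "inv (lift \<tau>) \<otimes> lift \<sigma> \<otimes> y \<in> Y"
        then have "inv (lift \<tau>) \<otimes> lift \<sigma> \<otimes> y \<otimes> inv y \<in> Y"
          by (rule subgroup.m_closed[OF Y _ subgroup.m_inv_closed[OF Y y]])
        then have "inv (lift \<tau>) \<otimes> lift \<sigma> \<in> Y" using c yc by (simp add: m_assoc)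
        then show False using lift_separates[OF \<sigma> \<tau>] False by blast
      qed
      then show ?thesis using False hecke_fun_support[OF h] by simp
    qed
    finally show ?thesis .
  next
    case False
    then show ?thesis using hecke_fun_support[OF h] by (simp add: component_def)
  qed
qed

text \<open>Write \<open>w\<close> as an affine \<open>a\<close> times \<open>\<sigma>\<close>. By
  normality \<open>w\<close> is also \<open>\<sigma>\<close> times a conjugate of \<open>a\<close>,
  which is affine, so an integer multiple of \<open>i w\<close> is \<open>i \<sigma>\<close>
  convolved with an affine function.\<close>

lemma basis_generates:
  "carrier (add_monoid H) \<subseteq> generate (add_monoid H) (\<Union>\<sigma>\<in>\<Omega>. (\<lambda>h. i \<sigma> \<star> h) ` carrier (add_monoid Haff))"
    (is "_ \<subseteq> ?E")
proof
  interpret W: group W by (rule W_group)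
  have multiple: "(\<lambda>y. of_int z * i w y) \<in> ?E" if w: "w \<in> carrier W" for z :: int and w
  proof -
    obtain a \<sigma> where a: "a \<in> Waff" "\<sigma> \<in> \<Omega>" "w = a \<otimes>\<^bsub>W\<^esub> \<sigma>"
      using w unfolding Waff_mult_Omega[symmetric] set_mult_def by blast
    let ?w = "inv\<^bsub>W\<^esub> \<sigma> \<otimes>\<^bsub>W\<^esub> a \<otimes>\<^bsub>W\<^esub> \<sigma>"
    have c: "a \<in> carrier W" "\<sigma> \<in> carrier W" using a Omega_W by (auto simp: Waff)
    have w': "?w \<in> Waff" using normal.inv_op_closed1[OF Waff_normal c(2) a(1)] .
    have wc: "?w \<in> carrier W" using w' by (simp add: Waff)
    have "\<sigma> \<otimes>\<^bsub>W\<^esub> ?w = w" unfolding a(3) using c by (simp add: W.m_assoc[symmetric])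
    then have eq: "i \<sigma> \<star> i ?w = i w" using i_mult_left[OF a(2) wc] by simp
    let ?h = "\<lambda>y. of_int z * i ?w y"
    have h: "?h \<in> hecke_fun Y" by (rule hecke_fun_int_multiple[OF i_in_Haff[OF w']])
    have "(\<lambda>y. of_int z * i w y) = i \<sigma> \<star> ?h"
    proof
      fix y
      show "of_int z * i w y = (i \<sigma> \<star> ?h) y"
      proof (cases "y \<in> carrier G")
        case True
        then show ?thesis
          using conv_i_left[OF a(2) h True] conv_i_left[OF a(2) i_in_Haff[OF w'] True] by (simp add: eq)
      next
        case False
        then show ?thesis using i_zero_outside[OF w False] by (simp add: convolution_def)
      qed
    qed
    then show ?thesis using a(2) h by (intro generate.incl) auto
  qed
  have finite_sum: "(\<lambda>y. \<Sum>w\<in>K. of_int (z w) * i w y) \<in> ?E"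
    if "finite K" "K \<subseteq> carrier W" for K and z :: "'a set \<Rightarrow> int"
    using that
  proof (induction K rule: finite_induct)
    case empty
    have "\<one>\<^bsub>add_monoid H\<^esub> \<in> ?E" by (rule generate.one)
    moreover have "\<one>\<^bsub>add_monoid H\<^esub> = (\<lambda>y. \<Sum>w\<in>{}. of_int (z w) * i w y)" by simp
    ultimately show ?case by (simp only:)
  next
    case (insert w K)
    have "(\<lambda>y. of_int (z w) * i w y) \<otimes>\<^bsub>add_monoid H\<^esub> (\<lambda>y. \<Sum>w\<in>K. of_int (z w) * i w y) \<in> ?E"
    proof (rule generate.eng)
      show "(\<lambda>y. of_int (z w) * i w y) \<in> ?E" using insert.prems by (intro multiple) blast
      show "(\<lambda>y. \<Sum>w\<in>K. of_int (z w) * i w y) \<in> ?E" using insert.prems by (intro insert.IH) blast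
    qed
    moreover have "(\<lambda>y. of_int (z w) * i w y) \<otimes>\<^bsub>add_monoid H\<^esub> (\<lambda>y. \<Sum>w\<in>K. of_int (z w) * i w y) =
        (\<lambda>y. \<Sum>w\<in>insert w K. of_int (z w) * i w y)"
      using insert.hyps by simp
    ultimately show ?case by (simp only:)
  qed
  fix f assume "f \<in> carrier (add_monoid H)"
  then have f: "f \<in> carrier H" by simp
  have "\<exists>c. Poly_Mapping.keys c \<subseteq> carrier W \<and>
      f = (\<lambda>x. \<Sum>w\<in>Poly_Mapping.keys c. of_int (Poly_Mapping.lookup c w) * i w x)"
    using basis f unfolding int_basis_def by (elim conjE ballE[of _ _ f] ex1E) blast+
  then obtain c where "Poly_Mapping.keys c \<subseteq> carrier W"
    and "f = (\<lambda>x. \<Sum>w\<in>Poly_Mapping.keys c. of_int (Poly_Mapping.lookup c w) * i w x)" by blast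
  then show "f \<in> ?E" using finite_sum[OF finite_keys] by simp
qed

theorem twisted_tensor_product:
  "\<exists>m e. let R = with_multiplication (tensor (free_Abelian_group \<Omega>) (add_monoid Haff)) m e;
             t = pure_tensor (free_Abelian_group \<Omega>) (add_monoid Haff)
    in ring R \<and>
       (\<forall>\<sigma>\<in>\<Omega>. \<forall>\<sigma>'\<in>\<Omega>. \<forall>w\<in>Waff. \<forall>w'\<in>Waff.
          t (frag_of \<sigma>) (i w) \<otimes>\<^bsub>R\<^esub> t (frag_of \<sigma>') (i w') =
          t (frag_of (\<sigma> \<otimes>\<^bsub>W\<^esub> \<sigma>'))
            (i (inv\<^bsub>W\<^esub> \<sigma>' \<otimes>\<^bsub>W\<^esub> w \<otimes>\<^bsub>W\<^esub> \<sigma>') \<otimes>\<^bsub>Haff\<^esub> i w')) \<and>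
       H \<simeq> R"
proof -
  interpret H: ring H by (rule H_ring)
  interpret Haff: ring Haff by (rule Haff_ring)
  interpret W: group W by (rule W_group)
  let ?T = "tensor (free_Abelian_group \<Omega>) (add_monoid Haff)"
  let ?t = "pure_tensor (free_Abelian_group \<Omega>) (add_monoid Haff)"
  have conv_H: "f \<star> g \<in> hecke_fun (carrier G)" if "f \<in> hecke_fun (carrier G)" "g \<in> hecke_fun (carrier G)" for f g
    using that by (rule convolution_in_hecke_fun[OF subgroup_self])
  have assoc: "f \<star> g \<star> h = f \<star> (g \<star> h)"
    if "f \<in> hecke_fun (carrier G)" "g \<in> hecke_fun (carrier G)" "h \<in> hecke_fun (carrier G)" for f g h
    using H.m_assoc[of f g h] that by simp
  have "\<exists>\<Psi>\<in>iso (add_monoid H) ?T. \<forall>\<sigma>\<in>\<Omega>. \<forall>h\<in>carrier (add_monoid Haff). \<Psi> (i \<sigma> \<star> h) = ?t (frag_of \<sigma>) h"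
  proof (rule tensor_free_Abelian_iso[where p = component])
    show "comm_group (add_monoid Haff)" by (rule Haff.a_comm_group)
    show "comm_group (add_monoid H)" by (rule H.a_comm_group)
    show "(\<lambda>h. i \<sigma> \<star> h) \<in> hom (add_monoid Haff) (add_monoid H)" if "\<sigma> \<in> \<Omega>" for \<sigma>
    proof (rule homI)
      note \<sigma> = i_in_H[OF Omega_W[OF that]]
      fix f g assume "f \<in> carrier (add_monoid Haff)" "g \<in> carrier (add_monoid Haff)"
      then have fg: "f \<in> hecke_fun (carrier G)" "g \<in> hecke_fun (carrier G)" by (auto intro: hecke_fun_Y)
      show "i \<sigma> \<star> f \<in> carrier (add_monoid H)" using conv_H[OF \<sigma> fg(1)] by simp
      show "i \<sigma> \<star> (f \<otimes>\<^bsub>add_monoid Haff\<^esub> g) = (i \<sigma> \<star> f) \<otimes>\<^bsub>add_monoid H\<^esub> (i \<sigma> \<star> g)"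
        using H.r_distr[of f g "i \<sigma>"] fg \<sigma> by simp
    qed
    show "component \<sigma> \<in> hom (add_monoid H) (add_monoid Haff)" if "\<sigma> \<in> \<Omega>" for \<sigma>
      by (rule homI) (use component_closed[OF that] in \<open>auto simp: component_def fun_eq_iff\<close>)
    show "component \<sigma> (i \<tau> \<star> h) = (if \<sigma> = \<tau> then h else \<one>\<^bsub>add_monoid Haff\<^esub>)"
      if "\<sigma> \<in> \<Omega>" "\<tau> \<in> \<Omega>" "h \<in> carrier (add_monoid Haff)" for \<sigma> \<tau> h
      using component_i[OF that(1,2), of h] that(3) by simp
    show "carrier (add_monoid H) \<subseteq> generate (add_monoid H) (\<Union>\<sigma>\<in>\<Omega>. (\<lambda>h. i \<sigma> \<star> h) ` carrier (add_monoid Haff))"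
      by (rule basis_generates)
  qed
  then obtain \<Psi> where \<Psi>: "\<Psi> \<in> iso (add_monoid H) ?T"
    and \<Psi>_i: "\<And>\<sigma> h. \<sigma> \<in> \<Omega> \<Longrightarrow> h \<in> hecke_fun Y \<Longrightarrow> \<Psi> (i \<sigma> \<star> h) = ?t (frag_of \<sigma>) h"
    by auto
  have "group_tensor (free_Abelian_group \<Omega>) (add_monoid Haff)"
    by (intro group_tensor.intro group_free_Abelian_group Haff.a_group)
  then have T: "group ?T" using group_tensor.tensor_comm_group comm_group.axioms(2) by blast
  obtain m e where R: "ring (with_multiplication ?T m e)" and iso: "\<Psi> \<in> ring_iso H (with_multiplication ?T m e)"
    using transport_multiplication[OF H_ring T \<Psi>] by blast
  let ?R = "with_multiplication ?T m e"
  have mult: "?t (frag_of \<sigma>) (i w) \<otimes>\<^bsub>?R\<^esub> ?t (frag_of \<sigma>') (i w') =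
      ?t (frag_of (\<sigma> \<otimes>\<^bsub>W\<^esub> \<sigma>')) (i (inv\<^bsub>W\<^esub> \<sigma>' \<otimes>\<^bsub>W\<^esub> w \<otimes>\<^bsub>W\<^esub> \<sigma>') \<otimes>\<^bsub>Haff\<^esub> i w')"
    if \<sigma>: "\<sigma> \<in> \<Omega>" "\<sigma>' \<in> \<Omega>" and w: "w \<in> Waff" "w' \<in> Waff" for \<sigma> \<sigma>' w w'
  proof -
    let ?v = "inv\<^bsub>W\<^esub> \<sigma>' \<otimes>\<^bsub>W\<^esub> w \<otimes>\<^bsub>W\<^esub> \<sigma>'"
    note \<sigma>c = Omega_W[OF \<sigma>(1)] Omega_W[OF \<sigma>(2)]
    have wc: "w \<in> carrier W" "w' \<in> carrier W" using w by (auto simp: Waff)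
    have v: "?v \<in> Waff" by (rule normal.inv_op_closed1[OF Waff_normal \<sigma>c(2) w(1)])
    have vc: "?v \<in> carrier W" using v by (simp add: Waff)
    note in_H = i_in_H[OF \<sigma>c(1)] i_in_H[OF \<sigma>c(2)] i_in_H[OF wc(1)] i_in_H[OF wc(2)] i_in_H[OF vc]
    have \<sigma>\<sigma>': "\<sigma> \<otimes>\<^bsub>W\<^esub> \<sigma>' \<in> \<Omega>" by (rule subgroup.m_closed[OF Omega_subgroup \<sigma>])
    \<comment> \<open>The origin of the twist: moving \<open>i \<sigma>'\<close> to the left
      conjugates \<open>w\<close>, because \<open>w\<close> times \<open>\<sigma>'\<close> equals
      \<open>\<sigma>'\<close> times \<open>?v\<close> in \<open>W\<close>.\<close>
    have swap: "i w \<star> i \<sigma>' = i \<sigma>' \<star> i ?v"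
      unfolding i_mult_right[OF \<sigma>(2) wc(1)] i_mult_left[OF \<sigma>(2) vc]
      using \<sigma>c wc by (simp add: W.m_assoc[symmetric])
    have "i \<sigma> \<star> i w \<star> (i \<sigma>' \<star> i w') = i \<sigma> \<star> (i w \<star> i \<sigma>') \<star> i w'"
      using in_H by (simp add: assoc conv_H)
    also have "\<dots> = i \<sigma> \<star> i \<sigma>' \<star> (i ?v \<star> i w')"
      unfolding swap using in_H by (simp add: assoc conv_H)
    also have "\<dots> = i (\<sigma> \<otimes>\<^bsub>W\<^esub> \<sigma>') \<star> (i ?v \<star> i w')"
      unfolding i_mult_left[OF \<sigma>(1) \<sigma>c(2)] ..
    finally have eq: "i \<sigma> \<star> i w \<star> (i \<sigma>' \<star> i w') = i (\<sigma> \<otimes>\<^bsub>W\<^esub> \<sigma>') \<star> (i ?v \<star> i w')" .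
    have "?t (frag_of \<sigma>) (i w) \<otimes>\<^bsub>?R\<^esub> ?t (frag_of \<sigma>') (i w') = \<Psi> (i \<sigma> \<star> i w) \<otimes>\<^bsub>?R\<^esub> \<Psi> (i \<sigma>' \<star> i w')"
      using \<sigma> w by (simp add: \<Psi>_i i_in_Haff)
    also have "\<dots> = \<Psi> (i \<sigma> \<star> i w \<star> (i \<sigma>' \<star> i w'))"
      using ring_iso_memE(2)[OF iso, of "i \<sigma> \<star> i w" "i \<sigma>' \<star> i w'"] in_H by (simp add: conv_H)
    also have "\<dots> = ?t (frag_of (\<sigma> \<otimes>\<^bsub>W\<^esub> \<sigma>')) (i ?v \<star> i w')"
      unfolding eq by (rule \<Psi>_i[OF \<sigma>\<sigma>' convolution_in_hecke_fun[OF Y i_in_Haff[OF v] i_in_Haff[OF w(2)]]])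
    finally show ?thesis by simp
  qed
  have "H \<simeq> ?R" using iso unfolding is_ring_iso_def by blast
  then show ?thesis unfolding Let_def using R mult by blast
qed

end

section \<open>The Kottwitz kernel and the Iwahori subgroup\<close>

lemma grp_simps [simp]:
  "carrier (grp n X) = X" "x \<otimes>\<^bsub>grp n X\<^esub> y = x * y" "\<one>\<^bsub>grp n X\<^esub> = 1\<^sub>m n"
  by (simp_all add: GL_def units_of_def ring_mat_def)

lemma GL_simps [simp]: "x \<otimes>\<^bsub>GL n\<^esub> y = x * y" "\<one>\<^bsub>GL n\<^esub> = 1\<^sub>m n"
  by (simp_all add: GL_def units_of_def ring_mat_def)

lemma set_mult_grp: "A <#>\<^bsub>GL n\<^esub> B = A <#>\<^bsub>grp n X\<^esub> B"
  by (simp add: set_mult_def)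

lemma subfield_set_range_to_ac: "subfield_set (range (to_ac :: 'f::field \<Rightarrow> 'f alg_closure))"
proof -
  have *: "to_ac x \<in> range (to_ac :: 'f \<Rightarrow> 'f alg_closure)" for x by simp
  show ?thesis
    unfolding subfield_set_def
    using *[of 0] *[of 1] *[of "_ - _"] *[of "_ * _"] *[of "inverse _"] by auto
qed

text \<open>The field is a finite extension of itself, spanned by 1, with the same value group. This
  places the rational points inside the domain of the Kottwitz homomorphism.\<close>

lemma subset_max_unramified:
  assumes "subfield_set F" shows "F \<subseteq> max_unramified v F"
proof -
  have one: "1 \<in> F" using assms by (simp add: subfield_set_def)
  have "\<exists>c. (\<forall>b\<in>{1}. c b \<in> F) \<and> x = (\<Sum>b\<in>{1}. c b * b)" if "x \<in> F" for x
    using that by (intro exI[of _ "\<lambda>_. x"]) simp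
  then have "finite_ext F F"
    unfolding finite_ext_def using assms one
    by (intro conjI exI[of _ "{1}"]) auto
  then show ?thesis unfolding max_unramified_def by blast
qed

text \<open>These unit laws are what \<open>coset_kernel_normal\<close> asks of the cocharacter
  record. The values are matrices of size \<open>d\<close>, and at 0 both sides are
  \<open>undefined\<close>.\<close>

lemma cocharacter_group_one:
  assumes "D \<subseteq> carrier (GL d)" "c \<in> carrier (cocharacter_group d D)"
  shows "\<one>\<^bsub>cocharacter_group d D\<^esub> \<otimes>\<^bsub>cocharacter_group d D\<^esub> c = c"
    and "c \<otimes>\<^bsub>cocharacter_group d D\<^esub> \<one>\<^bsub>cocharacter_group d D\<^esub> = c"
proof -
  have c: "c \<in> (-{0}) \<rightarrow>\<^sub>E D" using assms(2) by (simp add: cocharacter_group_def)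
  have "c t \<in> carrier_mat d d" if "t \<noteq> 0" for t
    using PiE_mem[OF c, of t] assms(1) that by (auto simp: GL_def units_of_def ring_mat_def Units_def)
  then have "1\<^sub>m d * c t = c t" "c t * 1\<^sub>m d = c t" if "t \<noteq> 0" for t
    using that by (blast intro: left_mult_one_mat right_mult_one_mat)+
  then show "\<one>\<^bsub>cocharacter_group d D\<^esub> \<otimes>\<^bsub>cocharacter_group d D\<^esub> c = c"
    "c \<otimes>\<^bsub>cocharacter_group d D\<^esub> \<one>\<^bsub>cocharacter_group d D\<^esub> = c"
    using PiE_arb[OF c] by (auto simp: cocharacter_group_def fun_eq_iff restrict_def)
qed

text \<open>
  The target of a map \<open>\<kappa>\<close> into cosets need not be known to be a group: the image of a group is one,
  and as it contains the coset \<open>R\<close>, which is closed under products, \<open>R\<close> is its unit.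
\<close>

lemma coset_kernel_normal:
  assumes G: "group G" and \<kappa>: "\<And>x y. x \<in> carrier G \<Longrightarrow> y \<in> carrier G \<Longrightarrow> \<kappa> (x \<otimes>\<^bsub>G\<^esub> y) = \<kappa> x <#>\<^bsub>C\<^esub> \<kappa> y"
    and coset: "\<And>x. x \<in> carrier G \<Longrightarrow> \<exists>c\<in>carrier C. \<kappa> x = R #>\<^bsub>C\<^esub> c"
    and one: "\<And>c. c \<in> carrier C \<Longrightarrow> \<one>\<^bsub>C\<^esub> \<otimes>\<^bsub>C\<^esub> c = c \<and> c \<otimes>\<^bsub>C\<^esub> \<one>\<^bsub>C\<^esub> = c"
    and R: "\<one>\<^bsub>C\<^esub> \<in> R" "R <#>\<^bsub>C\<^esub> R \<subseteq> R"
    and ne: "{g \<in> carrier G. \<kappa> g = R} \<noteq> {}"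
  shows "{g \<in> carrier G. \<kappa> g = R} \<lhd> G"
proof -
  interpret G: group G by (rule G)
  obtain g where g: "g \<in> carrier G" "\<kappa> g = R" using ne by blast
  have mono: "A <#>\<^bsub>C\<^esub> S \<subseteq> B <#>\<^bsub>C\<^esub> S" if "A \<subseteq> B" for A B S
    using that unfolding set_mult_def by blast
  have "\<kappa> g = \<kappa> (g \<otimes>\<^bsub>G\<^esub> g \<otimes>\<^bsub>G\<^esub> inv\<^bsub>G\<^esub> g)" using g by (simp add: G.m_assoc)
  also have "\<dots> = (\<kappa> g <#>\<^bsub>C\<^esub> \<kappa> g) <#>\<^bsub>C\<^esub> \<kappa> (inv\<^bsub>G\<^esub> g)" using g(1) by (simp add: \<kappa>)
  also have "\<dots> \<subseteq> \<kappa> g <#>\<^bsub>C\<^esub> \<kappa> (inv\<^bsub>G\<^esub> g)" unfolding g(2) by (rule mono[OF R(2)])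
  also have "\<dots> = \<kappa> (g \<otimes>\<^bsub>G\<^esub> inv\<^bsub>G\<^esub> g)" by (rule \<kappa>[symmetric]) (use g(1) in auto)
  also have "\<dots> = \<kappa> \<one>\<^bsub>G\<^esub>" using g(1) by simp
  finally have "R \<subseteq> \<kappa> \<one>\<^bsub>G\<^esub>" unfolding g(2) .
  \<comment> \<open>For the other inclusion, \<open>\<kappa> \<one>\<close> is a coset of
    \<open>R\<close> with representative \<open>c\<close>. Multiplying by
    \<open>\<kappa> g = R\<close> gives back \<open>R\<close>, which therefore contains
    \<open>c\<close>.\<close>
  obtain c where c: "c \<in> carrier C" "\<kappa> \<one>\<^bsub>G\<^esub> = R #>\<^bsub>C\<^esub> c" using coset[OF G.one_closed] by blast
  have "\<one>\<^bsub>C\<^esub> \<otimes>\<^bsub>C\<^esub> c \<in> \<kappa> \<one>\<^bsub>G\<^esub>" unfolding c(2) r_coset_def using R(1) by blast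
  then have "c \<in> \<kappa> \<one>\<^bsub>G\<^esub>" using one[OF c(1)] by simp
  then have "c \<otimes>\<^bsub>C\<^esub> \<one>\<^bsub>C\<^esub> \<in> \<kappa> \<one>\<^bsub>G\<^esub> <#>\<^bsub>C\<^esub> R" unfolding set_mult_def using R(1) by blast
  also have "\<kappa> \<one>\<^bsub>G\<^esub> <#>\<^bsub>C\<^esub> R = R" using \<kappa>[OF G.one_closed g(1)] g by simp
  finally have "c \<in> R" using one[OF c(1)] by simp
  then have "\<kappa> \<one>\<^bsub>G\<^esub> \<subseteq> R" unfolding c(2) using R(2) unfolding r_coset_def set_mult_def by blast
  with \<open>R \<subseteq> \<kappa> \<one>\<^bsub>G\<^esub>\<close> have unit: "\<kappa> \<one>\<^bsub>G\<^esub> = R" by blast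
  have inv: "\<kappa> (inv\<^bsub>G\<^esub> x) = R" if "x \<in> carrier G" "\<kappa> x = R" for x
  proof -
    have "\<kappa> (inv\<^bsub>G\<^esub> x) = \<kappa> (\<one>\<^bsub>G\<^esub> \<otimes>\<^bsub>G\<^esub> inv\<^bsub>G\<^esub> x)" using that by simp
    also have "\<dots> = \<kappa> \<one>\<^bsub>G\<^esub> <#>\<^bsub>C\<^esub> \<kappa> (inv\<^bsub>G\<^esub> x)" by (rule \<kappa>) (use that in auto)
    also have "\<dots> = \<kappa> x <#>\<^bsub>C\<^esub> \<kappa> (inv\<^bsub>G\<^esub> x)" using that unit by simp
    also have "\<dots> = \<kappa> (x \<otimes>\<^bsub>G\<^esub> inv\<^bsub>G\<^esub> x)" by (rule \<kappa>[symmetric]) (use that in auto)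
    finally show ?thesis using that unit by simp
  qed
  have mult: "\<kappa> (x \<otimes>\<^bsub>G\<^esub> y) = R" if "x \<in> carrier G" "y \<in> carrier G" "\<kappa> x = R" "\<kappa> y = R" for x y
  proof -
    have "\<kappa> (x \<otimes>\<^bsub>G\<^esub> y) = \<kappa> \<one>\<^bsub>G\<^esub> <#>\<^bsub>C\<^esub> \<kappa> \<one>\<^bsub>G\<^esub>" using that by (simp add: \<kappa> unit)
    also have "\<dots> = \<kappa> (\<one>\<^bsub>G\<^esub> \<otimes>\<^bsub>G\<^esub> \<one>\<^bsub>G\<^esub>)" by (rule \<kappa>[symmetric]) auto
    finally show ?thesis using unit by simp
  qed
  show ?thesis
  proof (rule G.normal_invI)
    show "subgroup {g \<in> carrier G. \<kappa> g = R} G"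
      by (rule G.subgroupI) (use g mult inv in auto)
    fix x h assume x: "x \<in> carrier G" and h: "h \<in> {g \<in> carrier G. \<kappa> g = R}"
    have "\<kappa> (x \<otimes>\<^bsub>G\<^esub> h \<otimes>\<^bsub>G\<^esub> inv\<^bsub>G\<^esub> x) = \<kappa> x <#>\<^bsub>C\<^esub> \<kappa> \<one>\<^bsub>G\<^esub> <#>\<^bsub>C\<^esub> \<kappa> (inv\<^bsub>G\<^esub> x)"
      using x h by (simp add: \<kappa> unit)
    also have "\<dots> = \<kappa> (x \<otimes>\<^bsub>G\<^esub> \<one>\<^bsub>G\<^esub> \<otimes>\<^bsub>G\<^esub> inv\<^bsub>G\<^esub> x)"
      using x by (simp only: \<kappa> G.m_closed G.one_closed G.inv_closed)
    also have "\<dots> = R" using x unit by simp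
    finally show "x \<otimes>\<^bsub>G\<^esub> h \<otimes>\<^bsub>G\<^esub> inv\<^bsub>G\<^esub> x \<in> {g \<in> carrier G. \<kappa> g = R}" using x h by simp
  qed
qed

text \<open>The kernel is cut out in the points over the unramified closure, but on rational points
  it is the fibre of the restricted map over the coset \<open>R\<close>. Nonemptiness makes
  \<open>R\<close> a value of the map, from which it is recognized as the unit of the image.\<close>

lemma kottwitz_kernel_normal:
  assumes k: "kottwitz_kernel v F n GG G1" and F: "subfield_set F"
    and G: "group (grp n (points F GG))" and ne: "G1 \<noteq> {}"
  shows "G1 \<lhd> grp n (points F GG)"
proof -
  obtain n' G' p d D q L \<pi> \<kappa> where
    zext: "z_extension F n GG n' G' p d D q"
    and L: "L = max_unramified v F"
    and \<pi>: "\<pi> = cocharacter_group d D Mod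
           kottwitz_relations L n' (kernel (grp n' G') (grp n GG) p) d D q"
    and \<kappa>: "\<kappa> \<in> hom (grp n (points L GG)) \<pi>"
    and G1: "G1 = points F GG \<inter> kernel (grp n (points L GG)) \<pi> \<kappa>"
    using k unfolding kottwitz_kernel_def by (elim exE conjE) (rule that)
  define R where "R = kottwitz_relations L n' (kernel (grp n' G') (grp n GG) p) d D q"
  let ?C = "cocharacter_group d D"
  have D: "D \<subseteq> carrier (GL d)"
    using zext unfolding z_extension_def torus_def alg_group_def by (elim conjE) (rule subgroup.subset)
  have FL: "points F GG \<subseteq> points L GG"
    using subset_max_unramified[OF F, of v] unfolding L points_def by blast
  have "{g \<in> carrier (grp n (points F GG)). \<kappa> g = R} = G1"
    using FL unfolding G1 kernel_def \<pi> R_def FactGroup_def by auto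
  moreover have "{g \<in> carrier (grp n (points F GG)). \<kappa> g = R} \<lhd> grp n (points F GG)"
  proof (rule coset_kernel_normal[OF G, where C = ?C])
    show "\<kappa> (x \<otimes>\<^bsub>grp n (points F GG)\<^esub> y) = \<kappa> x <#>\<^bsub>?C\<^esub> \<kappa> y"
      if "x \<in> carrier (grp n (points F GG))" "y \<in> carrier (grp n (points F GG))" for x y
      using hom_mult[OF \<kappa>, of x y] that FL by (auto simp: \<pi> FactGroup_def)
    show "\<exists>c\<in>carrier ?C. \<kappa> x = R #>\<^bsub>?C\<^esub> c" if "x \<in> carrier (grp n (points F GG))" for x
      using hom_in_carrier[OF \<kappa>, of x] that FL by (auto simp: \<pi> R_def FactGroup_def RCOSETS_def)
    show "\<one>\<^bsub>?C\<^esub> \<otimes>\<^bsub>?C\<^esub> c = c \<and> c \<otimes>\<^bsub>?C\<^esub> \<one>\<^bsub>?C\<^esub> = c" if "c \<in> carrier ?C" for c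
      using cocharacter_group_one[OF D that] by blast
    show "\<one>\<^bsub>?C\<^esub> \<in> R" unfolding R_def kottwitz_relations_def by (rule generate.one)
    show "R <#>\<^bsub>?C\<^esub> R \<subseteq> R" unfolding R_def kottwitz_relations_def set_mult_def by (auto intro: generate.eng)
    show "{g \<in> carrier (grp n (points F GG)). \<kappa> g = R} \<noteq> {}" using calculation ne by simp
  qed
  ultimately show ?thesis by simp
qed

lemma (in group) normalizes_iff_cosets:
  assumes A: "A \<subseteq> carrier G" and x: "x \<in> carrier G"
    and c: "\<And>a. a \<in> A \<Longrightarrow> x \<otimes> a \<otimes> inv x \<in> A" "\<And>a. a \<in> A \<Longrightarrow> inv x \<otimes> a \<otimes> x \<in> A"
  shows "x <# A = A #> x"
proof -
  have "inv x \<otimes> y \<in> A \<longleftrightarrow> y \<otimes> inv x \<in> A" if y: "y \<in> carrier G" for y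
    using c(1)[of "inv x \<otimes> y"] c(2)[of "y \<otimes> inv x"] x y by (auto simp: m_assoc) (simp add: m_assoc[symmetric])
  then have "y \<in> x <# A \<longleftrightarrow> y \<in> A #> x" if "y \<in> carrier G" for y
    using that by (simp only: mem_l_coset_iff[OF A x that] mem_r_coset_iff[OF A x that])
  then show ?thesis using l_coset_subset_G[OF A x] r_coset_subset_G[OF A x] by blast
qed

text \<open>Normalization gives \<open>A <#> B = B <#> A\<close>, so the inverse of a product and a
  product of two products can be reordered.\<close>

lemma (in group) set_mult_subgroup:
  assumes A: "subgroup A G" and B: "subgroup B G" and comm: "\<And>a. a \<in> A \<Longrightarrow> a <# B = B #> a"
  shows "subgroup (A <#> B) G"
proof -
  have sub: "A \<subseteq> carrier G" "B \<subseteq> carrier G" using A B by (auto dest: subgroup.subset)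
  have AB: "A <#> B = B <#> A"
  proof -
    have "A <#> B = (\<Union>a\<in>A. a <# B)" unfolding set_mult_def l_coset_def by blast
    also have "\<dots> = (\<Union>a\<in>A. B #> a)" using comm by simp
    also have "\<dots> = B <#> A" unfolding set_mult_def r_coset_def by blast
    finally show ?thesis .
  qed
  show ?thesis
  proof (rule subgroupI)
    show "A <#> B \<subseteq> carrier G" by (rule set_mult_closed[OF sub])
    show "A <#> B \<noteq> {}"
      using subgroup.one_closed[OF A] subgroup.one_closed[OF B] unfolding set_mult_def by blast
    fix x assume "x \<in> A <#> B"
    then obtain a b where ab: "a \<in> A" "b \<in> B" "x = a \<otimes> b" unfolding set_mult_def by blast
    then have "inv x = inv b \<otimes> inv a" using sub by (simp add: inv_mult_group subset_iff)
    then have "inv x \<in> B <#> A"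
      using subgroup.m_inv_closed[OF A ab(1)] subgroup.m_inv_closed[OF B ab(2)] unfolding set_mult_def by blast
    then show "inv x \<in> A <#> B" by (simp only: AB)
    fix y assume "y \<in> A <#> B"
    with \<open>x \<in> A <#> B\<close> have "x \<otimes> y \<in> (A <#> B) <#> (A <#> B)" unfolding set_mult_def[of G "A <#> B"] by blast
    also have "(A <#> B) <#> (A <#> B) = A <#> (B <#> A) <#> B"
      using sub by (simp add: set_mult_assoc set_mult_closed)
    also have "\<dots> = (A <#> A) <#> (B <#> B)"
      unfolding AB[symmetric] using sub by (simp add: set_mult_assoc set_mult_closed)
    also have "\<dots> = A <#> B" by (simp only: subgroup_mult_id[OF A] subgroup_mult_id[OF B])
    finally show "x \<otimes> y \<in> A <#> B" .
  qed
qed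

lemma (in group) set_mult_normalized:
  assumes x: "x \<in> carrier G" and A: "A \<subseteq> carrier G" "x <# A = A #> x"
    and B: "B \<subseteq> carrier G" "x <# B = B #> x"
  shows "x <# (A <#> B) = A <#> B #> x"
proof -
  have x: "{x} \<subseteq> carrier G" using x by simp
  note eq = A(2) B(2)
  note assoc = set_mult_assoc[OF x A(1) B(1)] set_mult_assoc[OF A(1) x B(1)] set_mult_assoc[OF A(1) B(1) x]
  show ?thesis using eq assoc unfolding l_coset_eq_set_mult r_coset_eq_set_mult by metis
qed

text \<open>If the coset of \<open>x\<close> in \<open>N\<close> lies in \<open>A <#> K\<close>,
  write \<open>x = a \<otimes> k\<close>; then \<open>k = inv a \<otimes> x\<close> is in
  \<open>N\<close>, since \<open>A\<close> is. With \<open>K = G1\<close> this turns the quotient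
  defining \<open>Waff\<close> into a condition on cosets in \<open>W\<close>.\<close>

lemma (in group) carrier_Mod_set_mult:
  assumes N: "subgroup N G" and A: "subgroup A G" "A \<subseteq> N" and K: "subgroup K G"
  shows "carrier (G\<lparr>carrier := A <#> (N \<inter> K)\<rparr> Mod A) = {w \<in> carrier (G\<lparr>carrier := N\<rparr> Mod A). w \<subseteq> A <#> K}"
proof -
  have "{A #> x | x. x \<in> A <#> (N \<inter> K)} = {A #> x | x. x \<in> N \<and> A #> x \<subseteq> A <#> K}"
  proof (intro Collect_cong iffI; elim exE conjE)
    fix w x assume w: "w = A #> x" and "x \<in> A <#> (N \<inter> K)"
    then obtain a k where x: "a \<in> A" "k \<in> N" "k \<in> K" "x = a \<otimes> k" unfolding set_mult_def by blast
    have "b \<otimes> x \<in> A <#> K" if "b \<in> A" for b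
    proof -
      have "b \<otimes> x = (b \<otimes> a) \<otimes> k"
        using that x subgroup.mem_carrier[OF A(1)] subgroup.mem_carrier[OF K] by (simp add: m_assoc)
      then show ?thesis using subgroup.m_closed[OF A(1) that x(1)] x(3) unfolding set_mult_def by blast
    qed
    moreover have "x \<in> N" unfolding x(4) using x A(2) by (intro subgroup.m_closed[OF N]) auto
    ultimately show "\<exists>x. w = A #> x \<and> x \<in> N \<and> A #> x \<subseteq> A <#> K"
      unfolding w r_coset_def by blast
  next
    fix w x assume w: "w = A #> x" and x: "x \<in> N" "A #> x \<subseteq> A <#> K"
    have xG: "x \<in> carrier G" by (rule subgroup.mem_carrier[OF N x(1)])
    then have "x \<in> A <#> K" using x(2) rcos_self[OF _ A(1)] by blast
    then obtain a k where ak: "a \<in> A" "k \<in> K" "x = a \<otimes> k" unfolding set_mult_def by blast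
    have "k = inv a \<otimes> x"
      using ak subgroup.mem_carrier[OF A(1)] subgroup.mem_carrier[OF K] by (simp add: m_assoc[symmetric])
    also have "\<dots> \<in> N"
      using ak(1) A(2) x(1) by (intro subgroup.m_closed[OF N] subgroup.m_inv_closed[OF N]) auto
    finally show "\<exists>x. w = A #> x \<and> x \<in> A <#> (N \<inter> K)" using w ak unfolding set_mult_def by blast
  qed
  also have "\<dots> = {w \<in> {A #> x | x. x \<in> N}. w \<subseteq> A <#> K}" by blast
  moreover have "carrier (G\<lparr>carrier := X\<rparr> Mod A) = {A #> x | x. x \<in> X}" for X
    by (auto simp: FactGroup_def RCOSETS_def r_coset_def)
  ultimately show ?thesis by simp
qed

text \<open>The abstract theorem is applied with \<open>J = Ib\<close> and \<open>Y = G1b\<close>.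
  The main task is to see that \<open>Ib\<close> is a group normalized by all representatives of
  \<open>\<Omega>\<close>. That \<open>Ib\<close> lies in a compact set is read off from the Hecke
  basis, and that \<open>G1\<close> is nonempty from the volume of \<open>Ib\<close>.\<close>

theorem proposition3p13p4:
  fixes \<omega> :: "'f::field \<Rightarrow> int" and n :: nat
    and GG SS :: "'f alg_closure mat set"
    and \<nu> :: "'f alg_closure mat \<Rightarrow> (('f alg_closure mat \<Rightarrow> 'f alg_closure) \<Rightarrow> real) \<Rightarrow>
                (('f alg_closure mat \<Rightarrow> 'f alg_closure) \<Rightarrow> real)"
    and \<B> :: "'b set" and act :: "'f alg_closure mat \<Rightarrow> 'b \<Rightarrow> 'b"
    and \<iota> :: "(('f alg_closure mat \<Rightarrow> 'f alg_closure) \<Rightarrow> real) \<Rightarrow> 'b"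
    and \<aa> :: "(('f alg_closure mat \<Rightarrow> 'f alg_closure) \<Rightarrow> real) set"
    and G1 M1 Mb :: "'f alg_closure mat set"
    and \<mu> :: "'f alg_closure mat measure"
  assumes F_eq: "F = range (to_ac :: 'f \<Rightarrow> 'f alg_closure)"
    and v_eq: "v = ext_val \<omega>"
    and MM_eq: "MM = centralizer_in GG SS"
    and G_eq: "G = points F GG"
    and M_eq: "M = points F MM"
    and N_eq: "N = points F (normalizer_in n GG SS)"
    and TT_eq: "TT = subtopology (mat_topology v n) G"
    and Iw_eq: "Iw = {g \<in> G1. \<forall>x\<in>\<aa>. act g (\<iota> x) = \<iota> x}"
    and Ib_eq: "Ib = Mb <#>\<^bsub>GL n\<^esub> Iw"
    and G1b_eq: "G1b = Mb <#>\<^bsub>GL n\<^esub> G1"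
    and W_eq: "W = grp n N Mod Mb"
    and Waff_eq: "Waff = carrier (grp n (Mb <#>\<^bsub>GL n\<^esub> (N \<inter> G1)) Mod Mb)"
    and Omega_eq: "\<Omega> = {w \<in> carrier W. \<forall>x\<in>w. \<nu> x ` \<aa> = \<aa>}"
    and i_eq: "i = (\<lambda>w. indicator (Ib <#>\<^bsub>GL n\<^esub> w <#>\<^bsub>GL n\<^esub> Ib) :: 'f alg_closure mat \<Rightarrow> real)"
    and H_eq: "H = hecke_ring (grp n G) TT \<mu> Ib G"
    and Haff_eq: "Haff = hecke_ring (grp n G) TT \<mu> Ib G1b"
    and ZO_eq: "ZO = free_Abelian_group \<Omega>"
    and local_field: "nonarch_local_field \<omega>"
    and reductive: "connected_reductive n F GG"
    and max_split: "maximal_split_torus n F GG SS"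
    and apartment: "apartment_action v F n GG SS \<nu>"
    and building: "building F n GG SS \<nu> \<B> act \<iota>"
    and alcove: "\<aa> \<in> alcoves F n GG SS \<nu>"
    and M1: "kottwitz_kernel v F n MM M1"
    and G1: "kottwitz_kernel v F n GG G1"
    and Mb: "subgroup Mb (grp n M)" "openin (subtopology TT M) Mb" "compactin (subtopology TT M) Mb"
      "M1 \<subseteq> Mb"
    and haar: "haar_measure (grp n G) TT \<mu>" "emeasure \<mu> Ib = 1"
    and normal: "Mb \<lhd> grp n N"
    and semidirect: "semidirect W Waff \<Omega>"
    and basis: "int_basis (carrier W) i (carrier H)"
  shows "\<exists>m e. let R = with_multiplication (tensor ZO (add_monoid Haff)) m e;
                   t = pure_tensor ZO (add_monoid Haff)
    in ring R \<and>
       (\<forall>\<sigma>\<in>\<Omega>. \<forall>\<sigma>'\<in>\<Omega>. \<forall>w\<in>Waff. \<forall>w'\<in>Waff.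
          t (frag_of \<sigma>) (i w) \<otimes>\<^bsub>R\<^esub> t (frag_of \<sigma>') (i w') =
          t (frag_of (\<sigma> \<otimes>\<^bsub>W\<^esub> \<sigma>'))
            (i (inv\<^bsub>W\<^esub> \<sigma>' \<otimes>\<^bsub>W\<^esub> w \<otimes>\<^bsub>W\<^esub> \<sigma>') \<otimes>\<^bsub>Haff\<^esub> i w')) \<and>
       H \<simeq> R"
proof -
  let ?P = "grp n G"
  let ?V = "apartment_space n GG SS"
  note bld = building[unfolded building_def Let_def, folded G_eq N_eq]
  have action: "group_action ?P \<B> act" using bld by (elim conjE)
  interpret action: group_action ?P \<B> act by (rule action)
  have P: "group ?P"
    using action unfolding group_action_def group_hom_def by blast
  interpret P: group ?P by (rule P)
  have GG_sub: "subgroup GG (GL n)"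
    using reductive unfolding connected_reductive_def alg_group_def by (elim conjE)
  have G_mat: "G \<subseteq> carrier_mat n n"
    using subgroup.subset[OF GG_sub] unfolding G_eq points_def
    by (auto simp: GL_def units_of_def ring_mat_def Units_def)
  \<comment> \<open>Normality of \<open>Mb\<close> in \<open>N\<close> includes that
    \<open>N\<close> is a group.\<close>
  have N_grp: "group (grp n N)" by (rule normal.axioms(2)[OF normal])
  have N_sub: "N \<subseteq> G" unfolding N_eq G_eq points_def normalizer_in_def by blast
  have N: "subgroup N ?P"
    using P.group_incl_imp_subgroup[of N] N_sub N_grp by simp
  have MbN: "subgroup Mb (grp n N)" by (rule normal.axioms(1)[OF normal])
  have Mb_sub_N: "Mb \<subseteq> N" using subgroup.subset[OF MbN] by simp
  have Mb_P: "subgroup Mb ?P" using P.incl_subgroup[OF N] MbN by simp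
  have one_G: "1\<^sub>m n \<in> G" using P.one_closed by simp
  have one_Mb: "1\<^sub>m n \<in> Mb" using subgroup.one_closed[OF Mb_P] by simp

  have W_one: "\<one>\<^bsub>W\<^esub> = Mb" by (simp add: W_eq FactGroup_def)
  have Mb_W: "Mb \<in> carrier W"
  proof -
    have "Mb #>\<^bsub>grp n N\<^esub> 1\<^sub>m n = Mb" using group.coset_mult_one[OF N_grp, of Mb] Mb_sub_N by simp
    then show ?thesis
      using subgroup.one_closed[OF N] by (auto simp: W_eq FactGroup_def RCOSETS_def intro!: bexI[of _ "1\<^sub>m n"])
  qed
  have Omega: "subgroup \<Omega> W" using semidirect unfolding semidirect_def by blast
  have Mb_Omega: "Mb \<in> \<Omega>" using subgroup.one_closed[OF Omega] by (simp add: W_one)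
  have stab: "\<nu> x ` \<aa> = \<aa>" if "\<sigma> \<in> \<Omega>" "x \<in> \<sigma>" for \<sigma> x using that unfolding Omega_eq by blast
  have \<sigma>_N: "x \<in> N" if \<sigma>: "\<sigma> \<in> \<Omega>" "x \<in> \<sigma>" for \<sigma> x
  proof -
    obtain y where "y \<in> N" "\<sigma> = Mb #>\<^bsub>grp n N\<^esub> y"
      using subgroup.mem_carrier[OF Omega \<sigma>(1)] by (auto simp: W_eq FactGroup_def RCOSETS_def r_coset_def)
    then show ?thesis
      using \<sigma>(2) subgroup.m_closed[OF N] Mb_sub_N unfolding r_coset_def by auto
  qed

  have aV: "\<aa> \<subseteq> ?V" using in_components_subset[OF alcove[unfolded alcoves_def]] by blast
  have act_N: "act g (\<iota> x) = \<iota> (\<nu> g x)" if "g \<in> N" "x \<in> ?V" for g x using bld that by blast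
  have act_G: "act g (\<iota> x) \<in> \<B>" if "g \<in> G" "x \<in> ?V" for g x
  proof -
    have "\<B> = (\<Union>g\<in>G. act g ` \<iota> ` ?V)" using bld by blast
    then show ?thesis using that by blast
  qed
  \<comment> \<open>The building is given as a union of translates \<open>act g\<close> of the
    embedded apartment, so \<open>\<iota> y\<close> has to be exhibited in one. The unit lies in the
    coset \<open>Mb\<close>, an element of \<open>\<Omega>\<close>, so \<open>\<nu>\<close> at the
    unit maps the alcove onto itself and \<open>\<iota> y\<close> is the unit applied to some
    \<open>\<iota> z\<close>.\<close>
  have \<iota>_mem: "\<iota> y \<in> \<B>" if y: "y \<in> \<aa>" for y
  proof -
    obtain z where z: "z \<in> \<aa>" "y = \<nu> (1\<^sub>m n) z" using stab[OF Mb_Omega one_Mb] y by blast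
    have "act (1\<^sub>m n) (\<iota> z) = \<iota> y" using act_N[of "1\<^sub>m n" z] z aV one_Mb Mb_sub_N by auto
    then show ?thesis using act_G[OF one_G, of z] z aV by auto
  qed
  have act_mult: "act (g * h) b = act g (act h b)" if "g \<in> G" "h \<in> G" "b \<in> \<B>" for g h b
    using action.composition_rule[of b g h] that by simp
  have act_one: "act (1\<^sub>m n) b = b" if "b \<in> \<B>" for b
    using action.id_eq_one that by (metis grp_simps(3) restrict_apply')
  have act_inv: "act (inv\<^bsub>?P\<^esub> g) (act g b) = b" if "g \<in> G" "b \<in> \<B>" for g b
    using act_mult[of "inv\<^bsub>?P\<^esub> g" g b] P.l_inv[of g] P.inv_closed[of g] that act_one by simp

  \<comment> \<open>A set of volume 1 is not empty, hence neither is its factor \<open>Iw\<close>,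
    which lies in \<open>G1\<close>.\<close>
  have "Ib \<noteq> {}" using haar(2) by force
  then have "G1 \<noteq> {}" unfolding Ib_eq Iw_eq set_mult_def by blast
  then have G1n: "G1 \<lhd> ?P"
    using kottwitz_kernel_normal[OF G1] subfield_set_range_to_ac P unfolding F_eq G_eq by blast
  have G1s: "subgroup G1 ?P" by (rule normal.axioms(1)[OF G1n])
  have G1_sub: "G1 \<subseteq> G" using subgroup.subset[OF G1s] by simp

  have Iw_sub: "Iw \<subseteq> G" using G1_sub unfolding Iw_eq by blast
  have Iw: "subgroup Iw ?P"
  proof (rule P.subgroupI)
    show "Iw \<subseteq> carrier ?P" using Iw_sub by simp
    have "1\<^sub>m n \<in> Iw"
      using subgroup.one_closed[OF G1s] act_one \<iota>_mem unfolding Iw_eq by simp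
    then show "Iw \<noteq> {}" by blast
    fix g assume g: "g \<in> Iw"
    then have gG: "g \<in> G" using Iw_sub by blast
    have "act (inv\<^bsub>?P\<^esub> g) (\<iota> y) = \<iota> y" if "y \<in> \<aa>" for y
      using act_inv[OF gG \<iota>_mem[OF that]] g that unfolding Iw_eq by simp
    then show "inv\<^bsub>?P\<^esub> g \<in> Iw"
      using subgroup.m_inv_closed[OF G1s, of g] g unfolding Iw_eq by blast
    fix h assume h: "h \<in> Iw"
    then have hG: "h \<in> G" using Iw_sub by blast
    have "act (g * h) (\<iota> y) = \<iota> y" if "y \<in> \<aa>" for y
      using act_mult[OF gG hG \<iota>_mem[OF that]] g h that unfolding Iw_eq by simp
    moreover have "g * h \<in> G1" using subgroup.m_closed[OF G1s, of g h] g h unfolding Iw_eq by simp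
    ultimately show "g \<otimes>\<^bsub>?P\<^esub> h \<in> Iw" unfolding Iw_eq by simp
  qed
  \<comment> \<open>\<open>x\<close> permutes the points of the alcove, so conjugation by
    \<open>x\<close> preserves their common fixer; it preserves \<open>G1\<close> by
    normality.\<close>
  have Iw_norm: "x <#\<^bsub>?P\<^esub> Iw = Iw #>\<^bsub>?P\<^esub> x" if \<sigma>: "\<sigma> \<in> \<Omega>" "x \<in> \<sigma>" for \<sigma> x
  proof (rule P.normalizes_iff_cosets)
    have xN: "x \<in> N" by (rule \<sigma>_N[OF \<sigma>])
    then have xG: "x \<in> G" using N_sub by blast
    have ixG: "inv\<^bsub>?P\<^esub> x \<in> G" using P.inv_closed[of x] xG by simp
    have x_act: "act x (\<iota> z) = \<iota> (\<nu> x z)" "\<nu> x z \<in> \<aa>" if "z \<in> \<aa>" for z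
      using act_N[OF xN, of z] that aV stab[OF \<sigma>] by auto
    have ix_act: "act (inv\<^bsub>?P\<^esub> x) (\<iota> (\<nu> x z)) = \<iota> z" if "z \<in> \<aa>" for z
      using act_inv[OF xG \<iota>_mem[OF that]] x_act(1)[OF that] by simp
    show "Iw \<subseteq> carrier ?P" using Iw_sub by simp
    show "x \<in> carrier ?P" using xG by simp
    fix g assume g: "g \<in> Iw"
    then have gG: "g \<in> G" and g1: "g \<in> G1" and g_act: "\<And>y. y \<in> \<aa> \<Longrightarrow> act g (\<iota> y) = \<iota> y"
      using Iw_sub unfolding Iw_eq by blast+
    have gx: "x * g \<in> G" "inv\<^bsub>?P\<^esub> x * g \<in> G"
      using P.m_closed[of x g] P.m_closed[of "inv\<^bsub>?P\<^esub> x" g] xG ixG gG by auto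
    have "act (x * g * inv\<^bsub>?P\<^esub> x) (\<iota> y) = \<iota> y" if y: "y \<in> \<aa>" for y
    proof -
      obtain z where z: "z \<in> \<aa>" "y = \<nu> x z" using stab[OF \<sigma>] y by blast
      have "act (x * g * inv\<^bsub>?P\<^esub> x) (\<iota> y) = act (x * g) (\<iota> z)"
        using act_mult[OF gx(1) ixG \<iota>_mem[OF y]] ix_act[OF z(1)] z(2) by simp
      also have "\<dots> = act x (\<iota> z)" using act_mult[OF xG gG \<iota>_mem[OF z(1)]] g_act[OF z(1)] by simp
      finally show ?thesis using x_act(1)[OF z(1)] z(2) by simp
    qed
    moreover have "x * g * inv\<^bsub>?P\<^esub> x \<in> G1" using normal.inv_op_closed2[OF G1n, of x g] xG g1 by simp
    ultimately show "x \<otimes>\<^bsub>?P\<^esub> g \<otimes>\<^bsub>?P\<^esub> inv\<^bsub>?P\<^esub> x \<in> Iw" unfolding Iw_eq by simp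
    have "act (inv\<^bsub>?P\<^esub> x * g * x) (\<iota> y) = \<iota> y" if y: "y \<in> \<aa>" for y
    proof -
      note xy = x_act[OF y]
      have "act (inv\<^bsub>?P\<^esub> x * g * x) (\<iota> y) = act (inv\<^bsub>?P\<^esub> x * g) (\<iota> (\<nu> x y))"
        using act_mult[OF gx(2) xG \<iota>_mem[OF y]] xy(1) by simp
      also have "\<dots> = act (inv\<^bsub>?P\<^esub> x) (\<iota> (\<nu> x y))"
        using act_mult[OF ixG gG \<iota>_mem[OF xy(2)]] g_act[OF xy(2)] by simp
      finally show ?thesis using ix_act[OF y] by simp
    qed
    moreover have "inv\<^bsub>?P\<^esub> x * g * x \<in> G1" using normal.inv_op_closed1[OF G1n, of x g] xG g1 by simp
    ultimately show "inv\<^bsub>?P\<^esub> x \<otimes>\<^bsub>?P\<^esub> g \<otimes>\<^bsub>?P\<^esub> x \<in> Iw" unfolding Iw_eq by simp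
  qed

  have Ib_P: "Ib = Mb <#>\<^bsub>?P\<^esub> Iw" unfolding Ib_eq by (rule set_mult_grp)
  have Ib: "subgroup Ib ?P"
    \<comment> \<open>\<open>Mb\<close>, as the unit coset, belongs to \<open>\<Omega>\<close>, so
      all its elements normalize \<open>Iw\<close>.\<close>
    unfolding Ib_P by (rule P.set_mult_subgroup[OF Mb_P Iw Iw_norm[OF Mb_Omega]])
  have Mb_comm: "x <#\<^bsub>?P\<^esub> Mb = Mb #>\<^bsub>?P\<^esub> x" if "x \<in> N" for x
    using normal.coset_eq[OF normal] that by (simp add: r_coset_def l_coset_def)
  have Ib_norm: "x <#\<^bsub>?P\<^esub> Ib = Ib #>\<^bsub>?P\<^esub> x" if \<sigma>: "\<sigma> \<in> \<Omega>" "x \<in> \<sigma>" for \<sigma> x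
  proof -
    have xN: "x \<in> N" by (rule \<sigma>_N[OF \<sigma>])
    have "x \<in> carrier ?P" "Mb \<subseteq> carrier ?P" "Iw \<subseteq> carrier ?P"
      using xN N_sub Mb_sub_N Iw_sub by auto
    then show ?thesis unfolding Ib_P by (intro P.set_mult_normalized Mb_comm[OF xN] Iw_norm[OF \<sigma>])
  qed
  have Mb_Ib: "Mb \<subseteq> Ib"
  proof
    fix m assume m: "m \<in> Mb"
    have "m \<otimes>\<^bsub>?P\<^esub> \<one>\<^bsub>?P\<^esub> \<in> Ib"
      unfolding Ib_P set_mult_def using m subgroup.one_closed[OF Iw] by blast
    then show "m \<in> Ib" using m Mb_sub_N N_sub P.r_one[of m] by auto
  qed

  have G1b_P: "G1b = Mb <#>\<^bsub>?P\<^esub> G1" unfolding G1b_eq by (rule set_mult_grp)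
  have G1b: "subgroup G1b ?P"
    unfolding G1b_P using P.mult_norm_subgroup[OF G1n Mb_P] P.commut_normal[OF Mb_P G1n] by simp
  have Ib_G1b: "Ib \<subseteq> G1b" unfolding Ib_P G1b_P set_mult_def Iw_eq by blast

  have i_P: "i = (\<lambda>w. indicator (Ib <#>\<^bsub>?P\<^esub> w <#>\<^bsub>?P\<^esub> Ib))"
    unfolding i_eq by (simp add: set_mult_def)
  \<comment> \<open>The basis function of the unit coset is the indicator of a double coset that
    contains \<open>Ib\<close>, and it has compact support as a member of the Hecke ring.\<close>
  have bounded: "\<exists>C. compactin TT C \<and> Ib \<subseteq> C"
  proof -
    have "i Mb \<in> carrier H" using basis Mb_W unfolding int_basis_def by blast
    then obtain C where C: "compactin TT C" "\<And>x. x \<notin> C \<Longrightarrow> i Mb x = 0"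
      unfolding H_eq hecke_ring_def by auto
    have "Ib \<subseteq> Ib <#>\<^bsub>?P\<^esub> Mb <#>\<^bsub>?P\<^esub> Ib"
    proof
      fix x assume x: "x \<in> Ib"
      have "\<one>\<^bsub>?P\<^esub> \<otimes>\<^bsub>?P\<^esub> \<one>\<^bsub>?P\<^esub> \<otimes>\<^bsub>?P\<^esub> x \<in> Ib <#>\<^bsub>?P\<^esub> Mb <#>\<^bsub>?P\<^esub> Ib"
        unfolding set_mult_def using x subgroup.one_closed[OF Ib] subgroup.one_closed[OF Mb_P] by blast
      then show "x \<in> Ib <#>\<^bsub>?P\<^esub> Mb <#>\<^bsub>?P\<^esub> Ib"
        using subgroup.mem_carrier[OF Ib x] by (metis P.l_one P.one_closed)
    qed
    then have "Ib \<subseteq> C" using C(2) by (force simp: i_P indicator_def)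
    then show ?thesis using C(1) by blast
  qed

  have v: "valuation v" unfolding v_eq by (rule ext_val_valuation[OF local_field])
  have top: "topspace TT = G" using G_mat by (auto simp: TT_eq)
  have "hecke_pair ?P TT \<mu> Ib"
  proof (intro hecke_pair.intro hecke_pair_axioms.intro)
    show "topspace TT = carrier ?P" using top by simp
    show "Hausdorff_space TT"
      unfolding TT_eq by (rule Hausdorff_space_subtopology[OF Hausdorff_mat_topology[OF v]])
    show "continuous_map TT TT (\<lambda>x. g \<otimes>\<^bsub>?P\<^esub> x)" if "g \<in> carrier ?P" for g
    proof -
      have "continuous_map TT (mat_topology v n) (\<lambda>x. g * x)"
        unfolding TT_eq using that G_mat
        by (intro continuous_map_from_subtopology continuous_map_mat_mult[OF v]) auto
      moreover have "(\<lambda>x. g * x) \<in> topspace TT \<rightarrow> G" using P.m_closed[of g] that top by auto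
      ultimately have "continuous_map TT (subtopology (mat_topology v n) G) (\<lambda>x. g * x)"
        by (simp add: continuous_map_in_subtopology image_subset_iff_funcset)
      then show ?thesis by (simp add: TT_eq)
    qed
  qed (use P haar Ib bounded in auto)
  moreover have "hecke_semidirect_axioms ?P TT \<mu> Ib N Mb G1b \<Omega> Waff W i"
  proof (rule hecke_semidirect_axioms.intro)
    show "Waff = {w \<in> carrier W. w \<subseteq> G1b}"
      using P.carrier_Mod_set_mult[OF N Mb_P Mb_sub_N G1s]
      unfolding Waff_eq W_eq G1b_P set_mult_grp[of _ _ _ G] by simp
    show "int_basis (carrier W) i (carrier (hecke_ring ?P TT \<mu> Ib (carrier ?P)))"
      using basis unfolding H_eq by simp
  qed (use N normal Mb_Ib G1b Ib_G1b W_eq semidirect Ib_norm i_P in auto)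
  ultimately have "hecke_semidirect ?P TT \<mu> Ib N Mb G1b \<Omega> Waff W i"
    by (rule hecke_semidirect.intro)
  from hecke_semidirect.twisted_tensor_product[OF this]
  show ?thesis unfolding H_eq Haff_eq ZO_eq by simp
qed

end
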